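(* Let $(M,J,D)$ be a manifold with an almost complex structure $J$ and a linear connection $D$, and let $J^{\pm}$ be the almost complex structures on $T^*M$ defined by $D$ and $\mathcal J^{\pm}=\begin{pmatrix}J&0\\0&\pm J^*\end{pmatrix}$. (i) If $(J,D)$ is a special complex structure, i.e. $J$ is integrable and $D$ is flat and torsion-free with $$(d^DJ)_{X,Y}:=D_X(J)(Y)-D_Y(J)(X)=0,\quad\forall X,Y\in TM,$$ then $J^+$ is integrable. (ii) If $D=D^g$ is the Levi-Civita connection of an almost Hermitian structure $(g,J)$, then $J^+$ is integrable if and only if $(g,J)$ is Kähler, and $J^-$ is integrable if and only if $J$ is integrable and the curvature of $g$ satisfies $$(R^D_{X,Y}-R^D_{JX,JY})(Z)-(R^D_{JX,Y}+R^D_{X,JY})(JZ)=0,\quad\forall X,Y,Z\in TM.$$ (iii) If $D$ is the Chern connection of a Hermitian structure $(J,g)$, then both $J^{+}$ and $J^-$ are integrable.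
   Context: $J^*\xi=\xi\circ J$ for $\xi\in T^*M$. The connection $D$, acting on $\pi:T^*M\to M$, induces a decomposition $T(T^*M)=H^D\oplus T^{\mathrm{vert}}(T^*M)\cong\pi^*(TM)\oplus\pi^*(T^*M)=\pi^*(TM\oplus T^*M)$ into horizontal and vertical bundles. The almost complex structure on $T^*M$ defined by $D$ and a field $\mathcal J$ of endomorphisms of $TM\oplus T^*M$ with $\mathcal J^2=-\mathrm{Id}$ is $\pi^*(\mathcal J)$ under this identification. $R^D_{X,Y}=-D_XD_Y+D_YD_X+D_{[X,Y]}$ is the curvature. *)

theory Defs
  imports "HOL-Analysis.Analysis" "HOL-Library.Function_Algebras"
begin

section \<open>Smooth maps between Euclidean spaces\<close>

primrec C_k_on :: "nat \<Rightarrow> 'e::euclidean_space set \<Rightarrow> ('e \<Rightarrow> 'b::real_normed_vector) \<Rightarrow> bool" where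
  "C_k_on 0 S f \<longleftrightarrow> continuous_on S f"
| "C_k_on (Suc k) S f \<longleftrightarrow> (\<forall>x\<in>S. f differentiable (at x)) \<and>
     (\<forall>v. C_k_on k S (\<lambda>x. frechet_derivative f (at x) v))"

text \<open>Only used for open \<open>S\<close>.\<close>

definition smooth_on :: "'e::euclidean_space set \<Rightarrow> ('e \<Rightarrow> 'b::real_normed_vector) \<Rightarrow> bool" where
  "smooth_on S f \<longleftrightarrow> (\<forall>k. C_k_on k S f)"


section \<open>Manifolds\<close>

text \<open>A manifold is a set with a smooth atlas. It is represented by the atlas alone: the underlying
  set is the union of the chart domains, and the topology is the one making the charts
  homeomorphisms onto their open images. The dimension is that of the model space \<open>'e\<close>.\<close>

type_synonym ('a, 'e) chart = "'a set \<times> ('a \<Rightarrow> 'e)"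

definition points :: "('a, 'e) chart set \<Rightarrow> 'a set" where
  "points A = \<Union> (fst ` A)"

definition manifold_topology :: "('a, 'e::euclidean_space) chart set \<Rightarrow> 'a topology" where
  "manifold_topology A = topology_generated_by {U \<inter> \<phi> -` V | U \<phi> V. (U, \<phi>) \<in> A \<and> open V}"

definition smooth_atlas :: "('a, 'e::euclidean_space) chart set \<Rightarrow> bool" where
  "smooth_atlas A \<longleftrightarrow>
     (\<forall>(U, \<phi>)\<in>A. inj_on \<phi> U \<and> open (\<phi> ` U)) \<and>
     (\<forall>(U, \<phi>)\<in>A. \<forall>(V, \<psi>)\<in>A. open (\<phi> ` (U \<inter> V)) \<and> smooth_on (\<phi> ` (U \<inter> V)) (\<psi> \<circ> inv_into U \<phi>))"

definition smooth_manifold :: "('a, 'e::euclidean_space) chart set \<Rightarrow> bool" where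
  "smooth_manifold A \<longleftrightarrow> smooth_atlas A \<and>
     Hausdorff_space (manifold_topology A) \<and> second_countable (manifold_topology A)"

definition smooth_near :: "('a, 'e::euclidean_space) chart set \<Rightarrow> 'a \<Rightarrow> ('a \<Rightarrow> real) \<Rightarrow> bool" where
  "smooth_near A p f \<longleftrightarrow> (\<exists>(U, \<phi>)\<in>A. p \<in> U \<and>
     (\<exists>W. open W \<and> \<phi> p \<in> W \<and> W \<subseteq> \<phi> ` U \<and> smooth_on W (f \<circ> inv_into U \<phi>)))"

definition smooth_function :: "('a, 'e::euclidean_space) chart set \<Rightarrow> ('a \<Rightarrow> real) \<Rightarrow> bool" where
  "smooth_function A f \<longleftrightarrow> (\<forall>p\<in>points A. smooth_near A p f)"


section \<open>Tangent and cotangent spaces\<close>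

text \<open>A tangent vector at \<open>p\<close> is a directional derivative, acting on functions that are smooth near
  \<open>p\<close>. On all other functions it is set to \<open>0\<close>, so that it is determined as a HOL function.\<close>

type_synonym 'a tvec = "('a \<Rightarrow> real) \<Rightarrow> real"
type_synonym 'a covec = "'a tvec \<Rightarrow> real"

definition chart_tvec ::
    "('a, 'e::euclidean_space) chart set \<Rightarrow> ('a, 'e) chart \<Rightarrow> 'a \<Rightarrow> 'e \<Rightarrow> 'a tvec" where
  "chart_tvec A = (\<lambda>(U, \<phi>) p v f.
     if smooth_near A p f then frechet_derivative (f \<circ> inv_into U \<phi>) (at (\<phi> p)) v else 0)"

definition tangent_space :: "('a, 'e::euclidean_space) chart set \<Rightarrow> 'a \<Rightarrow> 'a tvec set" where
  "tangent_space A p = {chart_tvec A c p v | c v. c \<in> A \<and> p \<in> fst c}"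

text \<open>Sums and differences of tangent vectors, covectors and fields of these are the pointwise ones
  of \<^theory>\<open>HOL-Library.Function_Algebras\<close>. Note that for \<open>p\<close> outside the manifold the tangent
  space is empty.\<close>

definition scale :: "real \<Rightarrow> ('b \<Rightarrow> real) \<Rightarrow> ('b \<Rightarrow> real)" where
  "scale r v = (\<lambda>x. r * v x)"

definition cotangent_space :: "('a, 'e::euclidean_space) chart set \<Rightarrow> 'a \<Rightarrow> 'a covec set" where
  "cotangent_space A p = {\<xi>.
     (\<forall>v\<in>tangent_space A p. \<forall>w\<in>tangent_space A p. \<xi> (v + w) = \<xi> v + \<xi> w) \<and>
     (\<forall>r. \<forall>v\<in>tangent_space A p. \<xi> (scale r v) = r * \<xi> v) \<and>
     (\<forall>v. v \<notin> tangent_space A p \<longrightarrow> \<xi> v = 0)}"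

definition pushforward ::
    "('b, 'f::euclidean_space) chart set \<Rightarrow> ('a \<Rightarrow> 'b) \<Rightarrow> 'a \<Rightarrow> 'a tvec \<Rightarrow> 'b tvec" where
  "pushforward B F p v = (\<lambda>f. if smooth_near B (F p) f then v (f \<circ> F) else 0)"


section \<open>Vector fields, forms and fields of endomorphisms\<close>

text \<open>All fields vanish outside the manifold; the values of fields of endomorphisms vanish outside
  the tangent spaces.\<close>

type_synonym 'a vfield = "'a \<Rightarrow> 'a tvec"
type_synonym 'a one_form = "'a \<Rightarrow> 'a covec"
type_synonym 'a endo_field = "'a \<Rightarrow> 'a tvec \<Rightarrow> 'a tvec"

definition vector_fields :: "('a, 'e::euclidean_space) chart set \<Rightarrow> 'a vfield set" where
  "vector_fields A = {X.
     (\<forall>p\<in>points A. X p \<in> tangent_space A p) \<and>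
     (\<forall>p. p \<notin> points A \<longrightarrow> X p = 0) \<and>
     (\<forall>p\<in>points A. \<forall>f. smooth_near A p f \<longrightarrow> smooth_near A p (\<lambda>q. X q f))}"

definition one_forms :: "('a, 'e::euclidean_space) chart set \<Rightarrow> 'a one_form set" where
  "one_forms A = {\<alpha>.
     (\<forall>p\<in>points A. \<alpha> p \<in> cotangent_space A p) \<and>
     (\<forall>p. p \<notin> points A \<longrightarrow> \<alpha> p = 0) \<and>
     (\<forall>X\<in>vector_fields A. smooth_function A (\<lambda>p. \<alpha> p (X p)))}"

definition fscale :: "('a \<Rightarrow> real) \<Rightarrow> 'a vfield \<Rightarrow> 'a vfield" where
  "fscale f X = (\<lambda>p. scale (f p) (X p))"

definition app :: "'a endo_field \<Rightarrow> 'a vfield \<Rightarrow> 'a vfield" where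
  "app J X = (\<lambda>p. J p (X p))"

definition lie_bracket ::
    "('a, 'e::euclidean_space) chart set \<Rightarrow> 'a vfield \<Rightarrow> 'a vfield \<Rightarrow> 'a vfield" where
  "lie_bracket A X Y = (\<lambda>p f.
     if smooth_near A p f then X p (\<lambda>q. Y q f) - Y p (\<lambda>q. X q f) else 0)"

definition endomorphism_field :: "('a, 'e::euclidean_space) chart set \<Rightarrow> 'a endo_field \<Rightarrow> bool" where
  "endomorphism_field A J \<longleftrightarrow>
     (\<forall>p\<in>points A.
        (\<forall>v\<in>tangent_space A p. J p v \<in> tangent_space A p) \<and>
        (\<forall>v\<in>tangent_space A p. \<forall>w\<in>tangent_space A p. J p (v + w) = J p v + J p w) \<and>
        (\<forall>r. \<forall>v\<in>tangent_space A p. J p (scale r v) = scale r (J p v))) \<and>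
     (\<forall>p v. v \<notin> tangent_space A p \<longrightarrow> J p v = 0) \<and>
     (\<forall>X\<in>vector_fields A. app J X \<in> vector_fields A)"


section \<open>Almost complex structures\<close>

definition almost_complex_structure ::
    "('a, 'e::euclidean_space) chart set \<Rightarrow> 'a endo_field \<Rightarrow> bool" where
  "almost_complex_structure A J \<longleftrightarrow> endomorphism_field A J \<and>
     (\<forall>p\<in>points A. \<forall>v\<in>tangent_space A p. J p (J p v) = - v)"

definition nijenhuis ::
    "('a, 'e::euclidean_space) chart set \<Rightarrow> 'a endo_field \<Rightarrow> 'a vfield \<Rightarrow> 'a vfield \<Rightarrow> 'a vfield" where
  "nijenhuis A J X Y = lie_bracket A (app J X) (app J Y) - app J (lie_bracket A (app J X) Y)
     - app J (lie_bracket A X (app J Y)) - lie_bracket A X Y"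

text \<open>Integrability is taken in the differential-geometric sense of a vanishing Nijenhuis tensor.\<close>

definition integrable_acs :: "('a, 'e::euclidean_space) chart set \<Rightarrow> 'a endo_field \<Rightarrow> bool" where
  "integrable_acs A J \<longleftrightarrow> almost_complex_structure A J \<and>
     (\<forall>X\<in>vector_fields A. \<forall>Y\<in>vector_fields A. nijenhuis A J X Y = 0)"


section \<open>Linear connections\<close>

text \<open>\<open>D X Y\<close> is the covariant derivative of \<open>Y\<close> in the direction of \<open>X\<close>.\<close>

type_synonym 'a connection = "'a vfield \<Rightarrow> 'a vfield \<Rightarrow> 'a vfield"

definition linear_connection ::
    "('a, 'e::euclidean_space) chart set \<Rightarrow> 'a connection \<Rightarrow> bool" where
  "linear_connection A D \<longleftrightarrow>
     (\<forall>X\<in>vector_fields A. \<forall>Y\<in>vector_fields A.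
        D X Y \<in> vector_fields A \<and>
        (\<forall>Z\<in>vector_fields A. D (X + Y) Z = D X Z + D Y Z \<and> D Z (X + Y) = D Z X + D Z Y) \<and>
        (\<forall>f. smooth_function A f \<longrightarrow>
           D (fscale f X) Y = fscale f (D X Y) \<and>
           D X (fscale f Y) = fscale (\<lambda>p. X p f) Y + fscale f (D X Y)))"

definition torsion ::
    "('a, 'e::euclidean_space) chart set \<Rightarrow> 'a connection \<Rightarrow> 'a vfield \<Rightarrow> 'a vfield \<Rightarrow> 'a vfield" where
  "torsion A D X Y = D X Y - D Y X - lie_bracket A X Y"

definition torsion_free :: "('a, 'e::euclidean_space) chart set \<Rightarrow> 'a connection \<Rightarrow> bool" where
  "torsion_free A D \<longleftrightarrow> (\<forall>X\<in>vector_fields A. \<forall>Y\<in>vector_fields A. torsion A D X Y = 0)"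

definition curvature :: "('a, 'e::euclidean_space) chart set \<Rightarrow> 'a connection \<Rightarrow>
    'a vfield \<Rightarrow> 'a vfield \<Rightarrow> 'a vfield \<Rightarrow> 'a vfield" where
  "curvature A D X Y Z = - D X (D Y Z) + D Y (D X Z) + D (lie_bracket A X Y) Z"

definition flat :: "('a, 'e::euclidean_space) chart set \<Rightarrow> 'a connection \<Rightarrow> bool" where
  "flat A D \<longleftrightarrow> (\<forall>X\<in>vector_fields A. \<forall>Y\<in>vector_fields A. \<forall>Z\<in>vector_fields A.
     curvature A D X Y Z = 0)"

definition cov_endo ::
    "'a connection \<Rightarrow> 'a endo_field \<Rightarrow> 'a vfield \<Rightarrow> 'a vfield \<Rightarrow> 'a vfield" where
  "cov_endo D J X Y = D X (app J Y) - app J (D X Y)"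

text \<open>\<open>cov_form D \<alpha> X Y\<close> is the function \<open>(D\<^sub>X \<alpha>)(Y)\<close>.\<close>

definition cov_form ::
    "'a connection \<Rightarrow> 'a one_form \<Rightarrow> 'a vfield \<Rightarrow> 'a vfield \<Rightarrow> 'a \<Rightarrow> real" where
  "cov_form D \<alpha> X Y = (\<lambda>p. X p (\<lambda>q. \<alpha> q (Y q)) - \<alpha> p (D X Y p))"

definition special_complex ::
    "('a, 'e::euclidean_space) chart set \<Rightarrow> 'a endo_field \<Rightarrow> 'a connection \<Rightarrow> bool" where
  "special_complex A J D \<longleftrightarrow> integrable_acs A J \<and> linear_connection A D \<and>
     flat A D \<and> torsion_free A D \<and>
     (\<forall>X\<in>vector_fields A. \<forall>Y\<in>vector_fields A. cov_endo D J X Y - cov_endo D J Y X = 0)"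


section \<open>Hermitian geometry\<close>

type_synonym 'a metric_field = "'a \<Rightarrow> 'a tvec \<Rightarrow> 'a tvec \<Rightarrow> real"

definition riemannian_metric ::
    "('a, 'e::euclidean_space) chart set \<Rightarrow> 'a metric_field \<Rightarrow> bool" where
  "riemannian_metric A g \<longleftrightarrow>
     (\<forall>p\<in>points A. \<forall>u\<in>tangent_space A p. \<forall>v\<in>tangent_space A p.
        g p u v = g p v u \<and>
        (\<forall>w\<in>tangent_space A p. g p (u + v) w = g p u w + g p v w) \<and>
        (\<forall>r. g p (scale r u) v = r * g p u v) \<and>
        (u \<noteq> 0 \<longrightarrow> g p u u > 0)) \<and>
     (\<forall>X\<in>vector_fields A. \<forall>Y\<in>vector_fields A. smooth_function A (\<lambda>p. g p (X p) (Y p)))"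

definition almost_hermitian ::
    "('a, 'e::euclidean_space) chart set \<Rightarrow> 'a metric_field \<Rightarrow> 'a endo_field \<Rightarrow> bool" where
  "almost_hermitian A g J \<longleftrightarrow> riemannian_metric A g \<and> almost_complex_structure A J \<and>
     (\<forall>p\<in>points A. \<forall>u\<in>tangent_space A p. \<forall>v\<in>tangent_space A p. g p (J p u) (J p v) = g p u v)"

definition hermitian ::
    "('a, 'e::euclidean_space) chart set \<Rightarrow> 'a metric_field \<Rightarrow> 'a endo_field \<Rightarrow> bool" where
  "hermitian A g J \<longleftrightarrow> almost_hermitian A g J \<and> integrable_acs A J"

definition kaehler_form :: "'a metric_field \<Rightarrow> 'a endo_field \<Rightarrow> 'a vfield \<Rightarrow> 'a vfield \<Rightarrow> 'a \<Rightarrow> real" where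
  "kaehler_form g J X Y = (\<lambda>p. g p (J p (X p)) (Y p))"

text \<open>Cartan's formula for the exterior derivative of a 2-form.\<close>

definition ext_deriv2 :: "('a, 'e::euclidean_space) chart set \<Rightarrow>
    ('a vfield \<Rightarrow> 'a vfield \<Rightarrow> 'a \<Rightarrow> real) \<Rightarrow> 'a vfield \<Rightarrow> 'a vfield \<Rightarrow> 'a vfield \<Rightarrow> 'a \<Rightarrow> real" where
  "ext_deriv2 A \<omega> X Y Z = (\<lambda>p.
     X p (\<omega> Y Z) + Y p (\<omega> Z X) + Z p (\<omega> X Y)
     - \<omega> (lie_bracket A X Y) Z p - \<omega> (lie_bracket A Y Z) X p - \<omega> (lie_bracket A Z X) Y p)"

definition kaehler ::
    "('a, 'e::euclidean_space) chart set \<Rightarrow> 'a metric_field \<Rightarrow> 'a endo_field \<Rightarrow> bool" where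
  "kaehler A g J \<longleftrightarrow> hermitian A g J \<and>
     (\<forall>X\<in>vector_fields A. \<forall>Y\<in>vector_fields A. \<forall>Z\<in>vector_fields A. \<forall>p\<in>points A.
        ext_deriv2 A (kaehler_form g J) X Y Z p = 0)"

definition metric_connection ::
    "('a, 'e::euclidean_space) chart set \<Rightarrow> 'a metric_field \<Rightarrow> 'a connection \<Rightarrow> bool" where
  "metric_connection A g D \<longleftrightarrow> linear_connection A D \<and>
     (\<forall>X\<in>vector_fields A. \<forall>Y\<in>vector_fields A. \<forall>Z\<in>vector_fields A. \<forall>p\<in>points A.
        X p (\<lambda>q. g q (Y q) (Z q)) = g p (D X Y p) (Z p) + g p (Y p) (D X Z p))"

definition levi_civita ::
    "('a, 'e::euclidean_space) chart set \<Rightarrow> 'a metric_field \<Rightarrow> 'a connection \<Rightarrow> bool" where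
  "levi_civita A g D \<longleftrightarrow> metric_connection A g D \<and> torsion_free A D"

text \<open>The Chern connection is the connection on the holomorphic bundle \<open>(TM, J)\<close> which is
  compatible with the Hermitian structure and whose (0,1)-part is the Dolbeault operator. Identify
  \<open>TM\<close> with \<open>T\<^sup>1\<^sup>,\<^sup>0M\<close> by \<open>Y \<mapsto> (Y - iJY)/2\<close>. The Dolbeault derivative of \<open>Y\<close> in the direction
  \<open>(X + iJX)/2\<close> is the (1,0)-part of \<open>[(X + iJX)/2, (Y - iJY)/2]\<close>, which corresponds to the real
  field \<open>([X, Y] + J[JX, Y])/2\<close> because \<open>J\<close> is integrable; the derivative of \<open>Y\<close> in this direction
  with respect to \<open>D\<close> is \<open>(D\<^sub>X Y + J D\<^sub>J\<^sub>X Y)/2\<close>. The common factor 1/2 is dropped.\<close>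

definition chern_connection :: "('a, 'e::euclidean_space) chart set \<Rightarrow>
    'a metric_field \<Rightarrow> 'a endo_field \<Rightarrow> 'a connection \<Rightarrow> bool" where
  "chern_connection A g J D \<longleftrightarrow> metric_connection A g D \<and>
     (\<forall>X\<in>vector_fields A. \<forall>Y\<in>vector_fields A.
        cov_endo D J X Y = 0 \<and>
        D X Y + app J (D (app J X) Y) = lie_bracket A X Y + app J (lie_bracket A (app J X) Y))"


section \<open>The cotangent bundle\<close>

definition cotangent_chart :: "('a, 'e::euclidean_space) chart set \<Rightarrow>
    ('a, 'e) chart \<Rightarrow> ('a \<times> 'a covec, 'e \<times> 'e) chart" where
  "cotangent_chart A c =
     (Sigma (fst c) (cotangent_space A),
      \<lambda>(p, \<xi>). (snd c p, \<Sum>b\<in>Basis. \<xi> (chart_tvec A c p b) *\<^sub>R b))"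

definition cotangent_bundle :: "('a, 'e::euclidean_space) chart set \<Rightarrow>
    ('a \<times> 'a covec, 'e \<times> 'e) chart set" where
  "cotangent_bundle A = cotangent_chart A ` A"

text \<open>The horizontal space at \<open>\<xi> \<in> T\<^sub>p\<^sup>*M\<close> consists of the vectors \<open>d\<alpha>\<^sub>p(X)\<close>, for
  sections \<open>\<alpha>\<close> of \<open>T\<^sup>*M\<close> through \<open>\<xi>\<close> with \<open>D\<^sub>X \<alpha> = 0\<close> at \<open>p\<close>.\<close>

definition horizontal_space :: "('a, 'e::euclidean_space) chart set \<Rightarrow> 'a connection \<Rightarrow>
    'a \<times> 'a covec \<Rightarrow> ('a \<times> 'a covec) tvec set" where
  "horizontal_space A D = (\<lambda>(p, \<xi>).
     {pushforward (cotangent_bundle A) (\<lambda>q. (q, \<alpha> q)) p (X p) | \<alpha> X.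
        \<alpha> \<in> one_forms A \<and> X \<in> vector_fields A \<and> \<alpha> p = \<xi> \<and>
        (\<forall>Y\<in>vector_fields A. cov_form D \<alpha> X Y p = 0)})"

definition horizontal_lift :: "('a, 'e::euclidean_space) chart set \<Rightarrow> 'a connection \<Rightarrow>
    'a \<times> 'a covec \<Rightarrow> 'a tvec \<Rightarrow> ('a \<times> 'a covec) tvec" where
  "horizontal_lift A D x v = (THE w. w \<in> horizontal_space A D x \<and> pushforward A fst x w = v)"

definition vertical_lift :: "('a, 'e::euclidean_space) chart set \<Rightarrow>
    'a \<times> 'a covec \<Rightarrow> 'a covec \<Rightarrow> ('a \<times> 'a covec) tvec" where
  "vertical_lift A = (\<lambda>(p, \<xi>) \<eta> f.
     if smooth_near (cotangent_bundle A) (p, \<xi>) f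
     then deriv (\<lambda>t. f (p, \<xi> + scale t \<eta>)) 0 else 0)"

text \<open>The isomorphism from the fibre of \<open>\<pi>\<^sup>*(TM \<oplus> T\<^sup>*M)\<close> at \<open>x \<in> T\<^sup>*M\<close> to
  \<open>T\<^sub>x(T\<^sup>*M)\<close>.\<close>

definition splitting :: "('a, 'e::euclidean_space) chart set \<Rightarrow> 'a connection \<Rightarrow>
    'a \<times> 'a covec \<Rightarrow> 'a tvec \<times> 'a covec \<Rightarrow> ('a \<times> 'a covec) tvec" where
  "splitting A D x = (\<lambda>(v, \<eta>). horizontal_lift A D x v + vertical_lift A x \<eta>)"

definition pullback_structure :: "('a, 'e::euclidean_space) chart set \<Rightarrow> 'a connection \<Rightarrow>
    ('a \<Rightarrow> 'a tvec \<times> 'a covec \<Rightarrow> 'a tvec \<times> 'a covec) \<Rightarrow> ('a \<times> 'a covec) endo_field" where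
  "pullback_structure A D \<J> = (\<lambda>x w.
     if w \<in> tangent_space (cotangent_bundle A) x
     then splitting A D x (\<J> (fst x)
       (the_inv_into (tangent_space A (fst x) \<times> cotangent_space A (fst x)) (splitting A D x) w))
     else 0)"

definition dual_endo :: "'a endo_field \<Rightarrow> 'a \<Rightarrow> 'a covec \<Rightarrow> 'a covec" where
  "dual_endo J p \<xi> = \<xi> \<circ> J p"

definition J_plus :: "('a, 'e::euclidean_space) chart set \<Rightarrow> 'a endo_field \<Rightarrow> 'a connection \<Rightarrow>
    ('a \<times> 'a covec) endo_field" where
  "J_plus A J D = pullback_structure A D (\<lambda>p (v, \<eta>). (J p v, dual_endo J p \<eta>))"

definition J_minus :: "('a, 'e::euclidean_space) chart set \<Rightarrow> 'a endo_field \<Rightarrow> 'a connection \<Rightarrow>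
    ('a \<times> 'a covec) endo_field" where
  "J_minus A J D = pullback_structure A D (\<lambda>p (v, \<eta>). (J p v, - dual_endo J p \<eta>))"

end

theory Submission
  imports Defs
begin

text \<open>The tangent vectors of \<open>T\<^sup>*M\<close> are determined by their values on the functions \<open>f \<circ> \<pi>\<close> and on the
  fibrewise linear functions \<open>ev\<^sub>Z(\<xi>) = \<xi>(Z)\<close>. On these, the horizontal lift \<open>X\<^sup>h\<close> and the vertical lift
  \<open>\<beta>\<^sup>v\<close> act by \<open>X\<^sup>h(f \<circ> \<pi>) = (Xf) \<circ> \<pi>\<close>, \<open>X\<^sup>h ev\<^sub>Z = ev(D\<^sub>X Z)\<close>, \<open>\<beta>\<^sup>v(f \<circ> \<pi>) = 0\<close> and
  \<open>\<beta>\<^sup>v ev\<^sub>Z = \<beta>(Z) \<circ> \<pi>\<close>. Hence the Nijenhuis tensor of \<open>J\<^sup>\<epsilon>\<close>, \<open>\<epsilon> = \<plusminus>1\<close>, which is determined by its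
  values on lifts, vanishes iff \<open>J\<close> is integrable, \<open>\<epsilon> (D\<^sub>J\<^sub>X J) Z + J (D\<^sub>X J) Z = 0\<close> and
  \<open>(R\<^sub>X\<^sub>,\<^sub>Y - R\<^sub>J\<^sub>X\<^sub>,\<^sub>J\<^sub>Y) Z + \<epsilon> (R\<^sub>J\<^sub>X\<^sub>,\<^sub>Y + R\<^sub>X\<^sub>,\<^sub>J\<^sub>Y) JZ = 0\<close> for all \<open>X, Y, Z\<close>.

  For a special complex structure the second condition follows from \<open>(D\<^sub>X J) Y = (D\<^sub>Y J) X\<close>. For a
  Chern connection \<open>DJ = 0\<close> and the curvature is of type (1,1). For the Levi-Civita connection,
  integrability of \<open>J\<close> gives \<open>D\<^sub>J\<^sub>X J = J (D\<^sub>X J)\<close>, which is the second condition for \<open>\<epsilon> = -1\<close>, and forces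
  \<open>DJ = 0\<close> together with the one for \<open>\<epsilon> = 1\<close>; a Levi-Civita connection with \<open>DJ = 0\<close> satisfies the
  Chern condition.\<close>


section \<open>Smooth maps between Euclidean spaces\<close>

text \<open>The structures are defined through a description operator and an inverse function, over
  horizontal spaces spanned by one-forms that are parallel at a single point. Two observations make
  them computable. Such one-forms exist: an extension \<alpha> of \<xi> is replaced by \<alpha> - h
  \<beta> with h(p) = 0, (Xh)(p) = 1 and \<beta>(p) = D_X \<alpha>. And the vertical component can
  be eliminated: for w over X, the value of J^\<epsilon> w on ev_Z is \<epsilon> w(ev_{JZ}) +
  \<xi>(D_{JX} Z) - \<epsilon> \<xi>(D_X JZ). Linearity, the square and the smoothness of
  J^\<epsilon> all come from this formula. All fields are global, so local arguments pass through
  cutoff functions. The Hausdorff property supplies them on M, and the projection carries them to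
  the cotangent bundle. Of the three conditions, the first and the third are the values of the
  Nijenhuis tensor of two horizontal lifts on the two kinds of test functions; the second comes from
  a mixed pair. A vertical pair gives no condition, because vertical lifts commute and J^\<epsilon>
  preserves them.\<close>

lemma C_k_on_subset: "C_k_on k S f \<Longrightarrow> T \<subseteq> S \<Longrightarrow> C_k_on k T f"
  by (induction k arbitrary: f) (auto intro: continuous_on_subset)

text \<open>Openness of S carries agreement on S over to the derivatives at points of S, so the
  hypothesis renews itself at every order.\<close>

lemma C_k_on_cong:
  assumes "open S" "\<And>x. x \<in> S \<Longrightarrow> f x = g x" "C_k_on k S f"
  shows "C_k_on k S g"
  using assms(2,3)
proof (induction k arbitrary: f g)
  case 0
  then show ?case by (metis C_k_on.simps(1) continuous_on_cong)
next
  case (Suc k)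
  have d: "(g has_derivative frechet_derivative f (at x)) (at x)" if "x \<in> S" for x
  proof (rule has_derivative_transform_within_open[OF _ assms(1) that Suc.prems(1)])
    show "(f has_derivative frechet_derivative f (at x)) (at x)"
      using Suc.prems(2) that by (simp add: frechet_derivative_works[symmetric])
  qed
  then have "frechet_derivative g (at x) = frechet_derivative f (at x)" if "x \<in> S" for x
    using frechet_derivative_at that by metis
  moreover have "g differentiable (at x)" if "x \<in> S" for x
    using d[OF that] by (auto simp: differentiable_def)
  ultimately show ?case
    using Suc.IH[of "\<lambda>x. frechet_derivative f (at x) _" "\<lambda>x. frechet_derivative g (at x) _"] Suc.prems
    by simp
qed

lemma C_k_on_SucD: "C_k_on (Suc k) S f \<Longrightarrow> C_k_on k S f"
proof (induction k arbitrary: f)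
  case 0
  then show ?case
    by (simp add: differentiable_imp_continuous_on differentiable_at_imp_differentiable_on)
next
  case (Suc k)
  then show ?case by (metis C_k_on.simps(2))
qed

text \<open>Lets a derivative computed by hand stand in for the chosen
  \<open>frechet_derivative\<close>; the inductive closure properties below use it as their
  step.\<close>

lemma C_k_on_SucI:
  assumes "\<And>x. x \<in> S \<Longrightarrow> (f has_derivative f' x) (at x)" "\<And>v. C_k_on k S (\<lambda>x. f' x v)" "open S"
  shows "C_k_on (Suc k) S f"
proof -
  have "frechet_derivative f (at x) = f' x" if "x \<in> S" for x
    using frechet_derivative_at[OF assms(1)[OF that]] by simp
  then have "C_k_on k S (\<lambda>x. frechet_derivative f (at x) v)" for v
    by (intro C_k_on_cong[OF assms(3) _ assms(2)[of v]]) auto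
  then show ?thesis
    using assms(1) by (auto simp: differentiable_def)
qed

lemma C_k_on_SucE:
  assumes "C_k_on (Suc k) S f"
  shows "x \<in> S \<Longrightarrow> (f has_derivative frechet_derivative f (at x)) (at x)"
    and "C_k_on k S (\<lambda>x. frechet_derivative f (at x) v)"
  using assms by (auto simp: frechet_derivative_works[symmetric])

lemma C_k_on_const: "C_k_on k S (\<lambda>x. c)"
  by (induction k arbitrary: c) (auto simp: frechet_derivative_const)

lemma C_k_on_bounded_linear:
  assumes L: "bounded_linear L" and S: "open S"
  shows "C_k_on k S f \<Longrightarrow> C_k_on k S (\<lambda>x. L (f x))"
proof (induction k arbitrary: f)
  case 0
  then show ?case using L by (auto intro: bounded_linear.continuous_on)
next
  case (Suc k)
  then show ?case
    by (intro C_k_on_SucI[OF bounded_linear.has_derivative[OF L C_k_on_SucE(1)[OF Suc.prems]]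
        Suc.IH[OF C_k_on_SucE(2)[OF Suc.prems]] S])
qed

lemma C_k_on_add:
  assumes S: "open S"
  shows "C_k_on k S f \<Longrightarrow> C_k_on k S g \<Longrightarrow> C_k_on k S (\<lambda>x. f x + g x)"
proof (induction k arbitrary: f g)
  case 0
  then show ?case by (auto intro: continuous_intros)
next
  case (Suc k)
  show ?case
    by (rule C_k_on_SucI[OF has_derivative_add[OF C_k_on_SucE(1)[OF Suc.prems(1)] C_k_on_SucE(1)[OF Suc.prems(2)]]
          Suc.IH[OF C_k_on_SucE(2)[OF Suc.prems(1)] C_k_on_SucE(2)[OF Suc.prems(2)]] S])
qed

lemma C_k_on_bilinear:
  assumes B: "bounded_bilinear B" and S: "open S"
  shows "C_k_on k S f \<Longrightarrow> C_k_on k S g \<Longrightarrow> C_k_on k S (\<lambda>x. B (f x) (g x))"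
proof (induction k arbitrary: f g)
  case 0
  then show ?case using B by (auto intro: bounded_bilinear.continuous_on)
next
  case (Suc k)
  note f = C_k_on_SucE[OF Suc.prems(1)] C_k_on_SucD[OF Suc.prems(1)]
    and g = C_k_on_SucE[OF Suc.prems(2)] C_k_on_SucD[OF Suc.prems(2)]
  show ?case
    by (rule C_k_on_SucI[OF bounded_bilinear.FDERIV[OF B f(1) g(1)]
          C_k_on_add[OF S Suc.IH[OF f(3) g(2)] Suc.IH[OF f(2) g(3)]] S])
qed

lemma C_k_on_id: "open S \<Longrightarrow> C_k_on k S (\<lambda>x. x)"
proof (cases k)
  case (Suc m)
  assume "open S"
  then show ?thesis
    unfolding Suc by (intro C_k_on_SucI[where f' = "\<lambda>x v. v"]) (auto intro: C_k_on_const)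
qed auto

lemma C_k_on_sum:
  assumes S: "open S" "\<And>i. i \<in> I \<Longrightarrow> C_k_on k S (f i)"
  shows "C_k_on k S (\<lambda>x. \<Sum>i\<in>I. f i x)"
  using S(2) by (induction I rule: infinite_finite_induct) (auto intro: C_k_on_add C_k_on_const S)

lemma linear_Basis_sum:
  fixes L :: "'e::euclidean_space \<Rightarrow> 'b::real_normed_vector"
  assumes "linear L"
  shows "L v = (\<Sum>b\<in>Basis. (v \<bullet> b) *\<^sub>R L b)"
proof -
  have "L v = L (\<Sum>b\<in>Basis. (v \<bullet> b) *\<^sub>R b)"
    by (simp only: euclidean_representation)
  also have "\<dots> = (\<Sum>b\<in>Basis. (v \<bullet> b) *\<^sub>R L b)"
    by (simp only: linear_sum[OF assms] linear_scale[OF assms])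
  finally show ?thesis .
qed

text \<open>\<open>C_k_on\<close> speaks of derivatives in fixed directions, whereas the chain rule
  applies Df(g x) to the moving vector Dg(x) v. Expanding that vector in the basis leaves products
  to which the induction and bilinearity apply.\<close>

lemma C_k_on_compose:
  fixes g :: "'e::euclidean_space \<Rightarrow> 'f::euclidean_space" and f :: "'f \<Rightarrow> 'b::real_normed_vector"
  assumes S: "open S" and T: "open T" and ST: "g ` S \<subseteq> T"
  shows "C_k_on k T f \<Longrightarrow> C_k_on k S g \<Longrightarrow> C_k_on k S (\<lambda>x. f (g x))"
proof (induction k arbitrary: f)
  case 0
  then show ?case using ST by (auto intro: continuous_on_compose2)
next
  case (Suc k)
  note f = C_k_on_SucE[OF Suc.prems(1)] C_k_on_SucD[OF Suc.prems(1)]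
    and g = C_k_on_SucE[OF Suc.prems(2)] C_k_on_SucD[OF Suc.prems(2)]
  have lin: "linear (frechet_derivative f (at (g x)))" if "x \<in> S" for x
    using f(1)[of "g x"] that ST by (auto intro: has_derivative_linear)
  show ?case
  proof (rule C_k_on_SucI[OF _ _ S, where f' = "\<lambda>x v. \<Sum>b\<in>Basis.
      (frechet_derivative g (at x) v \<bullet> b) *\<^sub>R frechet_derivative f (at (g x)) b"])
    fix x assume x: "x \<in> S"
    have "((\<lambda>x. f (g x)) has_derivative (\<lambda>v. frechet_derivative f (at (g x)) (frechet_derivative g (at x) v))) (at x)"
      using f(1)[of "g x"] g(1)[of x] x ST by (intro has_derivative_compose[where f=g and g=f]) auto
    moreover have "(\<lambda>v. frechet_derivative f (at (g x)) (frechet_derivative g (at x) v)) =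
        (\<lambda>v. \<Sum>b\<in>Basis. (frechet_derivative g (at x) v \<bullet> b) *\<^sub>R frechet_derivative f (at (g x)) b)"
      by (intro ext linear_Basis_sum[OF lin[OF x]])
    ultimately show "((\<lambda>x. f (g x)) has_derivative (\<lambda>v. \<Sum>b\<in>Basis.
      (frechet_derivative g (at x) v \<bullet> b) *\<^sub>R frechet_derivative f (at (g x)) b)) (at x)"
      by (rule back_subst)
  next
    show "C_k_on k S (\<lambda>x. \<Sum>b\<in>Basis. (frechet_derivative g (at x) v \<bullet> b) *\<^sub>R frechet_derivative f (at (g x)) b)" for v
      by (intro C_k_on_sum S C_k_on_bilinear[OF bounded_bilinear_scaleR] C_k_on_bounded_linear[OF bounded_linear_inner_left]
          Suc.IH[OF f(2)] g)
  qed
qed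

lemma C_k_on_local:
  assumes "\<And>x. x \<in> S \<Longrightarrow> \<exists>W. open W \<and> x \<in> W \<and> C_k_on k W f"
  shows "C_k_on k S f"
  using assms
proof (induction k arbitrary: f)
  case 0
  have "isCont f x" if "x \<in> S" for x
  proof -
    obtain W where "open W" "x \<in> W" "continuous_on W f"
      using "0"[OF \<open>x \<in> S\<close>] by auto
    then show ?thesis by (simp add: continuous_on_eq_continuous_at)
  qed
  then show ?case by (simp add: continuous_at_imp_continuous_on)
next
  case (Suc k)
  then show ?case by (metis C_k_on.simps(2))
qed

text \<open>With the neighbourhood hidden in the quantifier, smoothness is a property of the germ
  and combines freely with \<open>eventually\<close>.\<close>

definition smooth_at :: "('e::euclidean_space \<Rightarrow> 'b::real_normed_vector) \<Rightarrow> 'e \<Rightarrow> bool" where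
  "smooth_at f x \<longleftrightarrow> (\<exists>W. open W \<and> x \<in> W \<and> smooth_on W f)"

lemma smooth_on_subset: "smooth_on S f \<Longrightarrow> T \<subseteq> S \<Longrightarrow> smooth_on T f"
  unfolding smooth_on_def by (metis C_k_on_subset)

lemma smooth_on_cong: "open S \<Longrightarrow> (\<And>x. x \<in> S \<Longrightarrow> f x = g x) \<Longrightarrow> smooth_on S f \<Longrightarrow> smooth_on S g"
  unfolding smooth_on_def by (metis C_k_on_cong)

lemma smooth_on_iff_smooth_at: "open S \<Longrightarrow> smooth_on S f \<longleftrightarrow> (\<forall>x\<in>S. smooth_at f x)"
  unfolding smooth_at_def by (metis smooth_on_def C_k_on_local)

lemma smooth_at_openE:
  assumes "smooth_at f x" "open V" "x \<in> V"
  obtains W where "open W" "x \<in> W" "W \<subseteq> V" "smooth_on W f"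
  using assms unfolding smooth_at_def
  by (metis Int_iff inf_le1 inf_le2 open_Int smooth_on_subset)

lemma smooth_at_eventually: "smooth_at f x \<Longrightarrow> \<forall>\<^sub>F y in nhds x. smooth_at f y"
  unfolding eventually_nhds by (metis smooth_at_def)

lemma smooth_at_cong:
  assumes "smooth_at f x" "\<forall>\<^sub>F y in nhds x. f y = g y"
  shows "smooth_at g x"
proof -
  obtain V where "open V" "x \<in> V" "\<And>y. y \<in> V \<Longrightarrow> f y = g y"
    using assms(2) by (auto simp: eventually_nhds)
  moreover then obtain W where "open W" "x \<in> W" "W \<subseteq> V" "smooth_on W f"
    using smooth_at_openE[OF assms(1)] by metis
  ultimately show ?thesis
    unfolding smooth_at_def by (metis smooth_on_cong subsetD)
qed

lemma smooth_at_differentiable: "smooth_at f x \<Longrightarrow> f differentiable (at x)"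
  unfolding smooth_at_def smooth_on_def by (metis C_k_on.simps(2))

lemma smooth_at_has_derivative:
  "smooth_at f x \<Longrightarrow> (f has_derivative frechet_derivative f (at x)) (at x)"
  by (simp add: frechet_derivative_works[symmetric] smooth_at_differentiable)

lemma smooth_at_frechet: "smooth_at f x \<Longrightarrow> smooth_at (\<lambda>x. frechet_derivative f (at x) v) x"
  unfolding smooth_at_def smooth_on_def by (metis C_k_on.simps(2))

lemma smooth_at_isCont: "smooth_at f x \<Longrightarrow> isCont f x"
  using smooth_at_differentiable differentiable_imp_continuous_within by blast

lemma smooth_on_const: "smooth_on S (\<lambda>x. c)"
  by (simp add: smooth_on_def C_k_on_const)

lemma smooth_at_const [simp]: "smooth_at (\<lambda>x. c) x"
  unfolding smooth_at_def by (metis smooth_on_const UNIV_I open_UNIV)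

lemma smooth_at_id [simp]: "smooth_at (\<lambda>x. x) x"
  unfolding smooth_at_def smooth_on_def by (metis C_k_on_id UNIV_I open_UNIV)

lemma smooth_at_bounded_linear: "bounded_linear L \<Longrightarrow> smooth_at f x \<Longrightarrow> smooth_at (\<lambda>x. L (f x)) x"
  unfolding smooth_at_def smooth_on_def by (metis C_k_on_bounded_linear)

lemma smooth_at_bilinear:
  assumes "bounded_bilinear B" "smooth_at f x" "smooth_at g x"
  shows "smooth_at (\<lambda>x. B (f x) (g x)) x"
proof -
  obtain V where V: "open V" "x \<in> V" "smooth_on V f"
    using assms(2) by (auto simp: smooth_at_def)
  moreover then obtain W where "open W" "x \<in> W" "W \<subseteq> V" "smooth_on W g"
    using smooth_at_openE[OF assms(3)] by metis
  ultimately show ?thesis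
    unfolding smooth_at_def smooth_on_def
    by (metis C_k_on_bilinear[OF assms(1)] C_k_on_subset)
qed

lemma smooth_at_add:
  assumes "smooth_at f x" "smooth_at g x"
  shows "smooth_at (\<lambda>x. f x + g x) x"
proof -
  obtain V where V: "open V" "x \<in> V" "smooth_on V f"
    using assms(1) by (auto simp: smooth_at_def)
  moreover then obtain W where "open W" "x \<in> W" "W \<subseteq> V" "smooth_on W g"
    using smooth_at_openE[OF assms(2)] by metis
  ultimately show ?thesis
    unfolding smooth_at_def smooth_on_def
    by (metis C_k_on_add C_k_on_subset)
qed

lemma smooth_at_sum: "(\<And>i. i \<in> I \<Longrightarrow> smooth_at (f i) x) \<Longrightarrow> smooth_at (\<lambda>x. \<Sum>i\<in>I. f i x) x"
  by (induction I rule: infinite_finite_induct) (auto intro: smooth_at_add)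

lemmas smooth_at_scaleR = smooth_at_bilinear[OF bounded_bilinear_scaleR]
lemmas smooth_at_inner_left = smooth_at_bounded_linear[OF bounded_linear_inner_left]

lemma smooth_at_mult:
  fixes f g :: "_ \<Rightarrow> real"
  shows "smooth_at f x \<Longrightarrow> smooth_at g x \<Longrightarrow> smooth_at (\<lambda>x. f x * g x) x"
  by (rule smooth_at_bilinear[OF bounded_bilinear_mult])

lemma smooth_at_uminus: "smooth_at f x \<Longrightarrow> smooth_at (\<lambda>x. - f x) x"
  using smooth_at_bounded_linear[OF bounded_linear_minus[OF bounded_linear_ident]] by blast

lemma smooth_at_diff: "smooth_at f x \<Longrightarrow> smooth_at g x \<Longrightarrow> smooth_at (\<lambda>x. f x - g x) x"
  using smooth_at_add[OF _ smooth_at_uminus] by fastforce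

lemma smooth_at_compose:
  fixes g :: "'e::euclidean_space \<Rightarrow> 'f::euclidean_space" and f :: "'f \<Rightarrow> 'b::real_normed_vector"
  assumes "smooth_at f (g x)" "smooth_at g x"
  shows "smooth_at (\<lambda>x. f (g x)) x"
proof -
  obtain T where T: "open T" "g x \<in> T" "smooth_on T f"
    using assms(1) by (auto simp: smooth_at_def)
  obtain V where V: "open V" "x \<in> V" "smooth_on V g"
    using assms(2) by (auto simp: smooth_at_def)
  have "continuous_on V g"
    using V(3) unfolding smooth_on_def by (metis C_k_on.simps(1))
  then have "open (V \<inter> g -` T)"
    using V(1) T(1) by (metis continuous_on_open_vimage Int_commute)
  moreover have "x \<in> V \<inter> g -` T" using V T by auto
  moreover have "smooth_on (V \<inter> g -` T) (\<lambda>x. f (g x))"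
    using T(3) V(3) C_k_on_compose[OF \<open>open (V \<inter> g -` T)\<close> T(1), of g _ f] C_k_on_subset[of _ V g "V \<inter> g -` T"]
    unfolding smooth_on_def by auto
  ultimately show ?thesis unfolding smooth_at_def by blast
qed

lemma smooth_at_componentwise:
  fixes f :: "'e::euclidean_space \<Rightarrow> 'f::euclidean_space"
  assumes "\<And>b. b \<in> Basis \<Longrightarrow> smooth_at (\<lambda>x. f x \<bullet> b) x"
  shows "smooth_at f x"
proof -
  have "smooth_at (\<lambda>x. \<Sum>b\<in>Basis. (f x \<bullet> b) *\<^sub>R b) x"
    by (intro smooth_at_sum smooth_at_scaleR assms smooth_at_const)
  then show ?thesis by (simp add: euclidean_representation)
qed

lemma smooth_at_fst: "smooth_at fst x" and smooth_at_snd: "smooth_at snd x"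
  using smooth_at_bounded_linear[OF bounded_linear_fst smooth_at_id]
    smooth_at_bounded_linear[OF bounded_linear_snd smooth_at_id] by blast+

lemma frechet_derivative_cong:
  assumes "\<forall>\<^sub>F y in nhds x. f y = g y"
  shows "frechet_derivative f (at x) = frechet_derivative g (at x)"
proof -
  obtain S where S: "open S" "x \<in> S" "\<And>y. y \<in> S \<Longrightarrow> f y = g y"
    using assms by (auto simp: eventually_nhds)
  have "(f has_derivative D) (at x) \<longleftrightarrow> (g has_derivative D) (at x)" for D
    using has_derivative_transform_within_open[OF _ S(1,2), of f D UNIV g]
      has_derivative_transform_within_open[OF _ S(1,2), of g D UNIV f] S(3)
    by auto
  then show ?thesis by (simp add: frechet_derivative_def)
qed

lemma frechet_derivative_eqI: "(f has_derivative f') (at x) \<Longrightarrow> frechet_derivative f (at x) = f'"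
  using frechet_derivative_at by metis

section \<open>Symmetry of second derivatives and bump functions\<close>

lemma has_real_derivative_along_line:
  assumes "(f has_derivative f') (at (a + s *\<^sub>R u))"
  shows "((\<lambda>s. f (a + s *\<^sub>R u)) has_real_derivative f' u) (at s)"
proof -
  have "((\<lambda>s. a + s *\<^sub>R u) has_derivative (\<lambda>h. h *\<^sub>R u)) (at s)"
    by (auto intro!: derivative_eq_intros)
  from has_derivative_compose[OF this assms]
  show ?thesis
    using linear_scale[OF has_derivative_linear[OF assms]]
    by (simp add: has_field_derivative_def mult_commute_abs)
qed

text \<open>The mean value theorem, applied along u and then along v, turns the second difference
  into t^2 times the mixed derivative at an intermediate point; continuity of that derivative does
  the rest.\<close>

lemma second_difference_quotient:
  fixes f :: "'e::euclidean_space \<Rightarrow> real"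
  assumes f: "smooth_at f x" and e: "\<epsilon> > 0"
  obtains \<delta> where "\<delta> > 0" "\<And>t. 0 < t \<Longrightarrow> t < \<delta> \<Longrightarrow>
    \<bar>(f (x + t *\<^sub>R u + t *\<^sub>R v) - f (x + t *\<^sub>R u) - f (x + t *\<^sub>R v) + f x) / t\<^sup>2
      - frechet_derivative (\<lambda>y. frechet_derivative f (at y) u) (at x) v\<bar> < \<epsilon>"
proof -
  define G where "G = (\<lambda>y. frechet_derivative f (at y) u)"
  define H where "H = (\<lambda>y. frechet_derivative G (at y) v)"
  have "smooth_at G x" using smooth_at_frechet[OF f] by (simp add: G_def)
  then have "isCont H x" unfolding H_def by (intro smooth_at_isCont smooth_at_frechet)
  then have "\<forall>\<^sub>F y in nhds x. dist (H y) (H x) < \<epsilon>"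
    using e unfolding isCont_def tendsto_iff
    by (auto simp: eventually_at_filter elim!: eventually_mono)
  then have "\<forall>\<^sub>F y in nhds x. dist (H y) (H x) < \<epsilon> \<and> smooth_at f y \<and> smooth_at G y"
    using smooth_at_eventually[OF f] smooth_at_eventually[OF \<open>smooth_at G x\<close>]
    by (intro eventually_conj)
  then obtain \<eta> where eta: "\<eta> > 0" "\<And>y. dist y x < \<eta> \<Longrightarrow> dist (H y) (H x) < \<epsilon> \<and> smooth_at f y \<and> smooth_at G y"
    by (auto simp: eventually_nhds_metric)
  \<comment> \<open>Keeps the parallelogram with sides t u and t v in the \<eta>-ball for t <
    \<delta>; the summand 1 covers u = v = 0.\<close>
  define \<delta> where "\<delta> = \<eta> / (norm u + norm v + 1)"
  have pos: "norm u + norm v + 1 > 0" by (smt (verit) norm_ge_zero)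
  have near: "dist (x + s *\<^sub>R u + s' *\<^sub>R v) x < \<eta>" if "0 \<le> s" "s \<le> t" "0 \<le> s'" "s' \<le> t" "t < \<delta>" for s s' t
  proof -
    have "dist (x + s *\<^sub>R u + s' *\<^sub>R v) x = norm (s *\<^sub>R u + s' *\<^sub>R v)"
      by (simp add: dist_norm)
    also have "\<dots> \<le> s * norm u + s' * norm v"
      using that by (intro norm_triangle_le) simp
    also have "\<dots> \<le> t * norm u + t * norm v"
      using that by (intro add_mono mult_right_mono) auto
    also have "\<dots> \<le> t * (norm u + norm v + 1)"
      using that by (simp add: algebra_simps)
    also have "\<dots> < \<delta> * (norm u + norm v + 1)"
      using that pos by (intro mult_strict_right_mono)
    also have "\<dots> = \<eta>" using pos by (simp add: \<delta>_def)
    finally show ?thesis .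
  qed
  show thesis
  proof (rule that[of \<delta>])
    show "\<delta> > 0" using eta(1) pos by (simp add: \<delta>_def)
    fix t :: real assume t: "0 < t" "t < \<delta>"
    \<comment> \<open>The difference in the direction v stays inside the function of s, so that an
      increment in v is left for the second mean value theorem.\<close>
    have "((\<lambda>s. f ((x + t *\<^sub>R v) + s *\<^sub>R u) - f (x + s *\<^sub>R u)) has_real_derivative
        G (x + t *\<^sub>R v + s *\<^sub>R u) - G (x + s *\<^sub>R u)) (at s)" if "0 \<le> s" "s \<le> t" for s
      using eta(2)[OF near[of s t t]] eta(2)[OF near[of s t 0]] that t unfolding G_def
      by (intro DERIV_diff has_real_derivative_along_line smooth_at_has_derivative)
        (simp_all add: algebra_simps)
    from MVT2[OF t(1) this] obtain s where s: "0 < s" "s < t"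
      "f (x + t *\<^sub>R v + t *\<^sub>R u) - f (x + t *\<^sub>R u) - (f (x + t *\<^sub>R v) - f x)
        = t * (G (x + t *\<^sub>R v + s *\<^sub>R u) - G (x + s *\<^sub>R u))"
      by auto
    have "((\<lambda>s'. G ((x + s *\<^sub>R u) + s' *\<^sub>R v)) has_real_derivative H (x + s *\<^sub>R u + s' *\<^sub>R v)) (at s')"
      if "0 \<le> s'" "s' \<le> t" for s'
      using eta(2)[OF near[of s t s']] that t s unfolding H_def
      by (intro has_real_derivative_along_line smooth_at_has_derivative) simp
    from MVT2[OF t(1) this] obtain s' where s': "0 < s'" "s' < t"
      "G (x + s *\<^sub>R u + t *\<^sub>R v) - G (x + s *\<^sub>R u) = t * H (x + s *\<^sub>R u + s' *\<^sub>R v)"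
      by auto
    have "f (x + t *\<^sub>R u + t *\<^sub>R v) - f (x + t *\<^sub>R u) - f (x + t *\<^sub>R v) + f x
        = t\<^sup>2 * H (x + s *\<^sub>R u + s' *\<^sub>R v)"
      using s(3) s'(3) by (simp add: algebra_simps power2_eq_square)
    moreover have "\<bar>H (x + s *\<^sub>R u + s' *\<^sub>R v) - H x\<bar> < \<epsilon>"
      using eta(2)[OF near[of s t s']] s s' t by (simp add: dist_real_def)
    ultimately show "\<bar>(f (x + t *\<^sub>R u + t *\<^sub>R v) - f (x + t *\<^sub>R u) - f (x + t *\<^sub>R v) + f x) / t\<^sup>2
      - frechet_derivative (\<lambda>y. frechet_derivative f (at y) u) (at x) v\<bar> < \<epsilon>"
      using t(1) by (simp add: H_def[unfolded G_def])
  qed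
qed

text \<open>The second difference is unchanged when u and v are exchanged, so both mixed derivatives
  are approximated by the same number; taking half their supposed gap as the error bound gives the
  contradiction.\<close>

lemma frechet_derivative_symmetric:
  fixes f :: "'e::euclidean_space \<Rightarrow> real"
  assumes f: "smooth_at f x"
  shows "frechet_derivative (\<lambda>y. frechet_derivative f (at y) u) (at x) v
    = frechet_derivative (\<lambda>y. frechet_derivative f (at y) v) (at x) u" (is "?A = ?B")
proof (rule ccontr)
  assume ne: "?A \<noteq> ?B"
  define \<epsilon> where "\<epsilon> = \<bar>?A - ?B\<bar> / 2"
  have e: "\<epsilon> > 0" using ne by (simp add: \<epsilon>_def)
  obtain \<delta>1 where d1: "\<delta>1 > 0" "\<And>t. 0 < t \<Longrightarrow> t < \<delta>1 \<Longrightarrow>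
    \<bar>(f (x + t *\<^sub>R u + t *\<^sub>R v) - f (x + t *\<^sub>R u) - f (x + t *\<^sub>R v) + f x) / t\<^sup>2 - ?A\<bar> < \<epsilon>"
    using second_difference_quotient[OF f e, of u v] by blast
  obtain \<delta>2 where d2: "\<delta>2 > 0" "\<And>t. 0 < t \<Longrightarrow> t < \<delta>2 \<Longrightarrow>
    \<bar>(f (x + t *\<^sub>R v + t *\<^sub>R u) - f (x + t *\<^sub>R v) - f (x + t *\<^sub>R u) + f x) / t\<^sup>2 - ?B\<bar> < \<epsilon>"
    using second_difference_quotient[OF f e, of v u] by blast
  define t where "t = min \<delta>1 \<delta>2 / 2"
  have t: "0 < t" "t < \<delta>1" "t < \<delta>2" using d1 d2 by (auto simp: t_def)
  define q where "q = (f (x + t *\<^sub>R u + t *\<^sub>R v) - f (x + t *\<^sub>R u) - f (x + t *\<^sub>R v) + f x) / t\<^sup>2"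
  have "(f (x + t *\<^sub>R v + t *\<^sub>R u) - f (x + t *\<^sub>R v) - f (x + t *\<^sub>R u) + f x) / t\<^sup>2 = q"
    by (simp add: q_def add.assoc add.commute[of "t *\<^sub>R u"])
  then have "\<bar>q - ?B\<bar> < \<epsilon>"
    using d2(2)[OF t(1,3)] by (simp only:)
  moreover have "\<bar>q - ?A\<bar> < \<epsilon>"
    using d1(2)[OF t(1,2)] by (simp only: q_def)
  moreover have False if "\<bar>q - b\<bar> < \<bar>a - b\<bar> / 2" "\<bar>q - a\<bar> < \<bar>a - b\<bar> / 2" for a b :: real
    using that abs_triangle_ineq4[of "q - b" "q - a"] by simp
  ultimately show False unfolding \<epsilon>_def by blast
qed

text \<open>The negative powers of t make the family closed under differentiation up to linear
  combinations, as the smoothness induction requires; n = 0 is the classical flat function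
  exp(-1/t).\<close>

definition exp_bump :: "nat \<Rightarrow> real \<Rightarrow> real" where
  "exp_bump n t = (if t > 0 then exp (- inverse t) * inverse t ^ n else 0)"

lemma exp_bump_tendsto_0: "(exp_bump n \<longlongrightarrow> 0) (at 0)"
proof -
  have "((\<lambda>s. s ^ n / exp s) \<longlongrightarrow> (0::real)) at_top"
    by (rule tendsto_power_div_exp_0)
  then have "((\<lambda>t. inverse t ^ n / exp (inverse t)) \<longlongrightarrow> (0::real)) (at_right 0)"
    by (rule filterlim_compose[OF _ filterlim_inverse_at_top_right])
  then have "(exp_bump n \<longlongrightarrow> 0) (at_right 0)"
    by (rule Lim_transform_eventually)
      (auto simp: eventually_at_filter exp_bump_def exp_minus divide_inverse mult.commute)
  moreover have "(exp_bump n \<longlongrightarrow> 0) (at_left 0)"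
    by (rule Lim_transform_eventually[OF tendsto_const])
      (auto simp: eventually_at_filter exp_bump_def)
  ultimately show ?thesis by (simp add: filterlim_at_split)
qed

lemma exp_bump_has_real_derivative:
  "(exp_bump n has_real_derivative exp_bump (n + 2) t - real n * exp_bump (n + 1) t) (at t)"
proof (cases t "0 :: real" rule: linorder_cases)
  case less
  have "((\<lambda>_. 0) has_real_derivative 0) (at t)" by simp
  from has_field_derivative_transform_within_open[OF this, of "{..<0}" "exp_bump n"] show ?thesis
    using less by (simp add: exp_bump_def)
next
  case greater
  have "((\<lambda>t. exp (- inverse t)) has_real_derivative exp (- inverse t) * inverse t ^ 2) (at t)"
    using greater by (auto intro!: derivative_eq_intros simp: power2_eq_square)
  moreover have "((\<lambda>t. inverse t ^ n) has_real_derivative - (real n * inverse t ^ (n + 1))) (at t)"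
  proof (cases n)
    case (Suc m)
    have "((\<lambda>t. inverse t ^ n) has_real_derivative
        real n * (- (inverse t * 1 * inverse t) * inverse t ^ (n - Suc 0))) (at t)"
      using greater by (intro DERIV_power DERIV_inverse' DERIV_ident) auto
    then show ?thesis by (simp add: Suc mult.assoc)
  qed simp
  ultimately have "((\<lambda>t. exp (- inverse t) * inverse t ^ n) has_real_derivative
      exp (- inverse t) * (- (real n * inverse t ^ (n + 1))) + exp (- inverse t) * inverse t ^ 2 * inverse t ^ n) (at t)"
    by (rule DERIV_mult')
  from has_field_derivative_transform_within_open[OF this, of "{0<..}" "exp_bump n"]
  have "(exp_bump n has_real_derivative exp (- inverse t) * (- (real n * inverse t ^ (n + 1)))
      + exp (- inverse t) * inverse t ^ 2 * inverse t ^ n) (at t)"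
    using greater by (simp add: exp_bump_def)
  also have "exp (- inverse t) * (- (real n * inverse t ^ (n + 1))) + exp (- inverse t) * inverse t ^ 2 * inverse t ^ n
      = exp_bump (n + 2) t - real n * exp_bump (n + 1) t"
    using greater by (simp add: exp_bump_def power2_eq_square)
  finally show ?thesis .
next
  case equal
  \<comment> \<open>The difference quotient of \<open>exp_bump n\<close> at 0 is
    \<open>exp_bump (Suc n)\<close>.\<close>
  have "((\<lambda>h. exp_bump n h / h) \<longlongrightarrow> 0) (at 0)"
    by (rule Lim_transform_eventually[OF exp_bump_tendsto_0[of "Suc n"]])
      (auto simp: eventually_at_filter exp_bump_def divide_inverse)
  then show ?thesis
    by (simp add: equal DERIV_def exp_bump_def[of _ 0])
qed

lemma C_k_on_exp_bump: "C_k_on k UNIV (exp_bump n)"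
proof (induction k arbitrary: n)
  case 0
  then show ?case
    by (auto intro!: continuous_at_imp_continuous_on DERIV_isCont[OF exp_bump_has_real_derivative])
next
  case (Suc k)
  have c: "C_k_on k UNIV (\<lambda>t. (exp_bump (n + 2) t + (- real n) * exp_bump (n + 1) t) * v)" for v
    by (intro C_k_on_bilinear[OF bounded_bilinear_mult] C_k_on_add Suc.IH C_k_on_const open_UNIV)
  show ?case
    using exp_bump_has_real_derivative[of n] c
    by (intro C_k_on_SucI[where f' = "\<lambda>t v. (exp_bump (n + 2) t - real n * exp_bump (n + 1) t) * v"])
      (auto simp: has_field_derivative_def)
qed

lemma smooth_at_exp_bump: "smooth_at (exp_bump n) t"
  unfolding smooth_at_def smooth_on_def by (metis C_k_on_exp_bump UNIV_I open_UNIV)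

lemma exp_bump_mono: "0 < s \<Longrightarrow> s \<le> t \<Longrightarrow> exp_bump 0 s \<le> exp_bump 0 t"
  by (auto simp: exp_bump_def le_imp_inverse_le)

text \<open>With \<open>h = exp_bump 0\<close> and \<open>c = h d\<close>, the function \<open>h (c - h t) / h c\<close> is \<open>1\<close> for \<open>t \<le> 0\<close> and
  \<open>0\<close> for \<open>t \<ge> d\<close>.\<close>

lemma euclidean_bump:
  fixes p :: "'e::euclidean_space"
  assumes r: "r > 0"
  obtains \<rho> :: "'e \<Rightarrow> real"
  where "\<And>y. smooth_at \<rho> y" "\<And>y. dist p y < r / 2 \<Longrightarrow> \<rho> y = 1" "\<And>y. r \<le> dist p y \<Longrightarrow> \<rho> y = 0"
proof -
  \<comment> \<open>The argument is r^2 - r^2/4, a lower bound for \<open>s\<close> off the ball of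
    radius r.\<close>
  define c where "c = exp_bump 0 (3/4 * r\<^sup>2)"
  define s where "s = (\<lambda>y. (y - p) \<bullet> (y - p) + - (r\<^sup>2/4))"
  define \<rho> where "\<rho> = (\<lambda>y. exp_bump 0 (c + - exp_bump 0 (s y)) * inverse (exp_bump 0 c))"
  have c: "c > 0" "exp_bump 0 c > 0" using r by (auto simp: c_def exp_bump_def)
  have s: "s y = (dist p y)\<^sup>2 - r\<^sup>2/4" for y
    by (simp add: s_def dist_norm power2_norm_eq_inner inner_diff_left inner_diff_right inner_commute)
  have sm: "smooth_at s y" for y
    unfolding s_def by (intro smooth_at_add smooth_at_bilinear[OF bounded_bilinear_inner] smooth_at_diff smooth_at_id smooth_at_const)
  show thesis
  proof (rule that[of \<rho>])
    show "smooth_at \<rho> y" for y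
      unfolding \<rho>_def
      by (rule smooth_at_mult[OF smooth_at_compose[OF smooth_at_exp_bump
            smooth_at_add[OF smooth_at_const smooth_at_uminus[OF smooth_at_compose[OF smooth_at_exp_bump sm]]]]
            smooth_at_const])
    show "\<rho> y = 1" if "dist p y < r / 2" for y
    proof -
      have "(dist p y)\<^sup>2 \<le> (r/2)\<^sup>2" using that by (intro power_mono) auto
      then have "exp_bump 0 (s y) = 0" by (simp add: exp_bump_def s power2_eq_square)
      then show ?thesis using c by (simp add: \<rho>_def)
    qed
    show "\<rho> y = 0" if "r \<le> dist p y" for y
    proof -
      have "r\<^sup>2 \<le> (dist p y)\<^sup>2" using that r by (intro power_mono) auto
      then have "c \<le> exp_bump 0 (s y)" unfolding c_def using r by (intro exp_bump_mono) (auto simp: s)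
      then show ?thesis by (simp add: \<rho>_def exp_bump_def[of 0 "c - _"])
    qed
  qed
qed

section \<open>Germs of functions and tangent vectors\<close>

text \<open>Openness is tested in all charts rather than in \<open>manifold_topology\<close>, so
  that neighbourhood filters on the cotangent bundle are available from its atlas alone.\<close>

definition chart_open :: "('a, 'e::euclidean_space) chart set \<Rightarrow> 'a set \<Rightarrow> bool" where
  "chart_open A N \<longleftrightarrow> N \<subseteq> points A \<and> (\<forall>(U, \<phi>)\<in>A. open (\<phi> ` (U \<inter> N)))"

text \<open>Expresses statements about germs at p by \<open>eventually\<close>.\<close>

definition mnhds :: "('a, 'e::euclidean_space) chart set \<Rightarrow> 'a \<Rightarrow> 'a filter" where
  "mnhds A p = (INF N\<in>{N. chart_open A N \<and> p \<in> N}. principal N)"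

locale atlas =
  fixes A :: "('a, 'e::euclidean_space) chart set"
  assumes smooth_atlas: "smooth_atlas A"
begin

lemma chart_inj: "(U, \<phi>) \<in> A \<Longrightarrow> inj_on \<phi> U"
  using smooth_atlas by (auto simp: smooth_atlas_def)

lemma chart_image_open: "(U, \<phi>) \<in> A \<Longrightarrow> open (\<phi> ` U)"
  using smooth_atlas by (auto simp: smooth_atlas_def)

lemma overlap_open: "(U, \<phi>) \<in> A \<Longrightarrow> (V, \<psi>) \<in> A \<Longrightarrow> open (\<phi> ` (U \<inter> V))"
  using smooth_atlas unfolding smooth_atlas_def by fastforce

lemma chart_inv [simp]: "(U, \<phi>) \<in> A \<Longrightarrow> p \<in> U \<Longrightarrow> inv_into U \<phi> (\<phi> p) = p"
  by (simp add: chart_inj)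

lemma transition_smooth:
  assumes "(U, \<phi>) \<in> A" "(V, \<psi>) \<in> A" "p \<in> U" "p \<in> V"
  shows "smooth_at (\<lambda>x. \<psi> (inv_into U \<phi> x)) (\<phi> p)"
proof -
  have "smooth_on (\<phi> ` (U \<inter> V)) (\<psi> \<circ> inv_into U \<phi>)"
    using smooth_atlas assms(1,2) unfolding smooth_atlas_def by fastforce
  then show ?thesis
    using overlap_open[OF assms(1,2)] assms(3,4) unfolding smooth_at_def
    by (auto simp: o_def)
qed

lemma chart_points: "(U, \<phi>) \<in> A \<Longrightarrow> p \<in> U \<Longrightarrow> p \<in> points A"
  by (force simp: points_def)

lemma pointsE:
  assumes "p \<in> points A"
  obtains U \<phi> where "(U, \<phi>) \<in> A" "p \<in> U"
  using assms by (force simp: points_def)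

lemma chart_open_Int:
  assumes "chart_open A M" "chart_open A N"
  shows "chart_open A (M \<inter> N)"
proof -
  have "open (\<phi> ` (U \<inter> (M \<inter> N)))" if "(U, \<phi>) \<in> A" for U \<phi>
  proof -
    have "\<phi> ` (U \<inter> (M \<inter> N)) = \<phi> ` (U \<inter> M) \<inter> \<phi> ` (U \<inter> N)"
      using chart_inj[OF that] by (auto simp: inj_on_def)
    then show ?thesis using assms that by (auto simp: chart_open_def)
  qed
  then show ?thesis using assms by (auto simp: chart_open_def)
qed

lemma chart_open_points: "chart_open A (points A)"
proof -
  have "U \<inter> points A = U" if "(U, \<phi>) \<in> A" for U \<phi> using that chart_points by auto
  then show ?thesis by (auto simp: chart_open_def chart_image_open)
qed

text \<open>Seen in another chart, the set is the preimage of W under a transition map restricted to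
  the open overlap, and transition maps are continuous.\<close>

lemma chart_open_preimage:
  assumes c: "(U, \<phi>) \<in> A" and W: "open W"
  shows "chart_open A (U \<inter> \<phi> -` W)"
proof -
  have "open (\<psi> ` (V \<inter> (U \<inter> \<phi> -` W)))" if d: "(V, \<psi>) \<in> A" for V \<psi>
  proof -
    have eq: "\<psi> ` (V \<inter> (U \<inter> \<phi> -` W)) = \<psi> ` (V \<inter> U) \<inter> (\<lambda>x. \<phi> (inv_into V \<psi> x)) -` W"
      using d by (auto simp: image_iff)
    have "continuous_on (\<psi> ` (V \<inter> U)) (\<lambda>x. \<phi> (inv_into V \<psi> x))"
      using transition_smooth[OF d c]
      by (auto intro!: continuous_at_imp_continuous_on smooth_at_isCont)
    then show ?thesis
      unfolding eq using overlap_open[OF d c] W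
      by (metis continuous_on_open_vimage Int_commute)
  qed
  then show ?thesis using chart_points[OF c] by (auto simp: chart_open_def)
qed

lemma eventually_mnhds:
  assumes "p \<in> points A"
  shows "eventually P (mnhds A p) \<longleftrightarrow> (\<exists>N. chart_open A N \<and> p \<in> N \<and> (\<forall>q\<in>N. P q))"
proof -
  have "eventually P (mnhds A p) \<longleftrightarrow>
      (\<exists>N\<in>{N. chart_open A N \<and> p \<in> N}. eventually P (principal N))"
    unfolding mnhds_def
    by (rule eventually_INF_base) (use assms chart_open_points chart_open_Int in auto)
  then show ?thesis by (auto simp: eventually_principal)
qed

text \<open>The bridge to Euclidean analysis: germs on the manifold are germs in any single chart
  around the point.\<close>

lemma eventually_mnhds_chart:
  assumes c: "(U, \<phi>) \<in> A" "p \<in> U"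
  shows "eventually P (mnhds A p) \<longleftrightarrow> (\<forall>\<^sub>F x in nhds (\<phi> p). P (inv_into U \<phi> x))"
proof
  assume "eventually P (mnhds A p)"
  then obtain N where N: "chart_open A N" "p \<in> N" "\<And>q. q \<in> N \<Longrightarrow> P q"
    using eventually_mnhds chart_points[OF c] by auto
  have "open (\<phi> ` (U \<inter> N))" "\<phi> p \<in> \<phi> ` (U \<inter> N)"
    using N c by (auto simp: chart_open_def)
  moreover have "P (inv_into U \<phi> x)" if "x \<in> \<phi> ` (U \<inter> N)" for x
    using that c N(3) by auto
  ultimately show "\<forall>\<^sub>F x in nhds (\<phi> p). P (inv_into U \<phi> x)"
    by (auto simp: eventually_nhds)
next
  assume "\<forall>\<^sub>F x in nhds (\<phi> p). P (inv_into U \<phi> x)"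
  then obtain W where W: "open W" "\<phi> p \<in> W" "\<And>x. x \<in> W \<Longrightarrow> P (inv_into U \<phi> x)"
    by (auto simp: eventually_nhds)
  have "P q" if "q \<in> U \<inter> \<phi> -` W" for q
    using W(3)[of "\<phi> q"] that c by auto
  then show "eventually P (mnhds A p)"
    using chart_open_preimage[OF c(1) W(1)] c W(2) eventually_mnhds[OF chart_points[OF c]] by blast
qed

lemma eventually_mnhds_self: "eventually P (mnhds A p) \<Longrightarrow> p \<in> points A \<Longrightarrow> P p"
  by (auto simp: eventually_mnhds)

lemma eventually_mnhds_points: "p \<in> points A \<Longrightarrow> \<forall>\<^sub>F q in mnhds A p. q \<in> points A"
  by (auto simp: eventually_mnhds intro!: exI[of _ "points A"] chart_open_points)

lemma eventually_mnhds_domain: "(U, \<phi>) \<in> A \<Longrightarrow> p \<in> U \<Longrightarrow> \<forall>\<^sub>F q in mnhds A p. q \<in> U"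
  using chart_open_preimage[of U \<phi> UNIV]
  by (auto simp: eventually_mnhds chart_points intro!: exI[of _ U])

lemma eventually_mnhds_mnhds:
  assumes "eventually P (mnhds A p)" "p \<in> points A"
  shows "\<forall>\<^sub>F q in mnhds A p. eventually P (mnhds A q)"
proof -
  obtain N where N: "chart_open A N" "p \<in> N" "\<And>q. q \<in> N \<Longrightarrow> P q"
    using assms eventually_mnhds by auto
  have "eventually P (mnhds A q)" if "q \<in> N" for q
  proof -
    have "q \<in> points A" using N(1) that by (auto simp: chart_open_def)
    then show ?thesis using N that eventually_mnhds by blast
  qed
  then show ?thesis using N eventually_mnhds[OF assms(2)] by auto
qed

lemma eventually_nhds_chart_image:
  assumes "(U, \<phi>) \<in> A" "p \<in> U"
  shows "\<forall>\<^sub>F x in nhds (\<phi> p). x \<in> \<phi> ` U"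
  using assms chart_image_open by (auto simp: eventually_nhds)

lemma smooth_near_points: "smooth_near A p f \<Longrightarrow> p \<in> points A"
  by (force simp: smooth_near_def points_def)

text \<open>The definition asks for some chart; smooth transition maps make every chart around p
  equally good.\<close>

lemma smooth_near_iff:
  assumes c: "(U, \<phi>) \<in> A" "p \<in> U"
  shows "smooth_near A p f \<longleftrightarrow> smooth_at (\<lambda>x. f (inv_into U \<phi> x)) (\<phi> p)"
proof
  assume "smooth_near A p f"
  then obtain V \<psi> where d: "(V, \<psi>) \<in> A" "p \<in> V" and f: "smooth_at (\<lambda>x. f (inv_into V \<psi> x)) (\<psi> p)"
    by (auto simp: smooth_near_def smooth_at_def o_def)
  have "smooth_at (\<lambda>x. f (inv_into V \<psi> (\<psi> (inv_into U \<phi> x)))) (\<phi> p)"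
  proof (rule smooth_at_compose[where f = "\<lambda>x. f (inv_into V \<psi> x)"])
    show "smooth_at (\<lambda>x. f (inv_into V \<psi> x)) (\<psi> (inv_into U \<phi> (\<phi> p)))"
      using f c by simp
  qed (rule transition_smooth[OF c(1) d(1) c(2) d(2)])
  then show "smooth_at (\<lambda>x. f (inv_into U \<phi> x)) (\<phi> p)"
  proof (rule smooth_at_cong)
    show "\<forall>\<^sub>F x in nhds (\<phi> p). f (inv_into V \<psi> (\<psi> (inv_into U \<phi> x))) = f (inv_into U \<phi> x)"
      using eventually_mnhds_domain[OF d] d unfolding eventually_mnhds_chart[OF c]
      by (auto elim: eventually_mono)
  qed
next
  assume f: "smooth_at (\<lambda>x. f (inv_into U \<phi> x)) (\<phi> p)"
  obtain W where "open W" "\<phi> p \<in> W" "W \<subseteq> \<phi> ` U" "smooth_on W (\<lambda>x. f (inv_into U \<phi> x))"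
    by (rule smooth_at_openE[OF f chart_image_open[OF c(1)]]) (use c in auto)
  then show "smooth_near A p f"
    using c unfolding smooth_near_def o_def by blast
qed

lemma smooth_near_eventually:
  assumes "smooth_near A p f"
  shows "\<forall>\<^sub>F q in mnhds A p. smooth_near A q f"
proof -
  obtain U \<phi> where c: "(U, \<phi>) \<in> A" "p \<in> U"
    using pointsE[OF smooth_near_points[OF assms]] .
  have "\<forall>\<^sub>F x in nhds (\<phi> p). smooth_at (\<lambda>x. f (inv_into U \<phi> x)) x"
    using assms smooth_near_iff[OF c] smooth_at_eventually by blast
  with eventually_nhds_chart_image[OF c] show ?thesis
    unfolding eventually_mnhds_chart[OF c]
    by eventually_elim (use c smooth_near_iff[OF c(1)] in auto)
qed

lemma smooth_near_cong:
  assumes "smooth_near A p f" "\<forall>\<^sub>F q in mnhds A p. f q = g q"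
  shows "smooth_near A p g"
proof -
  obtain U \<phi> where c: "(U, \<phi>) \<in> A" "p \<in> U"
    using pointsE[OF smooth_near_points[OF assms(1)]] .
  show ?thesis
    using assms unfolding smooth_near_iff[OF c] eventually_mnhds_chart[OF c]
    by (rule smooth_at_cong)
qed

lemma smooth_near_const: "p \<in> points A \<Longrightarrow> smooth_near A p (\<lambda>q. c)"
  by (erule pointsE) (simp add: smooth_near_iff)

lemma smooth_near_add: "smooth_near A p f \<Longrightarrow> smooth_near A p g \<Longrightarrow> smooth_near A p (\<lambda>q. f q + g q)"
  by (frule smooth_near_points, erule pointsE) (auto simp: smooth_near_iff intro: smooth_at_add)

lemma smooth_near_diff: "smooth_near A p f \<Longrightarrow> smooth_near A p g \<Longrightarrow> smooth_near A p (\<lambda>q. f q - g q)"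
  by (frule smooth_near_points, erule pointsE) (auto simp: smooth_near_iff intro: smooth_at_diff)

lemma smooth_near_uminus: "smooth_near A p f \<Longrightarrow> smooth_near A p (\<lambda>q. - f q)"
  by (frule smooth_near_points, erule pointsE) (auto simp: smooth_near_iff intro: smooth_at_uminus)

lemma smooth_near_mult: "smooth_near A p f \<Longrightarrow> smooth_near A p g \<Longrightarrow> smooth_near A p (\<lambda>q. f q * g q)"
  by (frule smooth_near_points, erule pointsE) (auto simp: smooth_near_iff intro: smooth_at_mult)

lemma smooth_near_sum:
  "p \<in> points A \<Longrightarrow> (\<And>i. i \<in> I \<Longrightarrow> smooth_near A p (f i)) \<Longrightarrow> smooth_near A p (\<lambda>q. \<Sum>i\<in>I. f i q)"
  by (erule pointsE) (auto simp: smooth_near_iff intro: smooth_at_sum)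

lemma smooth_near_coord: "(U, \<phi>) \<in> A \<Longrightarrow> p \<in> U \<Longrightarrow> smooth_near A p (\<lambda>q. \<phi> q \<bullet> b)"
  using transition_smooth[of U \<phi> U \<phi> p] by (auto simp: smooth_near_iff intro: smooth_at_inner_left)

lemma smooth_functionD: "smooth_function A f \<Longrightarrow> p \<in> points A \<Longrightarrow> smooth_near A p f"
  by (simp add: smooth_function_def)

lemma chart_tvec_apply:
  "smooth_near A p f \<Longrightarrow>
    chart_tvec A (U, \<phi>) p v f = frechet_derivative (\<lambda>x. f (inv_into U \<phi> x)) (at (\<phi> p)) v"
  by (simp add: chart_tvec_def o_def)

lemma chart_tvec_not_smooth: "\<not> smooth_near A p f \<Longrightarrow> chart_tvec A c p v f = 0"
  by (simp add: chart_tvec_def split: prod.splits)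

text \<open>By the chain rule, a vector given in another chart has components here obtained from the
  Jacobian of the transition map. Non-smooth functions cause no conflict, because both sides are 0
  on them.\<close>

lemma tangent_space_chart:
  assumes c: "(U, \<phi>) \<in> A" "p \<in> U"
  shows "tangent_space A p = range (chart_tvec A (U, \<phi>) p)"
proof
  show "range (chart_tvec A (U, \<phi>) p) \<subseteq> tangent_space A p"
    using c by (auto simp: tangent_space_def)
  show "tangent_space A p \<subseteq> range (chart_tvec A (U, \<phi>) p)"
  proof
    fix w assume "w \<in> tangent_space A p"
    then obtain V \<psi> v where d: "(V, \<psi>) \<in> A" "p \<in> V" and w: "w = chart_tvec A (V, \<psi>) p v"
      by (auto simp: tangent_space_def)
    define g where "g = (\<lambda>x. \<phi> (inv_into V \<psi> x))"
    have g: "smooth_at g (\<psi> p)" "g (\<psi> p) = \<phi> p"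
      using transition_smooth[OF d(1) c(1) d(2) c(2)] d by (auto simp: g_def)
    have "w f = chart_tvec A (U, \<phi>) p (frechet_derivative g (at (\<psi> p)) v) f" for f
    proof (cases "smooth_near A p f")
      case True
      define F where "F = (\<lambda>x. f (inv_into U \<phi> x))"
      have F: "smooth_at F (g (\<psi> p))"
        using True smooth_near_iff[OF c] g by (simp add: F_def)
      have "\<forall>\<^sub>F x in nhds (\<psi> p). f (inv_into V \<psi> x) = F (g x)"
        using eventually_mnhds_domain[OF c] c unfolding eventually_mnhds_chart[OF d]
        by (auto elim!: eventually_mono simp: F_def g_def)
      then have "frechet_derivative (\<lambda>x. f (inv_into V \<psi> x)) (at (\<psi> p)) = frechet_derivative (\<lambda>x. F (g x)) (at (\<psi> p))"
        by (rule frechet_derivative_cong)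
      also have "\<dots> = (\<lambda>v. frechet_derivative F (at (g (\<psi> p))) (frechet_derivative g (at (\<psi> p)) v))"
        by (rule frechet_derivative_eqI[OF has_derivative_compose[OF smooth_at_has_derivative[OF g(1)]
              smooth_at_has_derivative[OF F]]])
      finally show ?thesis
        using True by (simp add: w chart_tvec_apply F_def g)
    qed (simp add: w chart_tvec_not_smooth)
    then show "w \<in> range (chart_tvec A (U, \<phi>) p)" by blast
  qed
qed

lemma chart_tvec_in_tangent_space [simp, intro]:
  "(U, \<phi>) \<in> A \<Longrightarrow> p \<in> U \<Longrightarrow> chart_tvec A (U, \<phi>) p v \<in> tangent_space A p"
  by (simp add: tangent_space_chart)

lemma tangent_space_points: "w \<in> tangent_space A p \<Longrightarrow> p \<in> points A"
  by (force simp: tangent_space_def points_def)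

lemma smooth_near_differentiable:
  "(U, \<phi>) \<in> A \<Longrightarrow> p \<in> U \<Longrightarrow> smooth_near A p f \<Longrightarrow> (\<lambda>x. f (inv_into U \<phi> x)) differentiable (at (\<phi> p))"
  by (simp add: smooth_near_iff smooth_at_differentiable)

lemma chart_tvec_linear:
  assumes "(U, \<phi>) \<in> A" "p \<in> U"
  shows "linear (\<lambda>v. chart_tvec A (U, \<phi>) p v f)"
proof (cases "smooth_near A p f")
  case True
  then show ?thesis
    using linear_frechet_derivative[OF smooth_near_differentiable[OF assms True]]
    by (simp add: chart_tvec_apply)
next
  case False
  then show ?thesis by (simp add: chart_tvec_not_smooth linear_zero)
qed

lemma chart_tvec_add:
  "(U, \<phi>) \<in> A \<Longrightarrow> p \<in> U \<Longrightarrow>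
    chart_tvec A (U, \<phi>) p (v + w) = chart_tvec A (U, \<phi>) p v + chart_tvec A (U, \<phi>) p w"
  using linear_add[OF chart_tvec_linear] by (auto simp: fun_eq_iff)

lemma chart_tvec_scale:
  "(U, \<phi>) \<in> A \<Longrightarrow> p \<in> U \<Longrightarrow>
    chart_tvec A (U, \<phi>) p (r *\<^sub>R v) = scale r (chart_tvec A (U, \<phi>) p v)"
  using linear_scale[OF chart_tvec_linear] by (auto simp: fun_eq_iff scale_def)

lemma tangent_add: "v \<in> tangent_space A p \<Longrightarrow> w \<in> tangent_space A p \<Longrightarrow> v + w \<in> tangent_space A p"
  by (frule tangent_space_points, erule pointsE)
    (auto simp: tangent_space_chart chart_tvec_add[symmetric])

lemma tangent_scale: "v \<in> tangent_space A p \<Longrightarrow> scale r v \<in> tangent_space A p"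
  by (frule tangent_space_points, erule pointsE)
    (auto simp: tangent_space_chart chart_tvec_scale[symmetric])

lemma tangent_uminus: "v \<in> tangent_space A p \<Longrightarrow> - v \<in> tangent_space A p"
  using tangent_scale[of v p "-1"] by (simp add: scale_def fun_Compl_def)

lemma tangent_diff: "v \<in> tangent_space A p \<Longrightarrow> w \<in> tangent_space A p \<Longrightarrow> v - w \<in> tangent_space A p"
  using tangent_add[OF _ tangent_uminus, of v p w] by simp

lemma tangent_zero: "p \<in> points A \<Longrightarrow> 0 \<in> tangent_space A p"
  by (metis pointsE chart_tvec_in_tangent_space tangent_diff diff_self)

lemma tvec_not_smooth: "w \<in> tangent_space A p \<Longrightarrow> \<not> smooth_near A p f \<Longrightarrow> w f = 0"
  by (auto simp: tangent_space_def chart_tvec_not_smooth)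

text \<open>Smoothness near p is itself a property of the germ, so the default value 0 is taken on
  both sides or on neither.\<close>

lemma tvec_cong:
  assumes w: "w \<in> tangent_space A p" and ev: "\<forall>\<^sub>F q in mnhds A p. f q = g q"
  shows "w f = w g"
proof -
  obtain U \<phi> where c: "(U, \<phi>) \<in> A" "p \<in> U"
    using pointsE[OF tangent_space_points[OF w]] .
  obtain v where v: "w = chart_tvec A (U, \<phi>) p v"
    using w tangent_space_chart[OF c] by auto
  have "smooth_near A p f \<longleftrightarrow> smooth_near A p g"
    using smooth_near_cong ev by (metis (mono_tags, lifting) eventually_mono)
  moreover have "frechet_derivative (\<lambda>x. f (inv_into U \<phi> x)) (at (\<phi> p)) = frechet_derivative (\<lambda>x. g (inv_into U \<phi> x)) (at (\<phi> p))"
    using ev unfolding eventually_mnhds_chart[OF c] by (rule frechet_derivative_cong)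
  ultimately show ?thesis
    by (cases "smooth_near A p f") (simp_all add: v chart_tvec_apply chart_tvec_not_smooth)
qed

lemma tvec_const: "w \<in> tangent_space A p \<Longrightarrow> w (\<lambda>q. k) = 0"
  by (frule tangent_space_points, erule pointsE)
    (auto simp: tangent_space_chart chart_tvec_apply smooth_near_const chart_points frechet_derivative_const)

lemma tvec_add:
  assumes w: "w \<in> tangent_space A p" and f: "smooth_near A p f" and g: "smooth_near A p g"
  shows "w (\<lambda>q. f q + g q) = w f + w g"
proof -
  obtain U \<phi> where c: "(U, \<phi>) \<in> A" "p \<in> U"
    using pointsE[OF tangent_space_points[OF w]] .
  obtain v where v: "w = chart_tvec A (U, \<phi>) p v"
    using w tangent_space_chart[OF c] by auto
  show ?thesis
    using frechet_derivative_eqI[OF has_derivative_add[OF f[unfolded smooth_near_iff[OF c], THEN smooth_at_has_derivative]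
          g[unfolded smooth_near_iff[OF c], THEN smooth_at_has_derivative]]]
    by (simp add: v chart_tvec_apply[OF f] chart_tvec_apply[OF g] chart_tvec_apply[OF smooth_near_add[OF f g]])
qed

lemma tvec_mult:
  assumes w: "w \<in> tangent_space A p" and f: "smooth_near A p f" and g: "smooth_near A p g"
  shows "w (\<lambda>q. f q * g q) = f p * w g + w f * g p"
proof -
  obtain U \<phi> where c: "(U, \<phi>) \<in> A" "p \<in> U"
    using pointsE[OF tangent_space_points[OF w]] .
  obtain v where v: "w = chart_tvec A (U, \<phi>) p v"
    using w tangent_space_chart[OF c] by auto
  show ?thesis
    using frechet_derivative_eqI[OF has_derivative_mult[OF f[unfolded smooth_near_iff[OF c], THEN smooth_at_has_derivative]
          g[unfolded smooth_near_iff[OF c], THEN smooth_at_has_derivative]]] c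
    by (simp add: v chart_tvec_apply[OF f] chart_tvec_apply[OF g] chart_tvec_apply[OF smooth_near_mult[OF f g]])
qed

lemma tvec_cmult: "w \<in> tangent_space A p \<Longrightarrow> smooth_near A p f \<Longrightarrow> w (\<lambda>q. k * f q) = k * w f"
  using tvec_mult[OF _ smooth_near_const, of w p f k] by (simp add: tvec_const smooth_near_points)

lemma tvec_uminus: "w \<in> tangent_space A p \<Longrightarrow> smooth_near A p f \<Longrightarrow> w (\<lambda>q. - f q) = - w f"
  using tvec_cmult[of w p f "-1"] by simp

lemma tvec_diff:
  "w \<in> tangent_space A p \<Longrightarrow> smooth_near A p f \<Longrightarrow> smooth_near A p g \<Longrightarrow> w (\<lambda>q. f q - g q) = w f - w g"
  using tvec_add[of w p f "\<lambda>q. - g q"] by (simp add: tvec_uminus smooth_near_uminus)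

lemma tvec_sum:
  assumes "w \<in> tangent_space A p" "finite I" "\<And>i. i \<in> I \<Longrightarrow> smooth_near A p (f i)"
  shows "w (\<lambda>q. \<Sum>i\<in>I. f i q) = (\<Sum>i\<in>I. w (f i))"
  using assms(2,3)
  by (induction I) (auto simp: tvec_const[OF assms(1)] tvec_add[OF assms(1)] smooth_near_sum tangent_space_points[OF assms(1)])

lemma chart_tvec_coord:
  assumes c: "(U, \<phi>) \<in> A" "p \<in> U"
  shows "chart_tvec A (U, \<phi>) p v (\<lambda>q. \<phi> q \<bullet> b) = v \<bullet> b"
proof -
  have "\<forall>\<^sub>F x in nhds (\<phi> p). \<phi> (inv_into U \<phi> x) \<bullet> b = x \<bullet> b"
    using eventually_nhds_chart_image[OF c] by (auto elim!: eventually_mono simp: f_inv_into_f)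
  then have "frechet_derivative (\<lambda>x. \<phi> (inv_into U \<phi> x) \<bullet> b) (at (\<phi> p)) = frechet_derivative (\<lambda>x. x \<bullet> b) (at (\<phi> p))"
    by (rule frechet_derivative_cong)
  also have "\<dots> = (\<lambda>x. x \<bullet> b)"
    by (intro frechet_derivative_eqI bounded_linear_imp_has_derivative bounded_linear_inner_left)
  finally show ?thesis by (simp add: chart_tvec_apply smooth_near_coord[OF c])
qed

lemma tvec_chart:
  assumes c: "(U, \<phi>) \<in> A" "p \<in> U" and w: "w \<in> tangent_space A p"
  shows "w = chart_tvec A (U, \<phi>) p (\<Sum>b\<in>Basis. w (\<lambda>q. \<phi> q \<bullet> b) *\<^sub>R b)"
proof -
  obtain v where v: "w = chart_tvec A (U, \<phi>) p v"
    using w tangent_space_chart[OF c] by auto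
  then have "(\<Sum>b\<in>Basis. w (\<lambda>q. \<phi> q \<bullet> b) *\<^sub>R b) = v"
    by (simp add: chart_tvec_coord[OF c] euclidean_representation)
  then show ?thesis by (simp add: v)
qed

lemma tvec_expand:
  assumes c: "(U, \<phi>) \<in> A" "p \<in> U" and w: "w \<in> tangent_space A p"
  shows "w f = (\<Sum>b\<in>Basis. w (\<lambda>q. \<phi> q \<bullet> b) * chart_tvec A (U, \<phi>) p b f)"
proof -
  obtain v where v: "w = chart_tvec A (U, \<phi>) p v"
    using w tangent_space_chart[OF c] by auto
  show ?thesis
    using linear_Basis_sum[OF chart_tvec_linear[OF c, of f], of v]
    by (simp add: v chart_tvec_coord[OF c])
qed

lemma tvec_eqI:
  assumes c: "(U, \<phi>) \<in> A" "p \<in> U" and w: "w \<in> tangent_space A p" "w' \<in> tangent_space A p"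
    and eq: "\<And>b. b \<in> Basis \<Longrightarrow> w (\<lambda>q. \<phi> q \<bullet> b) = w' (\<lambda>q. \<phi> q \<bullet> b)"
  shows "w = w'"
proof
  fix f
  have "w f = (\<Sum>b\<in>Basis. w (\<lambda>q. \<phi> q \<bullet> b) * chart_tvec A (U, \<phi>) p b f)"
    by (rule tvec_expand[OF c w(1)])
  also have "\<dots> = (\<Sum>b\<in>Basis. w' (\<lambda>q. \<phi> q \<bullet> b) * chart_tvec A (U, \<phi>) p b f)"
    using eq by (intro sum.cong) auto
  also have "\<dots> = w' f"
    by (rule tvec_expand[OF c w(2), symmetric])
  finally show "w f = w' f" .
qed

lemma coord_field_smooth:
  assumes c: "(U, \<phi>) \<in> A" "p \<in> U" and f: "smooth_near A p f"
  shows "smooth_near A p (\<lambda>q. chart_tvec A (U, \<phi>) q v f)"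
proof -
  define F where "F = (\<lambda>x. f (inv_into U \<phi> x))"
  have "smooth_at F (\<phi> p)" using f smooth_near_iff[OF c] by (simp add: F_def)
  then have "smooth_at (\<lambda>x. frechet_derivative F (at x) v) (\<phi> p)"
    by (rule smooth_at_frechet)
  moreover have "\<forall>\<^sub>F x in nhds (\<phi> p). frechet_derivative F (at x) v = chart_tvec A (U, \<phi>) (inv_into U \<phi> x) v f"
    using smooth_near_eventually[OF f, unfolded eventually_mnhds_chart[OF c]] eventually_nhds_chart_image[OF c]
    by eventually_elim (auto simp: chart_tvec_apply F_def f_inv_into_f)
  ultimately show ?thesis
    unfolding smooth_near_iff[OF c] by (rule smooth_at_cong)
qed

text \<open>Symmetry of second derivatives, in the form that makes the Lie bracket a first-order
  operator.\<close>

lemma coord_fields_commute: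
  assumes c: "(U, \<phi>) \<in> A" "p \<in> U" and f: "smooth_near A p f"
  shows "chart_tvec A (U, \<phi>) p u (\<lambda>q. chart_tvec A (U, \<phi>) q v f)
    = chart_tvec A (U, \<phi>) p v (\<lambda>q. chart_tvec A (U, \<phi>) q u f)"
proof -
  define F where "F = (\<lambda>x. f (inv_into U \<phi> x))"
  have F: "smooth_at F (\<phi> p)" using f smooth_near_iff[OF c] by (simp add: F_def)
  have "\<forall>\<^sub>F x in nhds (\<phi> p). chart_tvec A (U, \<phi>) (inv_into U \<phi> x) v f = frechet_derivative F (at x) v" for v
    using smooth_near_eventually[OF f, unfolded eventually_mnhds_chart[OF c]] eventually_nhds_chart_image[OF c]
    by eventually_elim (auto simp: chart_tvec_apply F_def f_inv_into_f)
  from frechet_derivative_cong[OF this]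
  have "chart_tvec A (U, \<phi>) p u (\<lambda>q. chart_tvec A (U, \<phi>) q v f) =
      frechet_derivative (\<lambda>x. frechet_derivative F (at x) v) (at (\<phi> p)) u" for u v
    by (simp add: chart_tvec_apply[OF coord_field_smooth[OF c f]])
  then show ?thesis using frechet_derivative_symmetric[OF F] by simp
qed

end

section \<open>Vector fields and tensoriality\<close>

lemma scale_apply [simp]: "scale r v x = r * v x"
  by (simp add: scale_def)

lemma scale_zero_right [simp]: "scale r 0 = 0" and scale_zero_left [simp]: "scale 0 v = 0"
  and scale_one [simp]: "scale 1 v = v"
  by (auto simp: fun_eq_iff)

lemma fscale_apply [simp]: "fscale f X p = scale (f p) (X p)"
  by (simp add: fscale_def)

lemma app_apply [simp]: "app J X p = J p (X p)"
  by (simp add: app_def)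

lemma sum_fun_apply: "(\<Sum>i\<in>I. f i) x = (\<Sum>i\<in>I. f i x)"
  by (induction I rule: infinite_finite_induct) auto

lemma lie_bracket_apply:
  "smooth_near A p f \<Longrightarrow> lie_bracket A X Y p f = X p (\<lambda>q. Y q f) - Y p (\<lambda>q. X q f)"
  by (simp add: lie_bracket_def)

lemma lie_bracket_skew: "lie_bracket A Y X = - lie_bracket A X Y"
  by (auto simp: lie_bracket_def fun_eq_iff)

context atlas
begin

lemma vf_tangent: "X \<in> vector_fields A \<Longrightarrow> p \<in> points A \<Longrightarrow> X p \<in> tangent_space A p"
  by (simp add: vector_fields_def)

lemma vf_outside: "X \<in> vector_fields A \<Longrightarrow> p \<notin> points A \<Longrightarrow> X p = 0"
  by (simp add: vector_fields_def)

lemma vf_smooth: "X \<in> vector_fields A \<Longrightarrow> smooth_near A p f \<Longrightarrow> smooth_near A p (\<lambda>q. X q f)"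
  using smooth_near_points by (simp add: vector_fields_def)

lemma vf_not_smooth: "X \<in> vector_fields A \<Longrightarrow> \<not> smooth_near A p f \<Longrightarrow> X p f = 0"
  using tvec_not_smooth[OF vf_tangent[of X p]] vf_outside[of X p] by (cases "p \<in> points A") auto

lemma vfI:
  assumes "\<And>p. p \<in> points A \<Longrightarrow> X p \<in> tangent_space A p"
    and "\<And>p. p \<notin> points A \<Longrightarrow> X p = 0"
    and "\<And>p f. smooth_near A p f \<Longrightarrow> smooth_near A p (\<lambda>q. X q f)"
  shows "X \<in> vector_fields A"
  using assms by (simp add: vector_fields_def)

lemma vf_eqI:
  assumes "X \<in> vector_fields A" "Y \<in> vector_fields A"
    and "\<And>p f. smooth_near A p f \<Longrightarrow> X p f = Y p f"
  shows "X = Y"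
proof (intro ext)
  fix p f show "X p f = Y p f"
    using assms(3) vf_not_smooth[OF assms(1)] vf_not_smooth[OF assms(2)]
    by (cases "smooth_near A p f") simp_all
qed

lemma vf_zero: "0 \<in> vector_fields A"
  by (rule vfI) (auto simp: tangent_zero smooth_near_const smooth_near_points)

lemma vf_add: "X \<in> vector_fields A \<Longrightarrow> Y \<in> vector_fields A \<Longrightarrow> X + Y \<in> vector_fields A"
  by (rule vfI) (simp_all add: vf_tangent vf_outside[of X] vf_outside[of Y] tangent_add smooth_near_add vf_smooth)

lemma vf_diff: "X \<in> vector_fields A \<Longrightarrow> Y \<in> vector_fields A \<Longrightarrow> X - Y \<in> vector_fields A"
  by (rule vfI) (simp_all add: vf_tangent vf_outside[of X] vf_outside[of Y] tangent_diff smooth_near_diff vf_smooth)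

lemma vf_uminus: "X \<in> vector_fields A \<Longrightarrow> - X \<in> vector_fields A"
  using vf_diff[OF vf_zero] by simp

lemma vf_fscale: "X \<in> vector_fields A \<Longrightarrow> smooth_function A f \<Longrightarrow> fscale f X \<in> vector_fields A"
  by (rule vfI) (simp_all add: vf_tangent vf_outside[of X] tangent_scale smooth_functionD smooth_near_points
      smooth_near_mult vf_smooth)

lemma vf_sum: "(\<And>i. i \<in> I \<Longrightarrow> X i \<in> vector_fields A) \<Longrightarrow> (\<Sum>i\<in>I. X i) \<in> vector_fields A"
  by (induction I rule: infinite_finite_induct) (auto intro: vf_add vf_zero)

lemma vf_smooth_function: "X \<in> vector_fields A \<Longrightarrow> smooth_function A f \<Longrightarrow> smooth_function A (\<lambda>q. X q f)"
  by (simp add: smooth_function_def vf_smooth)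

lemma smooth_function_mult: "smooth_function A f \<Longrightarrow> smooth_function A g \<Longrightarrow> smooth_function A (\<lambda>q. f q * g q)"
  by (simp add: smooth_function_def smooth_near_mult)

lemma smooth_function_const: "smooth_function A (\<lambda>q. c)"
  by (simp add: smooth_function_def smooth_near_const)

text \<open>Tangent vectors are directional derivatives in a chart, not abstract derivations, so the
  bracket has to be exhibited as one: its second-order terms must be shown to cancel.\<close>

lemma lie_bracket_tangent:
  assumes X: "X \<in> vector_fields A" and Y: "Y \<in> vector_fields A" and p: "p \<in> points A"
  shows "lie_bracket A X Y p \<in> tangent_space A p"
proof -
  obtain U \<phi> where c: "(U, \<phi>) \<in> A" "p \<in> U" using pointsE[OF p] .
  define x where "x = (\<lambda>b q. \<phi> q \<bullet> b)"
  define d where "d = (\<lambda>b f q. chart_tvec A (U, \<phi>) q b f)"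
  have x: "smooth_near A p (x b)" for b
    unfolding x_def by (rule smooth_near_coord[OF c])
  \<comment> \<open>The first sum is of first order in f; the double sum collects all second
    derivatives.\<close>
  have second: "X p (\<lambda>q. Y q f) = (\<Sum>b\<in>Basis. X p (\<lambda>q. Y q (x b)) * d b f p)
      + (\<Sum>b\<in>Basis. \<Sum>b'\<in>Basis. Y p (x b) * (X p (x b') * d b' (d b f) p))"
    if X: "X \<in> vector_fields A" and Y: "Y \<in> vector_fields A" and f: "smooth_near A p f" for X Y f
  proof -
    have df: "smooth_near A p (d b f)" for b
      unfolding d_def by (rule coord_field_smooth[OF c f])
    have second: "X p (d b f) = (\<Sum>b'\<in>Basis. X p (x b') * d b' (d b f) p)" for b
      using tvec_expand[OF c vf_tangent[OF X p], of "d b f"] by (simp add: x_def d_def)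
    have "\<forall>\<^sub>F q in mnhds A p. Y q f = (\<Sum>b\<in>Basis. Y q (x b) * d b f q)"
      using eventually_mnhds_domain[OF c]
      by eventually_elim (use c chart_points vf_tangent[OF Y] tvec_expand in \<open>auto simp: x_def d_def\<close>)
    then have "X p (\<lambda>q. Y q f) = X p (\<lambda>q. \<Sum>b\<in>Basis. Y q (x b) * d b f q)"
      by (rule tvec_cong[OF vf_tangent[OF X p]])
    also have "\<dots> = (\<Sum>b\<in>Basis. X p (\<lambda>q. Y q (x b) * d b f q))"
      by (rule tvec_sum[OF vf_tangent[OF X p]]) (simp_all add: smooth_near_mult df vf_smooth[OF Y] x)
    also have "\<dots> = (\<Sum>b\<in>Basis. Y p (x b) * X p (d b f) + X p (\<lambda>q. Y q (x b)) * d b f p)"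
      by (intro sum.cong refl tvec_mult vf_tangent[OF X p] df vf_smooth[OF Y] x)
    finally show ?thesis by (simp add: second sum.distrib sum_distrib_left)
  qed
  have "lie_bracket A X Y p f = chart_tvec A (U, \<phi>) p
      (\<Sum>b\<in>Basis. (X p (\<lambda>q. Y q (x b)) - Y p (\<lambda>q. X q (x b))) *\<^sub>R b) f" (is "_ = ?R") for f
  proof (cases "smooth_near A p f")
    case True
    \<comment> \<open>Commuting coordinate fields make the second-order parts of X(Y f) and Y(X f)
      equal.\<close>
    have "(\<Sum>b\<in>Basis. \<Sum>b'\<in>Basis. Y p (x b) * (X p (x b') * d b' (d b f) p))
        = (\<Sum>b\<in>Basis. \<Sum>b'\<in>Basis. X p (x b) * (Y p (x b') * d b' (d b f) p))"
      using coord_fields_commute[OF c True]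
      by (subst sum.swap) (simp add: d_def mult.left_commute)
    then have "lie_bracket A X Y p f =
        (\<Sum>b\<in>Basis. (X p (\<lambda>q. Y q (x b)) - Y p (\<lambda>q. X q (x b))) * d b f p)"
      using second[OF X Y True] second[OF Y X True]
      by (simp add: lie_bracket_apply[OF True] left_diff_distrib sum_subtractf)
    also have "\<dots> = ?R"
      by (simp add: d_def linear_sum[OF chart_tvec_linear[OF c]] linear_scale[OF chart_tvec_linear[OF c]])
    finally show ?thesis .
  qed (simp add: lie_bracket_def chart_tvec_not_smooth)
  then have "lie_bracket A X Y p = chart_tvec A (U, \<phi>) p
      (\<Sum>b\<in>Basis. (X p (\<lambda>q. Y q (x b)) - Y p (\<lambda>q. X q (x b))) *\<^sub>R b)" by blast
  then show ?thesis using c by simp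
qed

lemma lie_bracket_vf:
  assumes X: "X \<in> vector_fields A" and Y: "Y \<in> vector_fields A"
  shows "lie_bracket A X Y \<in> vector_fields A"
proof (rule vfI)
  show "lie_bracket A X Y p = 0" if "p \<notin> points A" for p
    using that smooth_near_points by (auto simp: lie_bracket_def fun_eq_iff)
next
  fix p f assume f: "smooth_near A p f"
  have "smooth_near A p (\<lambda>q. X q (\<lambda>r. Y r f) - Y q (\<lambda>r. X r f))"
    by (intro smooth_near_diff vf_smooth[OF X] vf_smooth[OF Y] f)
  then show "smooth_near A p (\<lambda>q. lie_bracket A X Y q f)"
  proof (rule smooth_near_cong)
    show "\<forall>\<^sub>F q in mnhds A p. X q (\<lambda>r. Y r f) - Y q (\<lambda>r. X r f) = lie_bracket A X Y q f"
      using smooth_near_eventually[OF f] by eventually_elim (simp add: lie_bracket_apply)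
  qed
qed (rule lie_bracket_tangent[OF X Y])

lemma tvec_lie_bracket:
  assumes w: "w \<in> tangent_space A p" and f: "smooth_near A p f"
    and X: "X \<in> vector_fields A" and Y: "Y \<in> vector_fields A"
  shows "w (\<lambda>q. lie_bracket A X Y q f) = w (\<lambda>q. X q (\<lambda>r. Y r f)) - w (\<lambda>q. Y q (\<lambda>r. X r f))"
proof -
  have "\<forall>\<^sub>F q in mnhds A p. lie_bracket A X Y q f = X q (\<lambda>r. Y r f) - Y q (\<lambda>r. X r f)"
    using smooth_near_eventually[OF f] by eventually_elim (simp add: lie_bracket_apply)
  then have "w (\<lambda>q. lie_bracket A X Y q f) = w (\<lambda>q. X q (\<lambda>r. Y r f) - Y q (\<lambda>r. X r f))"
    by (rule tvec_cong[OF w])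
  also have "\<dots> = w (\<lambda>q. X q (\<lambda>r. Y r f)) - w (\<lambda>q. Y q (\<lambda>r. X r f))"
    by (intro tvec_diff[OF w] vf_smooth[OF X] vf_smooth[OF Y] f)
  finally show ?thesis .
qed

lemma lie_bracket_add_left:
  assumes "X \<in> vector_fields A" "X' \<in> vector_fields A" "Y \<in> vector_fields A"
  shows "lie_bracket A (X + X') Y = lie_bracket A X Y + lie_bracket A X' Y"
  by (intro vf_eqI vf_add lie_bracket_vf assms)
    (simp add: lie_bracket_apply tvec_add[OF vf_tangent[OF assms(3)]] vf_smooth smooth_near_points assms)

lemma lie_bracket_add_right:
  assumes "X \<in> vector_fields A" "Y \<in> vector_fields A" "Y' \<in> vector_fields A"
  shows "lie_bracket A X (Y + Y') = lie_bracket A X Y + lie_bracket A X Y'"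
  by (intro vf_eqI vf_add lie_bracket_vf assms)
    (simp add: lie_bracket_apply tvec_add[OF vf_tangent[OF assms(1)]] vf_smooth smooth_near_points assms)

lemma lie_bracket_fscale_left:
  assumes "X \<in> vector_fields A" "Y \<in> vector_fields A" "smooth_function A f"
  shows "lie_bracket A (fscale f X) Y = fscale f (lie_bracket A X Y) - fscale (\<lambda>p. Y p f) X"
  by (intro vf_eqI vf_fscale vf_diff lie_bracket_vf vf_smooth_function[OF assms(2)] assms)
    (simp add: lie_bracket_apply tvec_mult[OF vf_tangent[OF assms(2)]] vf_smooth smooth_near_points smooth_functionD
      assms algebra_simps)

lemma lie_bracket_uminus_left:
  assumes "X \<in> vector_fields A" "Y \<in> vector_fields A"
  shows "lie_bracket A (- X) Y = - lie_bracket A X Y"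
  by (intro vf_eqI vf_uminus lie_bracket_vf assms)
    (simp add: lie_bracket_apply tvec_uminus[OF vf_tangent[OF assms(2)]] vf_smooth smooth_near_points assms)

lemma lie_bracket_jacobi:
  assumes "X \<in> vector_fields A" "Y \<in> vector_fields A" "Z \<in> vector_fields A"
  shows "lie_bracket A (lie_bracket A X Y) Z =
    lie_bracket A X (lie_bracket A Y Z) - lie_bracket A Y (lie_bracket A X Z)"
  by (intro vf_eqI vf_diff lie_bracket_vf assms)
    (simp add: lie_bracket_apply tvec_lie_bracket[OF vf_tangent[OF assms(1)]] tvec_lie_bracket[OF vf_tangent[OF assms(2)]]
      tvec_lie_bracket[OF vf_tangent[OF assms(3)]] vf_smooth smooth_near_points assms)

text \<open>Smoothness of F enters only through pulled-back functions: the components of its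
  coordinate expression G are pulled-back coordinates, so G is smooth and the chain rule yields the
  image vector. The continuity hypothesis keeps F in the target chart near p.\<close>

lemma pushforward_tangent:
  fixes B :: "('b, 'f::euclidean_space) chart set"
  assumes B: "atlas B" and w: "w \<in> tangent_space A p" and Fp: "F p \<in> points B"
    and smooth: "\<And>f. smooth_near B (F p) f \<Longrightarrow> smooth_near A p (\<lambda>q. f (F q))"
    and cont: "\<And>V \<psi>. (V, \<psi>) \<in> B \<Longrightarrow> F p \<in> V \<Longrightarrow> \<forall>\<^sub>F q in mnhds A p. F q \<in> V"
  shows "pushforward B F p w \<in> tangent_space B (F p)"
proof -
  interpret B: atlas B by (rule B)
  obtain V \<psi> where d: "(V, \<psi>) \<in> B" "F p \<in> V" using B.pointsE[OF Fp] .
  obtain U \<phi> where c: "(U, \<phi>) \<in> A" "p \<in> U"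
    using pointsE[OF tangent_space_points[OF w]] .
  obtain v where v: "w = chart_tvec A (U, \<phi>) p v"
    using w tangent_space_chart[OF c] by auto
  define G where "G = (\<lambda>x. \<psi> (F (inv_into U \<phi> x)))"
  have G: "smooth_at G (\<phi> p)"
    unfolding G_def using smooth[OF B.smooth_near_coord[OF d], unfolded smooth_near_iff[OF c]]
    by (rule smooth_at_componentwise)
  have Gp: "G (\<phi> p) = \<psi> (F p)" using c by (simp add: G_def)
  have "pushforward B F p w f = chart_tvec B (V, \<psi>) (F p) (frechet_derivative G (at (\<phi> p)) v) f" for f
  proof (cases "smooth_near B (F p) f")
    case True
    define H where "H = (\<lambda>y. f (inv_into V \<psi> y))"
    have H: "smooth_at H (G (\<phi> p))"
      using True B.smooth_near_iff[OF d] Gp by (simp add: H_def)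
    have "\<forall>\<^sub>F x in nhds (\<phi> p). f (F (inv_into U \<phi> x)) = H (G x)"
      using cont[OF d] unfolding eventually_mnhds_chart[OF c]
      by eventually_elim (simp add: H_def G_def d)
    then have "frechet_derivative (\<lambda>x. f (F (inv_into U \<phi> x))) (at (\<phi> p)) = frechet_derivative (\<lambda>x. H (G x)) (at (\<phi> p))"
      by (rule frechet_derivative_cong)
    also have "\<dots> = (\<lambda>v. frechet_derivative H (at (G (\<phi> p))) (frechet_derivative G (at (\<phi> p)) v))"
      by (rule frechet_derivative_eqI[OF has_derivative_compose[OF smooth_at_has_derivative[OF G]
            smooth_at_has_derivative[OF H]]])
    finally show ?thesis
      using True by (simp add: pushforward_def v o_def chart_tvec_apply[OF smooth[OF True]]
          B.chart_tvec_apply[OF True] Gp H_def)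
  qed (simp add: pushforward_def B.chart_tvec_not_smooth)
  then have "pushforward B F p w = chart_tvec B (V, \<psi>) (F p) (frechet_derivative G (at (\<phi> p)) v)"
    by blast
  then show ?thesis using d by simp
qed

end

text \<open>The last clause keeps the support away from the boundary of U, so that data given only
  on U become smooth on the whole manifold after multiplication by \<rho> and extension by
  0.\<close>

definition cutoff :: "('a, 'e::euclidean_space) chart set \<Rightarrow> 'a set \<Rightarrow> ('a \<Rightarrow> real) \<Rightarrow> bool" where
  "cutoff A U \<rho> \<longleftrightarrow> smooth_function A \<rho> \<and> (\<forall>q. q \<notin> U \<longrightarrow> \<rho> q = 0) \<and>
     (\<forall>q\<in>points A - U. \<forall>\<^sub>F r in mnhds A q. \<rho> r = 0)"

text \<open>Cutoffs are only required for chart domains, so that this notion passes to the cotangent bundle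
  by pulling back along the projection; no topology on the cotangent bundle is needed.\<close>

locale bump_atlas = atlas +
  assumes bump: "(U, \<phi>) \<in> A \<Longrightarrow> p \<in> U \<Longrightarrow> \<exists>\<rho>. cutoff A U \<rho> \<and> (\<forall>\<^sub>F q in mnhds A p. \<rho> q = 1)"

context atlas
begin

lemma cutoff_smooth:
  assumes rho: "cutoff A U \<rho>" and f: "\<And>q. q \<in> U \<Longrightarrow> smooth_near A q f"
  shows "smooth_function A (\<lambda>q. \<rho> q * f q)"
  unfolding smooth_function_def
proof
  fix q assume q: "q \<in> points A"
  show "smooth_near A q (\<lambda>q. \<rho> q * f q)"
  proof (cases "q \<in> U")
    case True
    then show ?thesis
      using smooth_near_mult[OF smooth_functionD[OF _ q] f[OF True]] rho by (simp add: cutoff_def)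
  next
    case False
    then have "\<forall>\<^sub>F r in mnhds A q. \<rho> r = 0" using rho q by (simp add: cutoff_def)
    then have "\<forall>\<^sub>F r in mnhds A q. 0 = \<rho> r * f r" by eventually_elim simp
    then show ?thesis by (rule smooth_near_cong[OF smooth_near_const[OF q]])
  qed
qed

lemma cutoff_coord_field:
  assumes c: "(U, \<phi>) \<in> A" and rho: "cutoff A U \<rho>"
  shows "(\<lambda>q. scale (\<rho> q) (chart_tvec A (U, \<phi>) q v)) \<in> vector_fields A"
proof (rule vfI)
  fix p
  have out: "\<rho> q = 0" if "q \<notin> U" for q using rho that by (simp add: cutoff_def)
  show "scale (\<rho> p) (chart_tvec A (U, \<phi>) p v) \<in> tangent_space A p" if "p \<in> points A"
    using that c by (cases "p \<in> U") (auto intro: tangent_scale tangent_zero simp: out)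
  show "scale (\<rho> p) (chart_tvec A (U, \<phi>) p v) = 0" if "p \<notin> points A"
  proof -
    have "p \<notin> U" using that chart_points[OF c] by blast
    then show ?thesis by (simp add: out)
  qed
  show "smooth_near A p (\<lambda>q. scale (\<rho> q) (chart_tvec A (U, \<phi>) q v) f)" if f: "smooth_near A p f" for f
  proof (cases "p \<in> U")
    case True
    show ?thesis
      using smooth_near_mult[OF smooth_functionD[OF _ smooth_near_points[OF f]] coord_field_smooth[OF c True f]] rho
      by (simp add: cutoff_def)
  next
    case False
    then have "\<forall>\<^sub>F r in mnhds A p. \<rho> r = 0"
      using rho smooth_near_points[OF f] by (simp add: cutoff_def)
    then have "\<forall>\<^sub>F r in mnhds A p. 0 = scale (\<rho> r) (chart_tvec A (U, \<phi>) r v) f"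
      by eventually_elim simp
    then show ?thesis by (rule smooth_near_cong[OF smooth_near_const[OF smooth_near_points[OF f]]])
  qed
qed

end

context bump_atlas
begin

text \<open>Connections and one-forms are tested on global fields only, so coordinate fields become
  usable after multiplication by a cutoff, which changes nothing near p.\<close>

lemma local_frame:
  assumes c: "(U, \<phi>) \<in> A" "p \<in> U"
  obtains E where "\<And>v. E v \<in> vector_fields A"
    "\<forall>\<^sub>F q in mnhds A p. \<forall>v. E v q = chart_tvec A (U, \<phi>) q v"
proof -
  obtain \<rho> where rho: "cutoff A U \<rho>" "\<forall>\<^sub>F q in mnhds A p. \<rho> q = 1" using bump[OF c] by blast
  show thesis
  proof (rule that)
    show "(\<lambda>q. scale (\<rho> q) (chart_tvec A (U, \<phi>) q v)) \<in> vector_fields A" for v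
      by (rule cutoff_coord_field[OF c(1) rho(1)])
    show "\<forall>\<^sub>F q in mnhds A p. \<forall>v. scale (\<rho> q) (chart_tvec A (U, \<phi>) q v) = chart_tvec A (U, \<phi>) q v"
      using rho(2) by eventually_elim simp
  qed
qed

lemma tvec_extend:
  assumes w: "w \<in> tangent_space A p"
  obtains X where "X \<in> vector_fields A" "X p = w"
proof -
  obtain U \<phi> where c: "(U, \<phi>) \<in> A" "p \<in> U"
    using pointsE[OF tangent_space_points[OF w]] .
  obtain v where v: "w = chart_tvec A (U, \<phi>) p v"
    using w tangent_space_chart[OF c] by auto
  obtain E where E: "\<And>v. E v \<in> vector_fields A"
    "\<forall>\<^sub>F q in mnhds A p. \<forall>v. E v q = chart_tvec A (U, \<phi>) q v"
    using local_frame[OF c] by blast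
  show thesis
    using that[OF E(1)[of v]] eventually_mnhds_self[OF E(2)] chart_points[OF c] v by blast
qed

text \<open>A cut-off, normalised coordinate. Subtracting h times a one-form changes nothing at p to
  order zero but shifts the derivative along w; this is what corrects an extension to a parallel one
  later.\<close>

lemma exists_function_tvec_one:
  assumes w: "w \<in> tangent_space A p" "w \<noteq> 0"
  obtains h where "smooth_function A h" "h p = 0" "w h = 1"
proof -
  have p: "p \<in> points A" by (rule tangent_space_points[OF w(1)])
  obtain U \<phi> where c: "(U, \<phi>) \<in> A" "p \<in> U" using pointsE[OF p] .
  obtain b where b: "w (\<lambda>q. \<phi> q \<bullet> b) \<noteq> 0"
    using tvec_eqI[OF c w(1) tangent_zero[OF p]] w(2) by auto
  obtain \<rho> where rho: "cutoff A U \<rho>" "\<forall>\<^sub>F q in mnhds A p. \<rho> q = 1" using bump[OF c] by blast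
  have r1: "\<rho> p = 1" by (rule eventually_mnhds_self[OF rho(2) p])
  define k where "k = inverse (w (\<lambda>q. \<phi> q \<bullet> b))"
  define f where "f = (\<lambda>q. k * (\<phi> q \<bullet> b - \<phi> p \<bullet> b))"
  have sd: "smooth_near A q (\<lambda>q. \<phi> q \<bullet> b - \<phi> p \<bullet> b)" if "q \<in> U" for q
    by (intro smooth_near_diff smooth_near_coord[OF c(1) that] smooth_near_const chart_points[OF c(1) that])
  have sf: "smooth_near A q f" if "q \<in> U" for q
    unfolding f_def by (intro smooth_near_mult sd[OF that] smooth_near_const chart_points[OF c(1) that])
  have "w (\<lambda>q. \<rho> q * f q) = \<rho> p * w f + w \<rho> * f p"
    by (rule tvec_mult[OF w(1) smooth_functionD[OF _ p] sf[OF c(2)]]) (use rho in \<open>simp add: cutoff_def\<close>)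
  also have "w f = k * (w (\<lambda>q. \<phi> q \<bullet> b) - w (\<lambda>q. \<phi> p \<bullet> b))"
    unfolding f_def by (simp add: tvec_cmult[OF w(1) sd[OF c(2)]]
        tvec_diff[OF w(1) smooth_near_coord[OF c] smooth_near_const[OF p]])
  also have "\<dots> = 1" using b by (simp add: k_def tvec_const[OF w(1)])
  finally have "w (\<lambda>q. \<rho> q * f q) = 1" by (simp add: r1 f_def)
  then show thesis
    using that[OF cutoff_smooth[OF rho(1) sf]] by (simp add: f_def)
qed

text \<open>The standard argument that linearity over functions means dependence on values only:
  after multiplication by \<rho>^2 the field is a combination of global fields whose coefficients
  vanish at p, and \<rho>(p) = 1.\<close>

lemma tensorial_zero:
  fixes T :: "'a vfield \<Rightarrow> real"
  assumes add: "\<And>X Y. X \<in> vector_fields A \<Longrightarrow> Y \<in> vector_fields A \<Longrightarrow> T (X + Y) = T X + T Y"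
    and mult: "\<And>f X. smooth_function A f \<Longrightarrow> X \<in> vector_fields A \<Longrightarrow> T (fscale f X) = f p * T X"
    and X: "X \<in> vector_fields A" and p: "p \<in> points A" and Xp: "X p = 0"
  shows "T X = 0"
proof -
  obtain U \<phi> where c: "(U, \<phi>) \<in> A" "p \<in> U" using pointsE[OF p] .
  obtain \<rho> where rho: "cutoff A U \<rho>" "\<forall>\<^sub>F q in mnhds A p. \<rho> q = 1" using bump[OF c] by blast
  have r1: "\<rho> p = 1" by (rule eventually_mnhds_self[OF rho(2) p])
  have sr: "smooth_function A \<rho>" using rho by (simp add: cutoff_def)
  define E where "E = (\<lambda>v q. scale (\<rho> q) (chart_tvec A (U, \<phi>) q v))"
  define a where "a = (\<lambda>b q. \<rho> q * X q (\<lambda>q. \<phi> q \<bullet> b))"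
  have E: "E v \<in> vector_fields A" for v
    unfolding E_def by (rule cutoff_coord_field[OF c(1) rho(1)])
  have a: "smooth_function A (a b)" for b
    unfolding a_def by (intro cutoff_smooth[OF rho(1)] vf_smooth[OF X] smooth_near_coord[OF c(1)])
  \<comment> \<open>One factor \<rho> makes the coefficients global functions, the other makes the
    frame global; hence the square.\<close>
  have "fscale (\<lambda>q. \<rho> q * \<rho> q) X = (\<Sum>b\<in>Basis. fscale (a b) (E b))"
  proof (intro ext)
    fix q f
    show "fscale (\<lambda>q. \<rho> q * \<rho> q) X q f = (\<Sum>b\<in>Basis. fscale (a b) (E b)) q f"
    proof (cases "q \<in> U")
      case True
      have "X q f = (\<Sum>b\<in>Basis. X q (\<lambda>q. \<phi> q \<bullet> b) * chart_tvec A (U, \<phi>) q b f)"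
        using tvec_expand[OF c(1) True vf_tangent[OF X chart_points[OF c(1) True]]] .
      then have "\<rho> q * \<rho> q * X q f =
          (\<Sum>b\<in>Basis. \<rho> q * X q (\<lambda>q. \<phi> q \<bullet> b) * (\<rho> q * chart_tvec A (U, \<phi>) q b f))"
        by (simp add: sum_distrib_left mult_ac)
      then show ?thesis by (simp add: sum_fun_apply a_def E_def)
    next
      case False
      then have "\<rho> q = 0" using rho by (simp add: cutoff_def)
      then show ?thesis by (simp add: sum_fun_apply a_def)
    qed
  qed
  moreover have "T (\<Sum>b\<in>I. fscale (a b) (E b)) = (\<Sum>b\<in>I. a b p * T (E b))" if "finite I" for I
    using that
  proof (induction I)
    case empty
    have "T (0 + 0) = T 0 + T 0" by (rule add[OF vf_zero vf_zero])
    then have "T 0 = 0" by simp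
    then show ?case by (simp only: sum.empty)
  next
    case (insert b I)
    have "T (fscale (a b) (E b) + (\<Sum>b\<in>I. fscale (a b) (E b))) =
        T (fscale (a b) (E b)) + T (\<Sum>b\<in>I. fscale (a b) (E b))"
      by (rule add[OF vf_fscale[OF E a] vf_sum[OF vf_fscale[OF E a]]])
    then show ?case
      by (simp only: sum.insert[OF insert.hyps] insert.IH mult[OF a E])
  qed
  ultimately have "T (fscale (\<lambda>q. \<rho> q * \<rho> q) X) = (\<Sum>b\<in>Basis. a b p * T (E b))"
    by simp
  also have "\<dots> = 0" by (simp add: a_def Xp)
  finally show ?thesis
    by (simp add: mult smooth_function_mult sr X r1)
qed

lemma tensorial_cong:
  fixes T :: "'a vfield \<Rightarrow> real"
  assumes add: "\<And>X Y. X \<in> vector_fields A \<Longrightarrow> Y \<in> vector_fields A \<Longrightarrow> T (X + Y) = T X + T Y"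
    and mult: "\<And>f X. smooth_function A f \<Longrightarrow> X \<in> vector_fields A \<Longrightarrow> T (fscale f X) = f p * T X"
    and X: "X \<in> vector_fields A" and Y: "Y \<in> vector_fields A" and p: "p \<in> points A" and eq: "X p = Y p"
  shows "T X = T Y"
proof -
  have "T (X - Y) = 0"
    by (rule tensorial_zero[of T p, OF add mult]) (auto simp: vf_diff X Y p eq)
  moreover have "T (X - Y + Y) = T (X - Y) + T Y"
    by (intro add vf_diff X Y)
  ultimately show ?thesis by simp
qed

text \<open>Evaluating T on any extension of a vector is well defined by
  \<open>tensorial_cong\<close>. Both D_X \<alpha> at a point and the vertical component of a
  tangent vector of the cotangent bundle are obtained as covectors in this way.\<close>

lemma tensorial_covector:
  fixes T :: "'a vfield \<Rightarrow> real"
  assumes add: "\<And>X Y. X \<in> vector_fields A \<Longrightarrow> Y \<in> vector_fields A \<Longrightarrow> T (X + Y) = T X + T Y"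
    and mult: "\<And>f X. smooth_function A f \<Longrightarrow> X \<in> vector_fields A \<Longrightarrow> T (fscale f X) = f p * T X"
    and p: "p \<in> points A"
  obtains \<eta> where "\<eta> \<in> cotangent_space A p" "\<And>X. X \<in> vector_fields A \<Longrightarrow> \<eta> (X p) = T X"
proof -
  define \<eta> where "\<eta> = (\<lambda>v. if v \<in> tangent_space A p
    then T (SOME X. X \<in> vector_fields A \<and> X p = v) else 0)"
  have eta: "\<eta> (X p) = T X" if X: "X \<in> vector_fields A" for X
  proof -
    let ?Y = "SOME Y. Y \<in> vector_fields A \<and> Y p = X p"
    have "?Y \<in> vector_fields A \<and> ?Y p = X p" by (rule someI[of _ X]) (simp add: X)
    then have "T ?Y = T X"
      by (intro tensorial_cong[of T p, OF add mult]) (auto simp: X p)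
    then show ?thesis using vf_tangent[OF X p] by (simp add: \<eta>_def)
  qed
  have "\<eta> \<in> cotangent_space A p"
    unfolding cotangent_space_def mem_Collect_eq
  proof (intro conjI ballI allI impI)
    fix v w assume v: "v \<in> tangent_space A p" and w: "w \<in> tangent_space A p"
    obtain X where X: "X \<in> vector_fields A" "X p = v" using tvec_extend[OF v] .
    obtain Y where Y: "Y \<in> vector_fields A" "Y p = w" using tvec_extend[OF w] .
    have "\<eta> ((X + Y) p) = \<eta> (X p) + \<eta> (Y p)"
      using eta[OF vf_add[OF X(1) Y(1)]] eta[OF X(1)] eta[OF Y(1)] add[OF X(1) Y(1)] by simp
    then show "\<eta> (v + w) = \<eta> v + \<eta> w" by (simp add: X Y)
  next
    fix r v assume v: "v \<in> tangent_space A p"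
    obtain X where X: "X \<in> vector_fields A" "X p = v" using tvec_extend[OF v] .
    have "\<eta> (fscale (\<lambda>q. r) X p) = r * \<eta> (X p)"
      using eta[OF vf_fscale[OF X(1) smooth_function_const]] eta[OF X(1)] mult[OF smooth_function_const X(1)] by simp
    then show "\<eta> (scale r v) = r * \<eta> v" by (simp add: X)
  qed (simp add: \<eta>_def)
  then show thesis using that eta by blast
qed

end

section \<open>Covectors, one-forms and connections\<close>

text \<open>The covector with components y in the coordinate coframe, hence the inverse of the fibre
  part of a cotangent chart; it is cut to 0 off the tangent space because covectors are total
  functions.\<close>

definition chart_covec ::
    "('a, 'e::euclidean_space) chart set \<Rightarrow> ('a, 'e) chart \<Rightarrow> 'a \<Rightarrow> 'e \<Rightarrow> 'a covec" where
  "chart_covec A c p y = (\<lambda>v. if v \<in> tangent_space A p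
     then \<Sum>b\<in>Basis. (y \<bullet> b) * v (\<lambda>q. snd c q \<bullet> b) else 0)"

context atlas
begin

lemma cot_add: "\<xi> \<in> cotangent_space A p \<Longrightarrow> v \<in> tangent_space A p \<Longrightarrow> w \<in> tangent_space A p \<Longrightarrow>
    \<xi> (v + w) = \<xi> v + \<xi> w"
  by (simp add: cotangent_space_def)

lemma cot_scale: "\<xi> \<in> cotangent_space A p \<Longrightarrow> v \<in> tangent_space A p \<Longrightarrow> \<xi> (scale r v) = r * \<xi> v"
  by (simp add: cotangent_space_def)

lemma cot_outside: "\<xi> \<in> cotangent_space A p \<Longrightarrow> v \<notin> tangent_space A p \<Longrightarrow> \<xi> v = 0"
  by (simp add: cotangent_space_def)

lemma cot_zero: "\<xi> \<in> cotangent_space A p \<Longrightarrow> \<xi> 0 = 0"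
  using cot_scale[of \<xi> p 0 0] cot_outside[of \<xi> p 0] by (cases "0 \<in> tangent_space A p") auto

lemma cot_uminus: "\<xi> \<in> cotangent_space A p \<Longrightarrow> v \<in> tangent_space A p \<Longrightarrow> \<xi> (- v) = - \<xi> v"
  using cot_add[of \<xi> p v "- v"] by (simp add: cot_zero tangent_uminus)

lemma cot_diff: "\<xi> \<in> cotangent_space A p \<Longrightarrow> v \<in> tangent_space A p \<Longrightarrow> w \<in> tangent_space A p \<Longrightarrow>
    \<xi> (v - w) = \<xi> v - \<xi> w"
  using cot_add[of \<xi> p v "- w"] by (simp add: cot_uminus tangent_uminus)

lemma cotI:
  assumes "\<And>v w. v \<in> tangent_space A p \<Longrightarrow> w \<in> tangent_space A p \<Longrightarrow> \<xi> (v + w) = \<xi> v + \<xi> w"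
    and "\<And>r v. v \<in> tangent_space A p \<Longrightarrow> \<xi> (scale r v) = r * \<xi> v"
    and "\<And>v. v \<notin> tangent_space A p \<Longrightarrow> \<xi> v = 0"
  shows "\<xi> \<in> cotangent_space A p"
  using assms by (simp add: cotangent_space_def)

lemma cotangent_add:
  "\<xi> \<in> cotangent_space A p \<Longrightarrow> \<eta> \<in> cotangent_space A p \<Longrightarrow> \<xi> + \<eta> \<in> cotangent_space A p"
  by (rule cotI) (simp_all add: cot_add[where p=p] cot_scale[where p=p] cot_outside[where p=p] distrib_left)

lemma cotangent_scale: "\<xi> \<in> cotangent_space A p \<Longrightarrow> scale r \<xi> \<in> cotangent_space A p"
  by (rule cotI) (simp_all add: cot_add[where p=p] cot_scale[where p=p] cot_outside[where p=p] distrib_left)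

lemma cotangent_uminus: "\<xi> \<in> cotangent_space A p \<Longrightarrow> - \<xi> \<in> cotangent_space A p"
  using cotangent_scale[of \<xi> p "-1"] by (simp add: scale_def fun_Compl_def)

lemma cotangent_diff:
  "\<xi> \<in> cotangent_space A p \<Longrightarrow> \<eta> \<in> cotangent_space A p \<Longrightarrow> \<xi> - \<eta> \<in> cotangent_space A p"
  using cotangent_add[OF _ cotangent_uminus, of \<xi> p \<eta>] by simp

lemma cotangent_zero: "0 \<in> cotangent_space A p"
  by (rule cotI) simp_all

lemma cot_expand:
  assumes c: "(U, \<phi>) \<in> A" "p \<in> U" and xi: "\<xi> \<in> cotangent_space A p" and v: "v \<in> tangent_space A p"
  shows "\<xi> v = (\<Sum>b\<in>Basis. v (\<lambda>q. \<phi> q \<bullet> b) * \<xi> (chart_tvec A (U, \<phi>) p b))"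
proof -
  have lin: "linear (\<lambda>e. \<xi> (chart_tvec A (U, \<phi>) p e))"
    using c xi by (intro linearI)
      (simp_all add: chart_tvec_add chart_tvec_scale cot_add[where p=p] cot_scale[where p=p])
  have "\<xi> v = \<xi> (chart_tvec A (U, \<phi>) p (\<Sum>b\<in>Basis. v (\<lambda>q. \<phi> q \<bullet> b) *\<^sub>R b))"
    using tvec_chart[OF c v] by simp
  also have "\<dots> = (\<Sum>b\<in>Basis. v (\<lambda>q. \<phi> q \<bullet> b) * \<xi> (chart_tvec A (U, \<phi>) p b))"
    by (simp only: linear_sum[OF lin] linear_scale[OF lin] real_scaleR_def)
  finally show ?thesis .
qed

lemma cot_eqI:
  assumes c: "(U, \<phi>) \<in> A" "p \<in> U" and xi: "\<xi> \<in> cotangent_space A p" "\<eta> \<in> cotangent_space A p"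
    and eq: "\<And>b. b \<in> Basis \<Longrightarrow> \<xi> (chart_tvec A (U, \<phi>) p b) = \<eta> (chart_tvec A (U, \<phi>) p b)"
  shows "\<xi> = \<eta>"
proof
  fix v show "\<xi> v = \<eta> v"
  proof (cases "v \<in> tangent_space A p")
    case True
    show ?thesis
      unfolding cot_expand[OF c xi(1) True] cot_expand[OF c xi(2) True]
      using eq by (intro sum.cong) simp_all
  qed (simp add: cot_outside[OF xi(1)] cot_outside[OF xi(2)])
qed

lemma chart_covec_cotangent: "chart_covec A c p y \<in> cotangent_space A p"
  by (rule cotI) (simp_all add: chart_covec_def tangent_add tangent_scale sum.distrib sum_distrib_left
      distrib_left mult_ac)

lemma chart_covec_chart_tvec:
  assumes c: "(U, \<phi>) \<in> A" "p \<in> U"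
  shows "chart_covec A (U, \<phi>) p y (chart_tvec A (U, \<phi>) p v) = y \<bullet> v"
  using c by (simp add: chart_covec_def chart_tvec_coord euclidean_inner[of y v])

lemma chart_covec_linear: "chart_covec A c p (y + r *\<^sub>R z) = chart_covec A c p y + scale r (chart_covec A c p z)"
  by (auto simp: chart_covec_def fun_eq_iff inner_left_distrib distrib_right sum.distrib sum_distrib_left mult.assoc)

lemma covec_chart:
  assumes c: "(U, \<phi>) \<in> A" "p \<in> U" and xi: "\<xi> \<in> cotangent_space A p"
  shows "chart_covec A (U, \<phi>) p (\<Sum>b\<in>Basis. \<xi> (chart_tvec A (U, \<phi>) p b) *\<^sub>R b) = \<xi>"
  by (rule cot_eqI[OF c chart_covec_cotangent xi]) (simp add: chart_covec_chart_tvec[OF c])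

lemma one_form_cotangent: "\<alpha> \<in> one_forms A \<Longrightarrow> p \<in> points A \<Longrightarrow> \<alpha> p \<in> cotangent_space A p"
  by (simp add: one_forms_def)

lemma one_form_smooth: "\<alpha> \<in> one_forms A \<Longrightarrow> X \<in> vector_fields A \<Longrightarrow> smooth_function A (\<lambda>q. \<alpha> q (X q))"
  by (simp add: one_forms_def)

lemma one_form_outside: "\<alpha> \<in> one_forms A \<Longrightarrow> p \<notin> points A \<Longrightarrow> \<alpha> p = 0"
  by (simp add: one_forms_def)

lemma one_formI:
  assumes "\<And>p. p \<in> points A \<Longrightarrow> \<alpha> p \<in> cotangent_space A p"
    and "\<And>p. p \<notin> points A \<Longrightarrow> \<alpha> p = 0"
    and "\<And>X. X \<in> vector_fields A \<Longrightarrow> smooth_function A (\<lambda>q. \<alpha> q (X q))"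
  shows "\<alpha> \<in> one_forms A"
  using assms by (simp add: one_forms_def)

lemma smooth_function_cong:
  assumes "smooth_function A f" "\<And>q. q \<in> points A \<Longrightarrow> f q = g q"
  shows "smooth_function A g"
  unfolding smooth_function_def
proof
  fix p assume p: "p \<in> points A"
  have "\<forall>\<^sub>F q in mnhds A p. f q = g q"
    using eventually_mnhds_points[OF p] by (rule eventually_mono) (rule assms(2))
  then show "smooth_near A p g" by (rule smooth_near_cong[OF smooth_functionD[OF assms(1) p]])
qed

lemma one_form_diff_scale:
  assumes a: "\<alpha> \<in> one_forms A" and b: "\<beta> \<in> one_forms A" and h: "smooth_function A h"
  shows "(\<lambda>p. \<alpha> p - scale (h p) (\<beta> p)) \<in> one_forms A"
proof (rule one_formI)
  show "smooth_function A (\<lambda>q. (\<alpha> q - scale (h q) (\<beta> q)) (X q))" if X: "X \<in> vector_fields A" for X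
    using one_form_smooth[OF a X] one_form_smooth[OF b X] h
    by (simp add: smooth_function_def smooth_near_diff smooth_near_mult)
  show "\<alpha> p - scale (h p) (\<beta> p) \<in> cotangent_space A p" if "p \<in> points A" for p
    by (intro cotangent_diff cotangent_scale one_form_cotangent a b that)
  show "\<alpha> p - scale (h p) (\<beta> p) = 0" if "p \<notin> points A" for p
    using one_form_outside[OF a that] one_form_outside[OF b that] by simp
qed

end

context bump_atlas
begin

text \<open>Constant components in a chart, multiplied by a cutoff.\<close>

lemma covec_extend:
  assumes p: "p \<in> points A" and xi: "\<xi> \<in> cotangent_space A p"
  obtains \<alpha> where "\<alpha> \<in> one_forms A" "\<alpha> p = \<xi>"
proof -
  obtain U \<phi> where c: "(U, \<phi>) \<in> A" "p \<in> U" using pointsE[OF p] .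
  obtain \<rho> where rho: "cutoff A U \<rho>" "\<forall>\<^sub>F q in mnhds A p. \<rho> q = 1" using bump[OF c] by blast
  have r1: "\<rho> p = 1" by (rule eventually_mnhds_self[OF rho(2) p])
  define y where "y = (\<Sum>b\<in>Basis. \<xi> (chart_tvec A (U, \<phi>) p b) *\<^sub>R b)"
  define \<alpha> where "\<alpha> = (\<lambda>q. scale (\<rho> q) (chart_covec A (U, \<phi>) q y))"
  have "\<alpha> \<in> one_forms A"
  proof (rule one_formI)
    show "\<alpha> q \<in> cotangent_space A q" for q
      unfolding \<alpha>_def by (intro cotangent_scale chart_covec_cotangent)
    show "\<alpha> q = 0" if "q \<notin> points A" for q
    proof -
      have "q \<notin> U" using that chart_points[OF c(1)] by blast
      then have "\<rho> q = 0" using rho(1) by (simp add: cutoff_def)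
      then show ?thesis by (simp add: \<alpha>_def)
    qed
    show "smooth_function A (\<lambda>q. \<alpha> q (X q))" if X: "X \<in> vector_fields A" for X
    proof -
      have "smooth_function A (\<lambda>q. \<rho> q * (\<Sum>b\<in>Basis. (y \<bullet> b) * X q (\<lambda>r. \<phi> r \<bullet> b)))"
        by (intro cutoff_smooth[OF rho(1)] smooth_near_sum smooth_near_mult smooth_near_const
            vf_smooth[OF X] smooth_near_coord[OF c(1)] chart_points[OF c(1)])
      moreover have "\<rho> q * (\<Sum>b\<in>Basis. (y \<bullet> b) * X q (\<lambda>r. \<phi> r \<bullet> b)) = \<alpha> q (X q)" if "q \<in> points A" for q
        using vf_tangent[OF X that] by (simp add: \<alpha>_def chart_covec_def)
      ultimately show ?thesis by (rule smooth_function_cong)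
    qed
  qed
  moreover have "\<alpha> p = \<xi>" by (simp add: \<alpha>_def r1 y_def covec_chart[OF c xi])
  ultimately show thesis using that by blast
qed

text \<open>Coordinate covectors read off the components of v. This recovers identities between
  vector fields from their pairings with the points of the cotangent bundle.\<close>

lemma covec_separates:
  assumes v: "v \<in> tangent_space A p" and zero: "\<And>\<xi>. \<xi> \<in> cotangent_space A p \<Longrightarrow> \<xi> v = 0"
  shows "v = 0"
proof -
  have p: "p \<in> points A" by (rule tangent_space_points[OF v])
  obtain U \<phi> where c: "(U, \<phi>) \<in> A" "p \<in> U" using pointsE[OF p] .
  have "v (\<lambda>q. \<phi> q \<bullet> b) = 0" if b: "b \<in> Basis" for b
  proof -
    have "chart_covec A (U, \<phi>) p b v = (\<Sum>b'\<in>Basis. (b \<bullet> b') * v (\<lambda>q. \<phi> q \<bullet> b'))"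
      by (simp add: chart_covec_def v)
    also have "\<dots> = v (\<lambda>q. \<phi> q \<bullet> b)"
      using b by (simp add: inner_Basis if_distrib[of "\<lambda>x. x * _"] cong: if_cong)
    finally show ?thesis using zero[OF chart_covec_cotangent] by simp
  qed
  then show ?thesis by (intro tvec_eqI[OF c v tangent_zero[OF p]]) simp
qed

end

section \<open>Cutoff functions from the Hausdorff property\<close>

lemma (in atlas) openin_manifold_topology:
  assumes "openin (manifold_topology A) N"
  shows "chart_open A N"
proof -
  have "generate_topology_on {U \<inter> \<phi> -` V | U \<phi> V. (U, \<phi>) \<in> A \<and> open V} N"
    using assms by (simp add: manifold_topology_def openin_topology_generated_by_iff)
  then show ?thesis
  proof induction
    case Empty
    then show ?case by (auto simp: chart_open_def)
  next
    case (Int a b)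
    then show ?case by (simp add: chart_open_Int)
  next
    case (UN K)
    have "\<phi> ` (U \<inter> \<Union> K) = (\<Union>k\<in>K. \<phi> ` (U \<inter> k))" for U and \<phi> :: "'a \<Rightarrow> 'e" by auto
    moreover have "\<Union> K \<subseteq> points A" using UN.IH by (auto simp: chart_open_def)
    moreover have "open (\<phi> ` (U \<inter> k))" if "k \<in> K" "(U, \<phi>) \<in> A" for k U \<phi>
      using UN.IH[OF that(1)] that(2) by (auto simp: chart_open_def)
    ultimately show ?case by (auto simp: chart_open_def intro!: open_UN)
  next
    case (Basis s)
    then show ?case using chart_open_preimage by auto
  qed
qed

lemma (in atlas) topspace_manifold_topology: "topspace (manifold_topology A) = points A"
proof -
  have "\<Union> {U \<inter> \<phi> -` V | U \<phi> V. (U, \<phi>) \<in> A \<and> open V} = points A"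
  proof
    show "\<Union> {U \<inter> \<phi> -` V | U \<phi> V. (U, \<phi>) \<in> A \<and> open V} \<subseteq> points A"
      by (auto intro: chart_points)
    show "points A \<subseteq> \<Union> {U \<inter> \<phi> -` V | U \<phi> V. (U, \<phi>) \<in> A \<and> open V}"
    proof
      fix p assume "p \<in> points A"
      then obtain U \<phi> where c: "(U, \<phi>) \<in> A" "p \<in> U" by (rule pointsE)
      then have "U \<inter> \<phi> -` UNIV \<in> {U \<inter> \<phi> -` V | U \<phi> V. (U, \<phi>) \<in> A \<and> open V}" by blast
      then show "p \<in> \<Union> {U \<inter> \<phi> -` V | U \<phi> V. (U, \<phi>) \<in> A \<and> open V}"
        using c(2) by (intro UnionI[of "U \<inter> \<phi> -` UNIV"]) simp_all
    qed
  qed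
  then show ?thesis by (simp add: manifold_topology_def topology_generated_by_topspace)
qed

text \<open>Carries compactness of a closed Euclidean ball over to the manifold.\<close>

lemma (in atlas) continuous_map_chart_inverse:
  assumes c: "(U, \<phi>) \<in> A"
  shows "continuous_map (top_of_set (\<phi> ` U)) (manifold_topology A) (inv_into U \<phi>)"
  unfolding manifold_topology_def
proof (rule continuous_on_generated_topo)
  fix N assume "N \<in> {U \<inter> \<phi> -` V |U \<phi> V. (U, \<phi>) \<in> A \<and> open V}"
  then obtain V \<psi> W where N: "N = V \<inter> \<psi> -` W" "(V, \<psi>) \<in> A" "open W" by auto
  have "open (\<phi> ` (U \<inter> N))"
    using chart_open_preimage[OF N(2,3)] c by (auto simp: chart_open_def N(1))
  moreover have "inv_into U \<phi> -` N \<inter> topspace (top_of_set (\<phi> ` U)) = \<phi> ` (U \<inter> N)"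
    using c by (auto simp: image_iff)
  ultimately show "openin (top_of_set (\<phi> ` U)) (inv_into U \<phi> -` N \<inter> topspace (top_of_set (\<phi> ` U)))"
    by (simp add: openin_open_eq[OF chart_image_open[OF c]] image_mono)
next
  show "inv_into U \<phi> ` topspace (top_of_set (\<phi> ` U)) \<subseteq> \<Union> {U \<inter> \<phi> -` V |U \<phi> V. (U, \<phi>) \<in> A \<and> open V}"
  proof -
    have "U \<inter> \<phi> -` UNIV \<in> {U \<inter> \<phi> -` V | U \<phi> V. (U, \<phi>) \<in> A \<and> open V}" using c by blast
    moreover have "inv_into U \<phi> ` topspace (top_of_set (\<phi> ` U)) \<subseteq> U \<inter> \<phi> -` UNIV"
      by (auto intro: inv_into_into)
    ultimately show ?thesis by blast
  qed
qed

text \<open>A Euclidean bump is extended by 0 outside the chart. Its support lies in the image K of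
  a closed ball; K is compact, hence closed in a Hausdorff space, and therefore the extension
  vanishes near every point outside U.\<close>

lemma smooth_manifold_bump_atlas:
  assumes "smooth_manifold A"
  shows "bump_atlas A"
proof -
  interpret atlas A using assms by unfold_locales (simp add: smooth_manifold_def)
  show ?thesis
  proof unfold_locales
    fix U \<phi> p assume c: "(U, \<phi>) \<in> A" "p \<in> U"
    obtain r where r: "r > 0" "cball (\<phi> p) r \<subseteq> \<phi> ` U"
      using chart_image_open[OF c(1)] c(2) open_contains_cball by (metis imageI)
    obtain \<rho>0 :: "'b \<Rightarrow> real" where rho0: "\<And>y. smooth_at \<rho>0 y" "\<And>y. dist (\<phi> p) y < r / 2 \<Longrightarrow> \<rho>0 y = 1"
      "\<And>y. r \<le> dist (\<phi> p) y \<Longrightarrow> \<rho>0 y = 0"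
      using euclidean_bump[OF r(1), of "\<phi> p"] by blast
    define \<rho> where "\<rho> = (\<lambda>q. if q \<in> U then \<rho>0 (\<phi> q) else 0)"
    define K where "K = inv_into U \<phi> ` cball (\<phi> p) r"
    have "compactin (top_of_set (\<phi> ` U)) (cball (\<phi> p) r)"
      using r(2) by (simp add: compactin_subtopology compactin_euclidean_iff)
    then have "compactin (manifold_topology A) K"
      unfolding K_def by (rule image_compactin[OF _ continuous_map_chart_inverse[OF c(1)]])
    then have "closedin (manifold_topology A) K"
      using assms by (intro compactin_imp_closedin) (simp_all add: smooth_manifold_def)
    then have K: "chart_open A (points A - K)"
      by (metis openin_manifold_topology openin_diff openin_topspace topspace_manifold_topology)
    have out: "\<rho> q = 0" if "q \<notin> K" for q
    proof (cases "q \<in> U")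
      case True
      then have "\<phi> q \<notin> cball (\<phi> p) r"
        using that c(1) unfolding K_def by (metis chart_inv imageI)
      then show ?thesis by (simp add: \<rho>_def rho0(3))
    qed (simp add: \<rho>_def)
    have KU: "K \<subseteq> U" using r(2) by (auto simp: K_def intro: inv_into_into)
    have zero: "\<forall>\<^sub>F r in mnhds A q. \<rho> r = 0" if "q \<in> points A - U" for q
      using that K KU out by (auto simp: eventually_mnhds intro!: exI[of _ "points A - K"])
    have "smooth_near A q \<rho>" if q: "q \<in> points A" for q
    proof (cases "q \<in> U")
      case True
      have "\<forall>\<^sub>F x in nhds (\<phi> q). \<rho>0 x = \<rho> (inv_into U \<phi> x)"
        using eventually_nhds_chart_image[OF c(1) True]
        by eventually_elim (auto simp: \<rho>_def c(1))
      then show ?thesis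
        unfolding smooth_near_iff[OF c(1) True] by (rule smooth_at_cong[OF rho0(1)])
    next
      case False
      then have "\<forall>\<^sub>F r in mnhds A q. 0 = \<rho> r" using zero q by (auto elim: eventually_mono)
      then show ?thesis by (rule smooth_near_cong[OF smooth_near_const[OF q]])
    qed
    then have "cutoff A U \<rho>" using zero by (auto simp: cutoff_def smooth_function_def \<rho>_def)
    moreover have "\<forall>\<^sub>F q in mnhds A p. \<rho> q = 1"
    proof -
      have "\<forall>\<^sub>F x in nhds (\<phi> p). dist (\<phi> p) x < r / 2"
        using r(1) by (auto simp: eventually_nhds_metric dist_commute intro!: exI[of _ "r/2"])
      with eventually_nhds_chart_image[OF c] show ?thesis
        unfolding eventually_mnhds_chart[OF c]
        by eventually_elim (auto simp: \<rho>_def c(1) rho0(2))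
    qed
    ultimately show "\<exists>\<rho>. cutoff A U \<rho> \<and> (\<forall>\<^sub>F q in mnhds A p. \<rho> q = 1)" by blast
  qed
qed

section \<open>Calculus of a linear connection\<close>

locale connection_atlas = bump_atlas +
  fixes D :: "'a connection"
  assumes linear_connection: "linear_connection A D"
begin

lemma D_vf: "X \<in> vector_fields A \<Longrightarrow> Y \<in> vector_fields A \<Longrightarrow> D X Y \<in> vector_fields A"
  using linear_connection by (simp add: linear_connection_def)

lemma D_add_left:
  "X \<in> vector_fields A \<Longrightarrow> Y \<in> vector_fields A \<Longrightarrow> Z \<in> vector_fields A \<Longrightarrow> D (X + Y) Z = D X Z + D Y Z"
  using linear_connection by (simp add: linear_connection_def)

lemma D_add_right:
  "X \<in> vector_fields A \<Longrightarrow> Y \<in> vector_fields A \<Longrightarrow> Z \<in> vector_fields A \<Longrightarrow> D Z (X + Y) = D Z X + D Z Y"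
  using linear_connection by (simp add: linear_connection_def)

lemma D_fscale_left:
  "X \<in> vector_fields A \<Longrightarrow> Y \<in> vector_fields A \<Longrightarrow> smooth_function A f \<Longrightarrow> D (fscale f X) Y = fscale f (D X Y)"
  using linear_connection by (simp add: linear_connection_def)

lemma D_fscale_right:
  "X \<in> vector_fields A \<Longrightarrow> Y \<in> vector_fields A \<Longrightarrow> smooth_function A f \<Longrightarrow>
    D X (fscale f Y) = fscale (\<lambda>p. X p f) Y + fscale f (D X Y)"
  using linear_connection by (simp add: linear_connection_def)

lemma D_zero_left: "Y \<in> vector_fields A \<Longrightarrow> D 0 Y = 0"
  using D_add_left[OF vf_zero vf_zero] by fastforce

lemma D_zero_right: "X \<in> vector_fields A \<Longrightarrow> D X 0 = 0"
  using D_add_right[OF vf_zero vf_zero] by fastforce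

lemma D_uminus_left:
  assumes "X \<in> vector_fields A" "Y \<in> vector_fields A"
  shows "D (- X) Y = - D X Y"
proof -
  have "D (- X) Y + D X Y = D (- X + X) Y"
    by (rule D_add_left[symmetric]) (simp_all add: assms vf_uminus)
  also have "\<dots> = 0" using D_zero_left[OF assms(2)] by simp
  finally show ?thesis by (simp add: eq_neg_iff_add_eq_0)
qed

lemma D_uminus_right:
  assumes "X \<in> vector_fields A" "Y \<in> vector_fields A"
  shows "D X (- Y) = - D X Y"
proof -
  have "D X (- Y) + D X Y = D X (- Y + Y)"
    by (rule D_add_right[symmetric]) (simp_all add: assms vf_uminus)
  also have "\<dots> = 0" using D_zero_right[OF assms(1)] by simp
  finally show ?thesis by (simp add: eq_neg_iff_add_eq_0)
qed

lemma D_diff_left: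
  "X \<in> vector_fields A \<Longrightarrow> Y \<in> vector_fields A \<Longrightarrow> Z \<in> vector_fields A \<Longrightarrow> D (X - Y) Z = D X Z - D Y Z"
  using D_add_left[of X "- Y" Z] D_uminus_left[of Y Z] vf_uminus[of Y] by simp

lemma D_left_cong:
  assumes X: "X \<in> vector_fields A" and Y: "Y \<in> vector_fields A" and Z: "Z \<in> vector_fields A"
    and p: "p \<in> points A" and eq: "X p = Y p"
  shows "D X Z p = D Y Z p"
proof
  fix f
  show "D X Z p f = D Y Z p f"
    by (rule tensorial_cong[of "\<lambda>X. D X Z p f" p, OF _ _ X Y p eq])
      (simp_all add: D_add_left D_fscale_left Z)
qed

end

section \<open>The atlas of the cotangent bundle\<close>

lemma smooth_at_Pair:
  assumes "smooth_at f x" "smooth_at g x"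
  shows "smooth_at (\<lambda>x. (f x, g x)) x"
proof -
  have "smooth_at (\<lambda>x. (f x, 0) + (0, g x)) x"
    by (intro smooth_at_add smooth_at_bounded_linear[OF bounded_linear_Pair[OF bounded_linear_ident bounded_linear_zero] assms(1)]
        smooth_at_bounded_linear[OF bounded_linear_Pair[OF bounded_linear_zero bounded_linear_ident] assms(2)])
  then show ?thesis by simp
qed

definition cot_coord :: "('a, 'e::euclidean_space) chart set \<Rightarrow> ('a, 'e) chart \<Rightarrow> 'a \<times> 'a covec \<Rightarrow> 'e \<times> 'e" where
  "cot_coord A c x = (snd c (fst x), \<Sum>b\<in>Basis. snd x (chart_tvec A c (fst x) b) *\<^sub>R b)"

definition fibre_eval :: "'a vfield \<Rightarrow> 'a \<times> 'a covec \<Rightarrow> real" where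
  "fibre_eval Z x = snd x (Z (fst x))"

lemma cotangent_chart_eq: "cotangent_chart A (U, \<phi>) = (Sigma U (cotangent_space A), cot_coord A (U, \<phi>))"
  by (auto simp: cotangent_chart_def cot_coord_def fun_eq_iff)

lemma cotangent_bundleE:
  assumes "c \<in> cotangent_bundle A"
  obtains U \<phi> where "(U, \<phi>) \<in> A" "c = (Sigma U (cotangent_space A), cot_coord A (U, \<phi>))"
  using assms by (auto simp: cotangent_bundle_def cotangent_chart_eq[symmetric])

lemma cotangent_bundleI:
  "(U, \<phi>) \<in> A \<Longrightarrow> (Sigma U (cotangent_space A), cot_coord A (U, \<phi>)) \<in> cotangent_bundle A"
  by (auto simp: cotangent_bundle_def cotangent_chart_eq[symmetric])

lemma points_cotangent_bundle: "points (cotangent_bundle A) = Sigma (points A) (cotangent_space A)"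
  by (force simp: points_def cotangent_bundle_def cotangent_chart_eq[of A, symmetric] cotangent_chart_def)

context atlas
begin

lemma cot_coord_chart_covec:
  "(U, \<phi>) \<in> A \<Longrightarrow> p \<in> U \<Longrightarrow> cot_coord A (U, \<phi>) (p, chart_covec A (U, \<phi>) p y) = (\<phi> p, y)"
  by (simp add: cot_coord_def chart_covec_chart_tvec euclidean_representation)

lemma chart_covec_cot_coord:
  "(U, \<phi>) \<in> A \<Longrightarrow> p \<in> U \<Longrightarrow> \<xi> \<in> cotangent_space A p \<Longrightarrow>
    chart_covec A (U, \<phi>) p (snd (cot_coord A (U, \<phi>) (p, \<xi>))) = \<xi>"
  by (simp add: cot_coord_def covec_chart)

lemma cot_coord_inj:
  assumes c: "(U, \<phi>) \<in> A"
  shows "inj_on (cot_coord A (U, \<phi>)) (Sigma U (cotangent_space A))"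
proof (rule inj_onI)
  fix x y assume "x \<in> Sigma U (cotangent_space A)" "y \<in> Sigma U (cotangent_space A)"
    and eq: "cot_coord A (U, \<phi>) x = cot_coord A (U, \<phi>) y"
  then obtain p \<xi> q \<eta> where x: "x = (p, \<xi>)" "p \<in> U" "\<xi> \<in> cotangent_space A p"
    and y: "y = (q, \<eta>)" "q \<in> U" "\<eta> \<in> cotangent_space A q"
    by blast
  have "\<phi> p = \<phi> q" using eq by (simp add: x y cot_coord_def)
  then have pq: "p = q" using chart_inj[OF c] x y by (simp add: inj_on_def)
  have "\<xi> = chart_covec A (U, \<phi>) p (snd (cot_coord A (U, \<phi>) x))"
    unfolding x(1) by (rule chart_covec_cot_coord[OF c x(2,3), symmetric])
  also have "\<dots> = \<eta>"
    unfolding eq y(1) pq by (rule chart_covec_cot_coord[OF c y(2,3)])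
  finally show "x = y" by (simp add: x y pq)
qed

lemma cot_coord_inv:
  assumes c: "(U, \<phi>) \<in> A" and x: "fst z \<in> \<phi> ` U"
  shows "inv_into (Sigma U (cotangent_space A)) (cot_coord A (U, \<phi>)) z =
    (inv_into U \<phi> (fst z), chart_covec A (U, \<phi>) (inv_into U \<phi> (fst z)) (snd z))"
proof (rule inv_into_f_eq[OF cot_coord_inj[OF c]])
  have i: "inv_into U \<phi> (fst z) \<in> U" using x by (rule inv_into_into)
  then show "(inv_into U \<phi> (fst z), chart_covec A (U, \<phi>) (inv_into U \<phi> (fst z)) (snd z)) \<in> Sigma U (cotangent_space A)"
    by (simp add: chart_covec_cotangent)
  show "cot_coord A (U, \<phi>) (inv_into U \<phi> (fst z), chart_covec A (U, \<phi>) (inv_into U \<phi> (fst z)) (snd z)) = z"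
    using x by (simp add: cot_coord_chart_covec[OF c i] f_inv_into_f)
qed

lemma cot_coord_image:
  assumes c: "(U, \<phi>) \<in> A" and W: "W \<subseteq> U"
  shows "cot_coord A (U, \<phi>) ` Sigma W (cotangent_space A) = (\<phi> ` W) \<times> UNIV"
proof
  show "cot_coord A (U, \<phi>) ` Sigma W (cotangent_space A) \<subseteq> (\<phi> ` W) \<times> UNIV"
    by (auto simp: cot_coord_def)
  show "(\<phi> ` W) \<times> UNIV \<subseteq> cot_coord A (U, \<phi>) ` Sigma W (cotangent_space A)"
  proof
    fix z :: "'e \<times> 'e" assume "z \<in> (\<phi> ` W) \<times> UNIV"
    then obtain p y where "p \<in> W" "z = (\<phi> p, y)" by auto
    then have "z = cot_coord A (U, \<phi>) (p, chart_covec A (U, \<phi>) p y)"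
      "(p, chart_covec A (U, \<phi>) p y) \<in> Sigma W (cotangent_space A)"
      using W cot_coord_chart_covec[OF c] chart_covec_cotangent by auto
    then show "z \<in> cot_coord A (U, \<phi>) ` Sigma W (cotangent_space A)" by blast
  qed
qed

lemma smooth_at_chart_fst:
  assumes c: "(U, \<phi>) \<in> A" "p \<in> U" and u: "smooth_near A p u"
  shows "smooth_at (\<lambda>z. u (inv_into U \<phi> (fst z))) (\<phi> p, y)"
proof (rule smooth_at_compose[where f = "\<lambda>x. u (inv_into U \<phi> x)"])
  show "smooth_at (\<lambda>x. u (inv_into U \<phi> x)) (fst (\<phi> p, y))"
    using u smooth_near_iff[OF c] by simp
qed (rule smooth_at_fst)

lemma chart_tvec_smooth_overlap:
  assumes "(U, \<phi>) \<in> A" "p \<in> U" "(V, \<psi>) \<in> A" "p \<in> V"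
  shows "smooth_near A p (\<lambda>q. chart_tvec A (V, \<psi>) q b (\<lambda>r. \<phi> r \<bullet> b'))"
  by (rule coord_field_smooth[OF assms(3,4) smooth_near_coord[OF assms(1,2)]])

lemma eventually_fst_chart_image:
  assumes c: "(U, \<phi>) \<in> A" "p \<in> U"
  shows "\<forall>\<^sub>F z in nhds (\<phi> p, y). fst z \<in> \<phi> ` U"
proof -
  have "filterlim fst (nhds (\<phi> p)) (nhds (\<phi> p, y))"
    using tendsto_fst[OF filterlim_ident, of "(\<phi> p, y)"] by simp
  then show ?thesis by (rule eventually_compose_filterlim[OF eventually_nhds_chart_image[OF c]])
qed

text \<open>The transition map is that of M on the base and linear on the fibres: components of a
  covector change by the Jacobian \<open>chart_tvec A (V, \<psi>) q b (\<lambda>r. \<phi> r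
  \<bullet> b')\<close>, which is smooth in the base point.\<close>

lemma smooth_atlas_cotangent_bundle: "smooth_atlas (cotangent_bundle A)"
  unfolding smooth_atlas_def
proof (intro conjI ballI; clarify)
  fix S \<Phi> assume "(S, \<Phi>) \<in> cotangent_bundle A"
  then obtain U \<phi> where c: "(U, \<phi>) \<in> A" and S: "S = Sigma U (cotangent_space A)" "\<Phi> = cot_coord A (U, \<phi>)"
    by (elim cotangent_bundleE) auto
  show "inj_on \<Phi> S \<and> open (\<Phi> ` S)"
    unfolding S using cot_coord_inj[OF c] cot_coord_image[OF c subset_refl] chart_image_open[OF c]
    by (simp add: open_Times)
next
  fix S \<Phi> T \<Psi> assume "(S, \<Phi>) \<in> cotangent_bundle A" "(T, \<Psi>) \<in> cotangent_bundle A"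
  then obtain U \<phi> V \<psi> where c: "(U, \<phi>) \<in> A" and S: "S = Sigma U (cotangent_space A)" "\<Phi> = cot_coord A (U, \<phi>)"
    and d: "(V, \<psi>) \<in> A" and T: "T = Sigma V (cotangent_space A)" "\<Psi> = cot_coord A (V, \<psi>)"
    by (elim cotangent_bundleE) auto
  have ST: "S \<inter> T = Sigma (U \<inter> V) (cotangent_space A)" by (auto simp: S T)
  have im: "\<Phi> ` (S \<inter> T) = (\<phi> ` (U \<inter> V)) \<times> UNIV"
    unfolding ST unfolding S by (rule cot_coord_image[OF c]) simp
  have o: "open (\<Phi> ` (S \<inter> T))"
    unfolding im using overlap_open[OF c d] by (simp add: open_Times)
  have "smooth_at (\<Psi> \<circ> inv_into S \<Phi>) z" if "z \<in> \<Phi> ` (S \<inter> T)" for z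
  proof -
    obtain p y where p: "p \<in> U" "p \<in> V" and z: "z = (\<phi> p, y)" using \<open>z \<in> _\<close> unfolding im by auto
    have "smooth_at (\<lambda>z. (\<psi> (inv_into U \<phi> (fst z)), \<Sum>b\<in>Basis. (\<Sum>b'\<in>Basis. (snd z \<bullet> b') *
        chart_tvec A (V, \<psi>) (inv_into U \<phi> (fst z)) b (\<lambda>r. \<phi> r \<bullet> b')) *\<^sub>R b)) z"
      unfolding z
    proof (intro smooth_at_Pair smooth_at_sum smooth_at_scaleR smooth_at_mult smooth_at_const
        smooth_at_inner_left smooth_at_snd)
      show "smooth_at (\<lambda>z. \<psi> (inv_into U \<phi> (fst z))) (\<phi> p, y)"
        using transition_smooth[OF c d p] by (intro smooth_at_compose[OF _ smooth_at_fst, of "\<lambda>x. \<psi> (inv_into U \<phi> x)"]) simp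
      show "smooth_at (\<lambda>z. chart_tvec A (V, \<psi>) (inv_into U \<phi> (fst z)) b (\<lambda>r. \<phi> r \<bullet> b')) (\<phi> p, y)" for b b'
        by (rule smooth_at_chart_fst[OF c p(1) chart_tvec_smooth_overlap[OF c p(1) d p(2)]])
    qed
    then show ?thesis
    proof (rule smooth_at_cong)
      have "\<forall>\<^sub>F w in nhds z. w \<in> (\<phi> ` (U \<inter> V)) \<times> UNIV"
        using o \<open>z \<in> _\<close> unfolding im by (auto simp: eventually_nhds)
      then show "\<forall>\<^sub>F w in nhds z. (\<psi> (inv_into U \<phi> (fst w)), \<Sum>b\<in>Basis. (\<Sum>b'\<in>Basis. (snd w \<bullet> b') *
        chart_tvec A (V, \<psi>) (inv_into U \<phi> (fst w)) b (\<lambda>r. \<phi> r \<bullet> b')) *\<^sub>R b) = (\<Psi> \<circ> inv_into S \<Phi>) w"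
      proof eventually_elim
        case (elim w)
        then obtain q where q: "q \<in> U" "q \<in> V" "fst w = \<phi> q" by auto
        then show ?case
          using c d by (simp add: S T cot_coord_inv cot_coord_def chart_covec_def)
      qed
    qed
  qed
  then show "open (\<Phi> ` (S \<inter> T)) \<and> smooth_on (\<Phi> ` (S \<inter> T)) (\<Psi> \<circ> inv_into S \<Phi>)"
    using o smooth_on_iff_smooth_at[OF o] by blast
qed

lemma atlas_cotangent_bundle: "atlas (cotangent_bundle A)"
  by unfold_locales (rule smooth_atlas_cotangent_bundle)

lemma cot_eventually_chart:
  assumes c: "(U, \<phi>) \<in> A" "p \<in> U" and xi: "\<xi> \<in> cotangent_space A p"
  shows "eventually P (mnhds (cotangent_bundle A) (p, \<xi>)) \<longleftrightarrow>
    (\<forall>\<^sub>F z in nhds (cot_coord A (U, \<phi>) (p, \<xi>)).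
      P (inv_into U \<phi> (fst z), chart_covec A (U, \<phi>) (inv_into U \<phi> (fst z)) (snd z)))"
proof -
  interpret cot: atlas "cotangent_bundle A" by (rule atlas_cotangent_bundle)
  have ev: "\<forall>\<^sub>F z in nhds (cot_coord A (U, \<phi>) (p, \<xi>)). fst z \<in> \<phi> ` U"
    using eventually_fst_chart_image[OF c] by (simp add: cot_coord_def)
  have "eventually P (mnhds (cotangent_bundle A) (p, \<xi>)) \<longleftrightarrow>
      (\<forall>\<^sub>F z in nhds (cot_coord A (U, \<phi>) (p, \<xi>)). P (inv_into (Sigma U (cotangent_space A)) (cot_coord A (U, \<phi>)) z))"
    using c xi by (intro cot.eventually_mnhds_chart cotangent_bundleI) auto
  also have "\<dots> \<longleftrightarrow> (\<forall>\<^sub>F z in nhds (cot_coord A (U, \<phi>) (p, \<xi>)).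
      P (inv_into U \<phi> (fst z), chart_covec A (U, \<phi>) (inv_into U \<phi> (fst z)) (snd z)))"
    by (rule eventually_subst, rule eventually_mono[OF ev]) (simp add: cot_coord_inv[OF c(1)])
  finally show ?thesis .
qed

lemma cot_smooth_near_chart:
  assumes c: "(U, \<phi>) \<in> A" "p \<in> U" and xi: "\<xi> \<in> cotangent_space A p"
  shows "smooth_near (cotangent_bundle A) (p, \<xi>) f \<longleftrightarrow>
    smooth_at (\<lambda>z. f (inv_into U \<phi> (fst z), chart_covec A (U, \<phi>) (inv_into U \<phi> (fst z)) (snd z)))
      (cot_coord A (U, \<phi>) (p, \<xi>))" (is "_ \<longleftrightarrow> smooth_at ?g ?z")
proof -
  interpret cot: atlas "cotangent_bundle A" by (rule atlas_cotangent_bundle)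
  let ?f = "\<lambda>z. f (inv_into (Sigma U (cotangent_space A)) (cot_coord A (U, \<phi>)) z)"
  have "\<forall>\<^sub>F z in nhds ?z. fst z \<in> \<phi> ` U"
    using eventually_fst_chart_image[OF c] by (simp add: cot_coord_def)
  then have "\<forall>\<^sub>F z in nhds ?z. ?f z = ?g z" "\<forall>\<^sub>F z in nhds ?z. ?g z = ?f z"
    by (auto elim!: eventually_mono simp: cot_coord_inv[OF c(1)])
  then have "smooth_at ?f ?z \<longleftrightarrow> smooth_at ?g ?z"
    using smooth_at_cong[of ?f ?z ?g] smooth_at_cong[of ?g ?z ?f] by blast
  moreover have "smooth_near (cotangent_bundle A) (p, \<xi>) f \<longleftrightarrow> smooth_at ?f ?z"
    using c xi by (intro cot.smooth_near_iff cotangent_bundleI) auto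
  ultimately show ?thesis by simp
qed

lemma cot_eventually_fst:
  assumes ev: "eventually P (mnhds A p)" and p: "p \<in> points A" and xi: "\<xi> \<in> cotangent_space A p"
  shows "\<forall>\<^sub>F x in mnhds (cotangent_bundle A) (p, \<xi>). P (fst x)"
proof -
  obtain U \<phi> where c: "(U, \<phi>) \<in> A" "p \<in> U" using pointsE[OF p] .
  have "filterlim fst (nhds (\<phi> p)) (nhds (cot_coord A (U, \<phi>) (p, \<xi>)))"
    using tendsto_fst[OF filterlim_ident, of "cot_coord A (U, \<phi>) (p, \<xi>)"] by (simp add: cot_coord_def)
  from eventually_compose_filterlim[OF ev[unfolded eventually_mnhds_chart[OF c]] this]
  show ?thesis by (simp add: cot_eventually_chart[OF c xi])
qed

lemma cot_smooth_near_fst: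
  assumes f: "smooth_near A p f" and xi: "\<xi> \<in> cotangent_space A p"
  shows "smooth_near (cotangent_bundle A) (p, \<xi>) (\<lambda>x. f (fst x))"
proof -
  obtain U \<phi> where c: "(U, \<phi>) \<in> A" "p \<in> U" using pointsE[OF smooth_near_points[OF f]] .
  show ?thesis
    using smooth_at_chart_fst[OF c f] by (simp add: cot_smooth_near_chart[OF c xi] cot_coord_def)
qed

text \<open>In a cotangent chart this function is linear in the fibre coordinates, with the
  components of Z as coefficients.\<close>

lemma fibre_eval_smooth:
  assumes Z: "Z \<in> vector_fields A" and x: "x \<in> points (cotangent_bundle A)"
  shows "smooth_near (cotangent_bundle A) x (fibre_eval Z)"
proof -
  obtain p \<xi> where x: "x = (p, \<xi>)" and p: "p \<in> points A" and xi: "\<xi> \<in> cotangent_space A p"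
    using x by (auto simp: points_cotangent_bundle)
  obtain U \<phi> where c: "(U, \<phi>) \<in> A" "p \<in> U" using pointsE[OF p] .
  define y where "y = snd (cot_coord A (U, \<phi>) (p, \<xi>))"
  have y: "cot_coord A (U, \<phi>) (p, \<xi>) = (\<phi> p, y)" by (simp add: y_def cot_coord_def)
  have "smooth_at (\<lambda>z. \<Sum>b\<in>Basis. (snd z \<bullet> b) * Z (inv_into U \<phi> (fst z)) (\<lambda>r. \<phi> r \<bullet> b)) (\<phi> p, y)"
    by (intro smooth_at_sum smooth_at_mult smooth_at_inner_left smooth_at_snd
        smooth_at_chart_fst[OF c vf_smooth[OF Z smooth_near_coord[OF c]]])
  moreover have "\<forall>\<^sub>F z in nhds (\<phi> p, y). (\<Sum>b\<in>Basis. (snd z \<bullet> b) * Z (inv_into U \<phi> (fst z)) (\<lambda>r. \<phi> r \<bullet> b))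
      = fibre_eval Z (inv_into U \<phi> (fst z), chart_covec A (U, \<phi>) (inv_into U \<phi> (fst z)) (snd z))"
    using eventually_fst_chart_image[OF c]
  proof eventually_elim
    case (elim z)
    then obtain q where q: "q \<in> U" "fst z = \<phi> q" by auto
    then show ?case
      using c(1) vf_tangent[OF Z chart_points[OF c(1) q(1)]] by (simp add: fibre_eval_def chart_covec_def)
  qed
  ultimately show ?thesis
    unfolding x cot_smooth_near_chart[OF c xi] y by (rule smooth_at_cong)
qed

end

context bump_atlas
begin

lemma bump_atlas_cotangent_bundle: "bump_atlas (cotangent_bundle A)"
proof -
  interpret cot: atlas "cotangent_bundle A" by (rule atlas_cotangent_bundle)
  show ?thesis
  proof unfold_locales
    fix S \<Phi> x assume "(S, \<Phi>) \<in> cotangent_bundle A" "x \<in> S"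
    then obtain U \<phi> p \<xi> where c: "(U, \<phi>) \<in> A" "p \<in> U" and S: "S = Sigma U (cotangent_space A)"
      and x: "x = (p, \<xi>)" and xi: "\<xi> \<in> cotangent_space A p"
      by (elim cotangent_bundleE) auto
    obtain \<rho> where rho: "cutoff A U \<rho>" "\<forall>\<^sub>F q in mnhds A p. \<rho> q = 1" using bump[OF c] by blast
    \<comment> \<open>A cutoff has to vanish at every pair outside the chart domain, including pairs
      whose second component is no covector; hence the case distinction.\<close>
    define \<sigma> where "\<sigma> = (\<lambda>x. if x \<in> points (cotangent_bundle A) then \<rho> (fst x) else 0)"
    have "smooth_function (cotangent_bundle A) (\<lambda>x. \<rho> (fst x))"
      using rho(1) cot_smooth_near_fst
      by (auto simp: smooth_function_def points_cotangent_bundle cutoff_def)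
    then have "smooth_function (cotangent_bundle A) \<sigma>"
      by (rule cot.smooth_function_cong) (simp add: \<sigma>_def)
    moreover have "\<sigma> x = 0" if "x \<notin> S" for x
      using that rho(1) unfolding S \<sigma>_def points_cotangent_bundle cutoff_def by auto
    moreover have "\<forall>\<^sub>F r in mnhds (cotangent_bundle A) x. \<sigma> r = 0" if "x \<in> points (cotangent_bundle A) - S" for x
    proof -
      obtain q \<eta> where x: "x = (q, \<eta>)" "q \<in> points A" "\<eta> \<in> cotangent_space A q" "q \<notin> U"
        using \<open>x \<in> _\<close> by (auto simp: S points_cotangent_bundle)
      then have "\<forall>\<^sub>F r in mnhds A q. \<rho> r = 0" using rho(1) by (simp add: cutoff_def)
      from cot_eventually_fst[OF this x(2,3)] show ?thesis
        unfolding x(1) by eventually_elim (simp add: \<sigma>_def)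
    qed
    ultimately have "cutoff (cotangent_bundle A) S \<sigma>" by (simp add: cutoff_def)
    moreover have "\<forall>\<^sub>F r in mnhds (cotangent_bundle A) x. \<sigma> r = 1"
    proof -
      have p: "p \<in> points A" by (rule chart_points[OF c])
      then have "x \<in> points (cotangent_bundle A)" by (simp add: x xi points_cotangent_bundle)
      from cot.eventually_mnhds_points[OF this] cot_eventually_fst[OF rho(2) p xi]
      show ?thesis unfolding x by eventually_elim (simp add: \<sigma>_def)
    qed
    ultimately show "\<exists>\<sigma>. cutoff (cotangent_bundle A) S \<sigma> \<and> (\<forall>\<^sub>F r in mnhds (cotangent_bundle A) x. \<sigma> r = 1)"
      by blast
  qed
qed

end

text \<open>Kept apart from \<open>bump_atlas\<close>: passing to the cotangent bundle within that
  locale itself would have to be iterated forever.\<close>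

locale cotangent_atlas = bump_atlas A for A :: "('a, 'e::euclidean_space) chart set"

sublocale cotangent_atlas \<subseteq> cot: bump_atlas "cotangent_bundle A"
  by (rule bump_atlas_cotangent_bundle)

section \<open>Tangent vectors and vector fields of the cotangent bundle\<close>

context cotangent_atlas
begin

abbreviation "TM \<equiv> cotangent_bundle A"

lemma cot_pointsE:
  assumes "x \<in> points TM"
  obtains p \<xi> U \<phi> where "x = (p, \<xi>)" "p \<in> points A" "\<xi> \<in> cotangent_space A p" "(U, \<phi>) \<in> A" "p \<in> U"
proof -
  obtain p \<xi> where "x = (p, \<xi>)" "p \<in> points A" "\<xi> \<in> cotangent_space A p"
    using assms by (auto simp: points_cotangent_bundle)
  then show thesis using that pointsE by metis
qed

lemma cot_smooth_near_fst':
  "x \<in> points TM \<Longrightarrow> smooth_near A (fst x) f \<Longrightarrow> smooth_near TM x (\<lambda>x. f (fst x))"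
  using cot_smooth_near_fst by (auto simp: points_cotangent_bundle)

lemma cot_coord_fibre:
  "b \<in> Basis \<Longrightarrow> cot_coord A (U, \<phi>) x \<bullet> (0, b) = snd x (chart_tvec A (U, \<phi>) (fst x) b)"
  by (simp add: cot_coord_def inner_sum_left_Basis)

text \<open>The functions \<open>f \<circ> \<pi>\<close> and \<open>fibre_eval Z\<close> contain local coordinates of the cotangent bundle.\<close>

lemma cot_coord_frame:
  assumes x: "x = (p, \<xi>)" "\<xi> \<in> cotangent_space A p" and c: "(U, \<phi>) \<in> A" "p \<in> U" and b: "b \<in> Basis"
  obtains (base) u where "b = (u, 0)" "(\<lambda>x. cot_coord A (U, \<phi>) x \<bullet> b) = (\<lambda>x. \<phi> (fst x) \<bullet> u)"
  | (fibre) Z where "Z \<in> vector_fields A" "\<forall>\<^sub>F y in mnhds TM x. cot_coord A (U, \<phi>) y \<bullet> b = fibre_eval Z y"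
proof -
  consider u where "b = (u, 0)" | u where "u \<in> Basis" "b = (0, u)"
    using b by (auto simp: Basis_prod_def)
  then show thesis
  proof cases
    case 1
    then show ?thesis using base by (simp add: cot_coord_def)
  next
    case 2
    obtain E where E: "\<And>v. E v \<in> vector_fields A"
      "\<forall>\<^sub>F q in mnhds A p. \<forall>v. E v q = chart_tvec A (U, \<phi>) q v"
      using local_frame[OF c] by blast
    have "\<forall>\<^sub>F y in mnhds TM x. cot_coord A (U, \<phi>) y \<bullet> b = fibre_eval (E u) y"
      using cot_eventually_fst[OF E(2) chart_points[OF c] x(2)] unfolding x(1)
      by eventually_elim (simp add: 2 cot_coord_fibre fibre_eval_def)
    then show ?thesis using fibre E(1) by blast
  qed
qed

lemma cot_tvec_eqI:
  assumes w: "w \<in> tangent_space TM x" "w' \<in> tangent_space TM x"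
    and base: "\<And>f. smooth_near A (fst x) f \<Longrightarrow> w (\<lambda>x. f (fst x)) = w' (\<lambda>x. f (fst x))"
    and fibre: "\<And>Z. Z \<in> vector_fields A \<Longrightarrow> w (fibre_eval Z) = w' (fibre_eval Z)"
  shows "w = w'"
proof -
  obtain p \<xi> U \<phi> where x: "x = (p, \<xi>)" "\<xi> \<in> cotangent_space A p" and c: "(U, \<phi>) \<in> A" "p \<in> U"
    using cot_pointsE[OF cot.tangent_space_points[OF w(1)]] by metis
  show ?thesis
  proof (rule cot.tvec_eqI[OF cotangent_bundleI[OF c(1)] _ w])
    show "x \<in> Sigma U (cotangent_space A)" using x c by simp
    fix b :: "'e \<times> 'e" assume b: "b \<in> Basis"
    show "w (\<lambda>q. cot_coord A (U, \<phi>) q \<bullet> b) = w' (\<lambda>q. cot_coord A (U, \<phi>) q \<bullet> b)"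
    proof (cases rule: cot_coord_frame[OF x c b])
      case (1 u)
      then show ?thesis using base[of "\<lambda>q. \<phi> q \<bullet> u"] smooth_near_coord[OF c] by (simp add: x(1))
    next
      case (2 Z)
      then show ?thesis using cot.tvec_cong[OF w(1) 2(2)] cot.tvec_cong[OF w(2) 2(2)] fibre by simp
    qed
  qed
qed

text \<open>The tested functions contain local coordinates, so the components of W in a cotangent
  chart are smooth; the value on any other function is a combination of these with smooth
  coefficients.\<close>

lemma cot_vfI:
  assumes tan: "\<And>x. x \<in> points TM \<Longrightarrow> W x \<in> tangent_space TM x"
    and out: "\<And>x. x \<notin> points TM \<Longrightarrow> W x = 0"
    and base: "\<And>x f. x \<in> points TM \<Longrightarrow> smooth_near A (fst x) f \<Longrightarrow> smooth_near TM x (\<lambda>y. W y (\<lambda>x. f (fst x)))"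
    and fibre: "\<And>x Z. x \<in> points TM \<Longrightarrow> Z \<in> vector_fields A \<Longrightarrow> smooth_near TM x (\<lambda>y. W y (fibre_eval Z))"
  shows "W \<in> vector_fields TM"
proof (rule cot.vfI[OF tan out])
  fix x f assume f: "smooth_near TM x f"
  have xB: "x \<in> points TM" by (rule cot.smooth_near_points[OF f])
  obtain p \<xi> U \<phi> where x: "x = (p, \<xi>)" "\<xi> \<in> cotangent_space A p" and c: "(U, \<phi>) \<in> A" "p \<in> U"
    using cot_pointsE[OF xB] by metis
  let ?c = "(Sigma U (cotangent_space A), cot_coord A (U, \<phi>))"
  have cc: "?c \<in> TM" "x \<in> Sigma U (cotangent_space A)"
    using x c cotangent_bundleI by auto
  have co: "smooth_near TM x (\<lambda>y. W y (\<lambda>q. cot_coord A (U, \<phi>) q \<bullet> b))" if b: "b \<in> Basis" for b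
  proof (cases rule: cot_coord_frame[OF x c b])
    case (1 u)
    then show ?thesis using base[OF xB, of "\<lambda>q. \<phi> q \<bullet> u"] smooth_near_coord[OF c] by (simp add: x(1))
  next
    case (2 Z)
    show ?thesis
    proof (rule cot.smooth_near_cong[OF fibre[OF xB 2(1)]])
      show "\<forall>\<^sub>F y in mnhds TM x. W y (fibre_eval Z) = W y (\<lambda>q. cot_coord A (U, \<phi>) q \<bullet> b)"
        \<comment> \<open>A fibre coordinate equals some ev_Z only near x, and W y depends on the
          germ at y rather than at x; hence the iterated \<open>eventually\<close>.\<close>
        using cot.eventually_mnhds_mnhds[OF 2(2) xB] cot.eventually_mnhds_points[OF xB]
        by eventually_elim (rule cot.tvec_cong[OF tan, symmetric])
    qed
  qed
  have "smooth_near TM x (\<lambda>y. \<Sum>b\<in>Basis. W y (\<lambda>q. cot_coord A (U, \<phi>) q \<bullet> b) * chart_tvec TM ?c y b f)"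
    by (intro cot.smooth_near_sum[OF xB] cot.smooth_near_mult co cot.coord_field_smooth[OF cc f])
  then show "smooth_near TM x (\<lambda>y. W y f)"
  proof (rule cot.smooth_near_cong)
    show "\<forall>\<^sub>F y in mnhds TM x. (\<Sum>b\<in>Basis. W y (\<lambda>q. cot_coord A (U, \<phi>) q \<bullet> b) * chart_tvec TM ?c y b f) = W y f"
      using cot.eventually_mnhds_domain[OF cc]
      by eventually_elim (rule cot.tvec_expand[OF cc(1) _ tan[OF cot.chart_points[OF cc(1)]], symmetric])
  qed
qed

text \<open>Cotangent charts are linear on fibres, so the line \<xi> + t \<eta> is straight in the
  chart and its velocity is the coordinate derivative in the direction (0, z).\<close>

lemma vertical_lift_tangent:
  assumes p: "p \<in> points A" and xi: "\<xi> \<in> cotangent_space A p" and eta: "\<eta> \<in> cotangent_space A p"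
  shows "vertical_lift A (p, \<xi>) \<eta> \<in> tangent_space TM (p, \<xi>)"
proof -
  obtain U \<phi> where c: "(U, \<phi>) \<in> A" "p \<in> U" using pointsE[OF p] .
  let ?c = "(Sigma U (cotangent_space A), cot_coord A (U, \<phi>))"
  have cc: "?c \<in> TM" "(p, \<xi>) \<in> Sigma U (cotangent_space A)"
    using xi c cotangent_bundleI by auto
  define y where "y = snd (cot_coord A (U, \<phi>) (p, \<xi>))"
  define z where "z = snd (cot_coord A (U, \<phi>) (p, \<eta>))"
  have y: "cot_coord A (U, \<phi>) (p, \<xi>) = (\<phi> p, y)" by (simp add: y_def cot_coord_def)
  have "vertical_lift A (p, \<xi>) \<eta> f = chart_tvec TM ?c (p, \<xi>) (0, z) f" for f
  proof (cases "smooth_near TM (p, \<xi>) f")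
    case True
    define F where "F = (\<lambda>x. f (inv_into (Sigma U (cotangent_space A)) (cot_coord A (U, \<phi>)) x))"
    have "smooth_at F ((\<phi> p, y) + 0 *\<^sub>R (0, z))"
      using True cot.smooth_near_iff[OF cc] by (simp add: F_def y)
    from has_real_derivative_along_line[OF smooth_at_has_derivative[OF this]]
    have "deriv (\<lambda>s. F ((\<phi> p, y) + s *\<^sub>R (0, z))) 0 = frechet_derivative F (at (\<phi> p, y)) (0, z)"
      by (simp add: DERIV_imp_deriv)
    moreover have "F ((\<phi> p, y) + s *\<^sub>R (0, z)) = f (p, \<xi> + scale s \<eta>)" for s
      using c xi eta by (simp add: F_def cot_coord_inv chart_covec_linear y_def z_def chart_covec_cot_coord)
    ultimately show ?thesis
      using True by (simp add: vertical_lift_def cot.chart_tvec_apply y F_def)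
  qed (simp add: vertical_lift_def cot.chart_tvec_not_smooth)
  then have "vertical_lift A (p, \<xi>) \<eta> = chart_tvec TM ?c (p, \<xi>) (0, z)" by blast
  then show ?thesis using cc by simp
qed

lemma vertical_lift_base:
  assumes "smooth_near A p f" "\<xi> \<in> cotangent_space A p"
  shows "vertical_lift A (p, \<xi>) \<eta> (\<lambda>x. f (fst x)) = 0"
  using cot_smooth_near_fst[OF assms] by (simp add: vertical_lift_def)

lemma vertical_lift_fibre:
  assumes p: "p \<in> points A" and xi: "\<xi> \<in> cotangent_space A p" and Z: "Z \<in> vector_fields A"
  shows "vertical_lift A (p, \<xi>) \<eta> (fibre_eval Z) = \<eta> (Z p)"
proof -
  have "((\<lambda>t. \<xi> (Z p) + t * \<eta> (Z p)) has_real_derivative \<eta> (Z p)) (at 0)"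
    by (auto intro!: derivative_eq_intros)
  then have "deriv (\<lambda>t. \<xi> (Z p) + t * \<eta> (Z p)) 0 = \<eta> (Z p)"
    by (rule DERIV_imp_deriv)
  then show ?thesis
    using fibre_eval_smooth[OF Z, of "(p, \<xi>)"] p xi
    by (simp add: vertical_lift_def fibre_eval_def points_cotangent_bundle)
qed

lemma pushforward_fst:
  assumes "w \<in> tangent_space TM x"
  shows "pushforward A fst x w \<in> tangent_space A (fst x)"
proof (rule cot.pushforward_tangent[OF atlas_axioms assms])
  have xB: "x \<in> points TM" by (rule cot.tangent_space_points[OF assms])
  then show "fst x \<in> points A" by (auto simp: points_cotangent_bundle)
  show "smooth_near A (fst x) f \<Longrightarrow> smooth_near TM x (\<lambda>q. f (fst q))" for f
    by (rule cot_smooth_near_fst'[OF xB])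
  show "\<forall>\<^sub>F q in mnhds TM x. fst q \<in> V" if "(V, \<psi>) \<in> A" "fst x \<in> V" for V \<psi>
    using cot_eventually_fst[OF eventually_mnhds_domain[OF that] chart_points[OF that]] xB
    by (auto simp: points_cotangent_bundle)
qed

lemma pushforward_fst_apply:
  "smooth_near A (fst x) f \<Longrightarrow> pushforward A fst x w f = w (\<lambda>x. f (fst x))"
  by (simp add: pushforward_def o_def)

lemma section_smooth:
  assumes \<alpha>: "\<alpha> \<in> one_forms A" and f: "smooth_near TM (p, \<alpha> p) f"
  shows "smooth_near A p (\<lambda>q. f (q, \<alpha> q))"
proof -
  have p: "p \<in> points A" using cot.smooth_near_points[OF f] by (simp add: points_cotangent_bundle)
  obtain U \<phi> where c: "(U, \<phi>) \<in> A" "p \<in> U" using pointsE[OF p] .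
  obtain E where E: "\<And>v. E v \<in> vector_fields A"
    "\<forall>\<^sub>F q in mnhds A p. \<forall>v. E v q = chart_tvec A (U, \<phi>) q v"
    using local_frame[OF c] by blast
  define G where "G = (\<lambda>x. cot_coord A (U, \<phi>) (inv_into U \<phi> x, \<alpha> (inv_into U \<phi> x)))"
  define F where "F = (\<lambda>z. f (inv_into U \<phi> (fst z), chart_covec A (U, \<phi>) (inv_into U \<phi> (fst z)) (snd z)))"
  have comp: "smooth_at (\<lambda>x. \<alpha> (inv_into U \<phi> x) (chart_tvec A (U, \<phi>) (inv_into U \<phi> x) b)) (\<phi> p)" for b
  proof -
    have "smooth_near A p (\<lambda>q. \<alpha> q (chart_tvec A (U, \<phi>) q b))"
    proof (rule smooth_near_cong[OF smooth_functionD[OF one_form_smooth[OF \<alpha> E(1)[of b]] p]])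
      show "\<forall>\<^sub>F q in mnhds A p. \<alpha> q (E b q) = \<alpha> q (chart_tvec A (U, \<phi>) q b)"
        using E(2) by eventually_elim simp
    qed
    then show ?thesis by (simp add: smooth_near_iff[OF c])
  qed
  have G: "smooth_at G (\<phi> p)"
    unfolding G_def cot_coord_def fst_conv snd_conv
    by (intro smooth_at_Pair smooth_at_sum smooth_at_scaleR smooth_at_const comp transition_smooth[OF c(1) c(1) c(2) c(2)])
  have "smooth_at F (G (\<phi> p))"
    using f c unfolding F_def G_def by (simp add: cot_smooth_near_chart[OF c one_form_cotangent[OF \<alpha> p]])
  then have "smooth_at (\<lambda>x. F (G x)) (\<phi> p)" using G by (rule smooth_at_compose)
  moreover have "\<forall>\<^sub>F x in nhds (\<phi> p). F (G x) = f (inv_into U \<phi> x, \<alpha> (inv_into U \<phi> x))"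
    using eventually_nhds_chart_image[OF c]
  proof eventually_elim
    case (elim x)
    then obtain q where q: "q \<in> U" "x = \<phi> q" by auto
    have "fst (cot_coord A (U, \<phi>) (q, \<alpha> q)) = \<phi> q" by (simp add: cot_coord_def)
    then show ?case
      using q c(1) chart_covec_cot_coord[OF c(1) q(1) one_form_cotangent[OF \<alpha> chart_points[OF c(1) q(1)]]]
      by (simp add: F_def G_def)
  qed
  ultimately show ?thesis unfolding smooth_near_iff[OF c] by (rule smooth_at_cong)
qed

lemma section_pushforward:
  assumes \<alpha>: "\<alpha> \<in> one_forms A" and v: "v \<in> tangent_space A p"
  shows "pushforward TM (\<lambda>q. (q, \<alpha> q)) p v \<in> tangent_space TM (p, \<alpha> p)"
proof (rule pushforward_tangent[OF atlas_cotangent_bundle v, of "\<lambda>q. (q, \<alpha> q)"])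
  have p: "p \<in> points A" by (rule tangent_space_points[OF v])
  then show "(p, \<alpha> p) \<in> points TM" by (simp add: points_cotangent_bundle one_form_cotangent[OF \<alpha>])
  show "\<forall>\<^sub>F q in mnhds A p. (q, \<alpha> q) \<in> V" if "(V, \<psi>) \<in> TM" "(p, \<alpha> p) \<in> V" for V \<psi>
  proof -
    obtain U \<phi> where c: "(U, \<phi>) \<in> A" "V = Sigma U (cotangent_space A)"
      using \<open>(V, \<psi>) \<in> TM\<close> by (elim cotangent_bundleE) auto
    then have "p \<in> U" using that by simp
    from eventually_mnhds_domain[OF c(1) this] show ?thesis
      by eventually_elim (simp add: c one_form_cotangent[OF \<alpha>] chart_points[OF c(1)])
  qed
qed (rule section_smooth[OF \<alpha>])

end

section \<open>The Nijenhuis tensor and horizontal lifts\<close>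

locale acs_atlas = atlas +
  fixes J :: "'a endo_field"
  assumes acs: "almost_complex_structure A J"
begin

lemma J_tangent: "v \<in> tangent_space A p \<Longrightarrow> J p v \<in> tangent_space A p"
  using acs tangent_space_points[of v p] by (simp add: almost_complex_structure_def endomorphism_field_def)

lemma J_add: "v \<in> tangent_space A p \<Longrightarrow> w \<in> tangent_space A p \<Longrightarrow> J p (v + w) = J p v + J p w"
  using acs tangent_space_points[of v p] by (simp add: almost_complex_structure_def endomorphism_field_def)

lemma J_scale: "v \<in> tangent_space A p \<Longrightarrow> J p (scale r v) = scale r (J p v)"
  using acs tangent_space_points[of v p] by (simp add: almost_complex_structure_def endomorphism_field_def)

lemma J_outside: "v \<notin> tangent_space A p \<Longrightarrow> J p v = 0"
  using acs by (simp add: almost_complex_structure_def endomorphism_field_def)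

lemma J_square: "v \<in> tangent_space A p \<Longrightarrow> J p (J p v) = - v"
  using acs tangent_space_points[of v p] by (simp add: almost_complex_structure_def)

lemma J_zero: "J p 0 = 0"
  using J_scale[of 0 p 0] J_outside[of 0 p] by (cases "0 \<in> tangent_space A p") auto

lemma J_uminus: "v \<in> tangent_space A p \<Longrightarrow> J p (- v) = - J p v"
  using J_add[of v p "- v"] by (simp add: J_zero tangent_uminus eq_neg_iff_add_eq_0 add.commute)

lemma J_diff: "v \<in> tangent_space A p \<Longrightarrow> w \<in> tangent_space A p \<Longrightarrow> J p (v - w) = J p v - J p w"
  using J_add[of v p "- w"] by (simp add: J_uminus tangent_uminus)

lemma app_vf: "X \<in> vector_fields A \<Longrightarrow> app J X \<in> vector_fields A"
  using acs by (simp add: almost_complex_structure_def endomorphism_field_def)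

lemma vf_eqI_points:
  assumes "X \<in> vector_fields A" "Y \<in> vector_fields A" "\<And>p. p \<in> points A \<Longrightarrow> X p = Y p"
  shows "X = Y"
  using assms smooth_near_points by (intro vf_eqI) auto

lemma app_add:
  assumes "X \<in> vector_fields A" "Y \<in> vector_fields A"
  shows "app J (X + Y) = app J X + app J Y"
  by (rule vf_eqI_points) (simp_all add: assms app_vf vf_add J_add vf_tangent fun_eq_iff)

lemma app_diff:
  assumes "X \<in> vector_fields A" "Y \<in> vector_fields A"
  shows "app J (X - Y) = app J X - app J Y"
  by (rule vf_eqI_points) (simp_all add: assms app_vf vf_diff J_diff vf_tangent fun_eq_iff)

lemma app_uminus:
  assumes "X \<in> vector_fields A"
  shows "app J (- X) = - app J X"
  by (rule vf_eqI_points) (simp_all add: assms app_vf vf_uminus J_uminus vf_tangent fun_eq_iff)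

lemma app_zero: "app J 0 = 0"
  by (auto simp: fun_eq_iff J_zero)

lemma app_fscale:
  assumes "X \<in> vector_fields A" "smooth_function A f"
  shows "app J (fscale f X) = fscale f (app J X)"
  by (rule vf_eqI_points) (simp_all add: assms app_vf vf_fscale J_scale vf_tangent fun_eq_iff)

lemma app_square:
  assumes "X \<in> vector_fields A"
  shows "app J (app J X) = - X"
  by (rule vf_eqI_points) (simp_all add: assms app_vf vf_uminus J_square vf_tangent fun_eq_iff)

lemma nijenhuis_vf:
  "X \<in> vector_fields A \<Longrightarrow> Y \<in> vector_fields A \<Longrightarrow> nijenhuis A J X Y \<in> vector_fields A"
  unfolding nijenhuis_def by (intro vf_diff lie_bracket_vf app_vf)

lemma nijenhuis_skew:
  assumes "X \<in> vector_fields A" "Y \<in> vector_fields A"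
  shows "nijenhuis A J Y X = - nijenhuis A J X Y"
  unfolding nijenhuis_def
  by (simp add: lie_bracket_skew[of A "app J X"] lie_bracket_skew[of A X] app_uminus lie_bracket_vf app_vf assms)

lemma nijenhuis_add:
  assumes "X \<in> vector_fields A" "X' \<in> vector_fields A" "Y \<in> vector_fields A"
  shows "nijenhuis A J (X + X') Y = nijenhuis A J X Y + nijenhuis A J X' Y"
  unfolding nijenhuis_def
  by (simp add: app_add lie_bracket_add_left lie_bracket_vf app_vf assms)

lemma nijenhuis_add_right:
  assumes "X \<in> vector_fields A" "X' \<in> vector_fields A" "Y \<in> vector_fields A"
  shows "nijenhuis A J Y (X + X') = nijenhuis A J Y X + nijenhuis A J Y X'"
  using nijenhuis_add[OF assms] nijenhuis_skew[OF assms(3,1)] nijenhuis_skew[OF assms(3,2)]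
    nijenhuis_skew[OF assms(3) vf_add[OF assms(1,2)]]
  by (metis minus_add_distrib neg_equal_iff_equal)

text \<open>The derivatives of f cancel: those along JY between the first and the third bracket,
  those along Y between the second and the last, the latter by J^2 = -1.\<close>

lemma nijenhuis_fscale:
  assumes X: "X \<in> vector_fields A" and Y: "Y \<in> vector_fields A" and f: "smooth_function A f"
  shows "nijenhuis A J (fscale f X) Y = fscale f (nijenhuis A J X Y)"
proof -
  have 1: "lie_bracket A (app J (fscale f X)) (app J Y) =
      fscale f (lie_bracket A (app J X) (app J Y)) - fscale (\<lambda>p. app J Y p f) (app J X)"
    using lie_bracket_fscale_left[OF app_vf[OF X] app_vf[OF Y] f] by (simp only: app_fscale[OF X f])
  have 2: "app J (lie_bracket A (app J (fscale f X)) Y) =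
      fscale f (app J (lie_bracket A (app J X) Y)) + fscale (\<lambda>p. Y p f) X"
  proof -
    have "lie_bracket A (app J (fscale f X)) Y =
        fscale f (lie_bracket A (app J X) Y) - fscale (\<lambda>p. Y p f) (app J X)"
      using lie_bracket_fscale_left[OF app_vf[OF X] Y f] by (simp only: app_fscale[OF X f])
    then have "app J (lie_bracket A (app J (fscale f X)) Y) =
        fscale f (app J (lie_bracket A (app J X) Y)) - fscale (\<lambda>p. Y p f) (app J (app J X))"
      using X Y f by (simp only: app_diff app_fscale vf_fscale lie_bracket_vf app_vf vf_smooth_function[OF Y f])
    then show ?thesis by (simp add: app_square[OF X] fun_eq_iff)
  qed
  have 3: "app J (lie_bracket A (fscale f X) (app J Y)) =
      fscale f (app J (lie_bracket A X (app J Y))) - fscale (\<lambda>p. app J Y p f) (app J X)"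
    using X Y f vf_smooth_function[OF app_vf[OF Y] f]
    by (simp only: lie_bracket_fscale_left app_diff app_fscale vf_fscale lie_bracket_vf app_vf)
  show ?thesis
    unfolding nijenhuis_def 1 2 3 lie_bracket_fscale_left[OF X Y f]
    by (simp add: fun_eq_iff algebra_simps)
qed

end

locale bump_acs_atlas = bump_atlas + acs_atlas
begin

lemma nijenhuis_cong_left:
  assumes X: "X \<in> vector_fields A" and X': "X' \<in> vector_fields A" and Y: "Y \<in> vector_fields A"
    and p: "p \<in> points A" and eq: "X p = X' p"
  shows "nijenhuis A J X Y p = nijenhuis A J X' Y p"
proof
  fix f
  show "nijenhuis A J X Y p f = nijenhuis A J X' Y p f"
    by (rule tensorial_cong[of "\<lambda>X. nijenhuis A J X Y p f" p, OF _ _ X X' p eq])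
      (simp_all add: nijenhuis_add nijenhuis_fscale Y)
qed

lemma nijenhuis_cong:
  assumes X: "X \<in> vector_fields A" "X' \<in> vector_fields A" and Y: "Y \<in> vector_fields A" "Y' \<in> vector_fields A"
    and p: "p \<in> points A" and eq: "X p = X' p" "Y p = Y' p"
  shows "nijenhuis A J X Y p = nijenhuis A J X' Y' p"
proof -
  have "nijenhuis A J X Y p = nijenhuis A J X' Y p"
    by (rule nijenhuis_cong_left[OF X Y(1) p eq(1)])
  also have "\<dots> = - nijenhuis A J Y X' p"
    using nijenhuis_skew[OF Y(1) X(2)] by simp
  also have "\<dots> = - nijenhuis A J Y' X' p"
    using nijenhuis_cong_left[OF Y X(2) p eq(2)] by simp
  also have "\<dots> = nijenhuis A J X' Y' p"
    using nijenhuis_skew[OF Y(2) X(2)] by simp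
  finally show ?thesis .
qed

end

lemma (in atlas) tvec_cong_points:
  assumes "w \<in> tangent_space A p" "\<And>q. q \<in> points A \<Longrightarrow> f q = g q"
  shows "w f = w g"
  by (rule tvec_cong[OF assms(1) eventually_mono[OF eventually_mnhds_points[OF tangent_space_points[OF assms(1)]] assms(2)]])

lemma (in atlas) tvec_eqI_smooth:
  assumes "v \<in> tangent_space A p" "w \<in> tangent_space A p" "\<And>f. smooth_near A p f \<Longrightarrow> v f = w f"
  shows "v = w"
proof
  fix f show "v f = w f"
    using assms tvec_not_smooth by (cases "smooth_near A p f") metis+
qed

section \<open>Horizontal lifts and the splitting of the tangent bundle of the cotangent
  bundle\<close>

locale cotangent_connection = cotangent_atlas A + connection_atlas A D
  for A :: "('a, 'e::euclidean_space) chart set" and D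
begin

text \<open>The term X(f) \<alpha>(Z) from the product rule is removed by the same term in D_X(f
  Z).\<close>

lemma cov_form_tensorial:
  assumes \<alpha>: "\<alpha> \<in> one_forms A" and X: "X \<in> vector_fields A" and p: "p \<in> points A"
  obtains \<eta> where "\<eta> \<in> cotangent_space A p" "\<And>Z. Z \<in> vector_fields A \<Longrightarrow> \<eta> (Z p) = cov_form D \<alpha> X Z p"
proof (rule tensorial_covector[of "\<lambda>Z. cov_form D \<alpha> X Z p" p])
  have sm: "smooth_near A p (\<lambda>q. \<alpha> q (Z q))" if "Z \<in> vector_fields A" for Z
    by (rule smooth_functionD[OF one_form_smooth[OF \<alpha> that] p])
  note Xp = vf_tangent[OF X p] and ap = one_form_cotangent[OF \<alpha> p]
  fix Z Z' assume Z: "Z \<in> vector_fields A" "Z' \<in> vector_fields A"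
  have "X p (\<lambda>q. \<alpha> q ((Z + Z') q)) = X p (\<lambda>q. \<alpha> q (Z q) + \<alpha> q (Z' q))"
    by (rule tvec_cong_points[OF Xp]) (simp add: cot_add[OF one_form_cotangent[OF \<alpha>]] vf_tangent Z)
  also have "\<dots> = X p (\<lambda>q. \<alpha> q (Z q)) + X p (\<lambda>q. \<alpha> q (Z' q))"
    by (rule tvec_add[OF Xp sm[OF Z(1)] sm[OF Z(2)]])
  finally show "cov_form D \<alpha> X (Z + Z') p = cov_form D \<alpha> X Z p + cov_form D \<alpha> X Z' p"
    using D_add_right[OF Z X] cot_add[OF ap vf_tangent[OF D_vf[OF X Z(1)] p] vf_tangent[OF D_vf[OF X Z(2)] p]]
    by (simp add: cov_form_def)
next
  have sm: "smooth_near A p (\<lambda>q. \<alpha> q (Z q))" if "Z \<in> vector_fields A" for Z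
    by (rule smooth_functionD[OF one_form_smooth[OF \<alpha> that] p])
  note Xp = vf_tangent[OF X p] and ap = one_form_cotangent[OF \<alpha> p]
  fix f Z assume f: "smooth_function A f" and Z: "Z \<in> vector_fields A"
  have "X p (\<lambda>q. \<alpha> q (fscale f Z q)) = X p (\<lambda>q. f q * \<alpha> q (Z q))"
    by (rule tvec_cong_points[OF Xp]) (simp add: cot_scale[OF one_form_cotangent[OF \<alpha>]] vf_tangent Z)
  also have "\<dots> = f p * X p (\<lambda>q. \<alpha> q (Z q)) + X p f * \<alpha> p (Z p)"
    by (rule tvec_mult[OF Xp smooth_functionD[OF f p] sm[OF Z]])
  finally show "cov_form D \<alpha> X (fscale f Z) p = f p * cov_form D \<alpha> X Z p"
    using D_fscale_right[OF X Z f] vf_tangent[OF Z p] vf_tangent[OF D_vf[OF X Z] p]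
    by (simp add: cov_form_def cot_add[OF ap] cot_scale[OF ap] tangent_scale algebra_simps)
qed (use p that in auto)

text \<open>Without such a one-form the horizontal space might contain no lift of X p. For any
  extension \<alpha>, with \<beta>(p) = D_X \<alpha> and h(p) = 0, (Xh)(p) = 1, the Leibniz rule
  gives D_X(\<alpha> - h \<beta>) = D_X \<alpha> - \<beta> = 0 at p.\<close>

lemma parallel_extension:
  assumes p: "p \<in> points A" and xi: "\<xi> \<in> cotangent_space A p" and X: "X \<in> vector_fields A"
  obtains \<alpha> where "\<alpha> \<in> one_forms A" "\<alpha> p = \<xi>" "\<And>Z. Z \<in> vector_fields A \<Longrightarrow> cov_form D \<alpha> X Z p = 0"
proof -
  obtain \<alpha> where \<alpha>: "\<alpha> \<in> one_forms A" "\<alpha> p = \<xi>" using covec_extend[OF p xi] .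
  note Xp = vf_tangent[OF X p]
  show thesis
  proof (cases "X p = 0")
    \<comment> \<open>No h with (Xh)(p) = 1 exists here, but every extension is parallel along X at
      p, since D_X depends on X only through X p.\<close>
    case True
    have "D X Z p = 0" if "Z \<in> vector_fields A" for Z
      using D_left_cong[OF X vf_zero that p] D_zero_left[OF that] True by simp
    then have "cov_form D \<alpha> X Z p = 0" if "Z \<in> vector_fields A" for Z
      using that True by (simp add: cov_form_def \<alpha>(2) cot_zero[OF xi])
    then show ?thesis using that \<alpha> by blast
  next
    case False
    obtain h where h: "smooth_function A h" "h p = 0" "X p h = 1"
      using exists_function_tvec_one[OF Xp False] .
    obtain \<eta> where eta: "\<eta> \<in> cotangent_space A p" "\<And>Z. Z \<in> vector_fields A \<Longrightarrow> \<eta> (Z p) = cov_form D \<alpha> X Z p"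
      using cov_form_tensorial[OF \<alpha>(1) X p] by blast
    obtain \<beta> where \<beta>: "\<beta> \<in> one_forms A" "\<beta> p = \<eta>" using covec_extend[OF p eta(1)] .
    define \<gamma> where "\<gamma> = (\<lambda>q. \<alpha> q - scale (h q) (\<beta> q))"
    have "cov_form D \<gamma> X Z p = 0" if Z: "Z \<in> vector_fields A" for Z
    proof -
      note sa = smooth_functionD[OF one_form_smooth[OF \<alpha>(1) Z] p] and sb = smooth_functionD[OF one_form_smooth[OF \<beta>(1) Z] p]
      note sh = smooth_functionD[OF h(1) p]
      have "X p (\<lambda>q. \<gamma> q (Z q)) = X p (\<lambda>q. \<alpha> q (Z q)) - \<eta> (Z p)"
        using tvec_diff[OF Xp sa smooth_near_mult[OF sh sb]] tvec_mult[OF Xp sh sb]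
        by (simp add: \<gamma>_def h \<beta>(2))
      then show ?thesis
        by (simp add: cov_form_def eta(2)[OF Z]) (simp add: \<gamma>_def h)
    qed
    moreover have "\<gamma> \<in> one_forms A" unfolding \<gamma>_def by (rule one_form_diff_scale[OF \<alpha>(1) \<beta>(1) h(1)])
    moreover have "\<gamma> p = \<xi>" by (simp add: \<gamma>_def h \<alpha>(2))
    ultimately show ?thesis using that by blast
  qed
qed

text \<open>Along the section, ev_Z is the function \<alpha>(Z), whose derivative is (D_X
  \<alpha>)(Z) + \<alpha>(D_X Z); the first term vanishes by hypothesis.\<close>

lemma section_pushforward_apply:
  assumes \<alpha>: "\<alpha> \<in> one_forms A" and p: "p \<in> points A" and X: "X \<in> vector_fields A"
    and par: "\<And>Z. Z \<in> vector_fields A \<Longrightarrow> cov_form D \<alpha> X Z p = 0"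
  defines "w \<equiv> pushforward TM (\<lambda>q. (q, \<alpha> q)) p (X p)"
  shows "w \<in> tangent_space TM (p, \<alpha> p)"
    and "smooth_near A p f \<Longrightarrow> w (\<lambda>x. f (fst x)) = X p f"
    and "Z \<in> vector_fields A \<Longrightarrow> w (fibre_eval Z) = \<alpha> p (D X Z p)"
proof -
  have x: "(p, \<alpha> p) \<in> points TM" using p one_form_cotangent[OF \<alpha> p] by (simp add: points_cotangent_bundle)
  show "w \<in> tangent_space TM (p, \<alpha> p)"
    unfolding w_def by (rule section_pushforward[OF \<alpha> vf_tangent[OF X p]])
  show "w (\<lambda>x. f (fst x)) = X p f" if "smooth_near A p f"
    using cot_smooth_near_fst[OF that one_form_cotangent[OF \<alpha> p]] by (simp add: w_def pushforward_def o_def)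
  show "w (fibre_eval Z) = \<alpha> p (D X Z p)" if Z: "Z \<in> vector_fields A"
    using fibre_eval_smooth[OF Z x] par[OF Z]
    by (simp add: w_def pushforward_def o_def fibre_eval_def cov_form_def)
qed

lemma horizontal_spaceE:
  assumes w: "w \<in> horizontal_space A D (p, \<xi>)" and p: "p \<in> points A"
  obtains X where "X \<in> vector_fields A" "w \<in> tangent_space TM (p, \<xi>)"
    "\<And>f. smooth_near A p f \<Longrightarrow> w (\<lambda>x. f (fst x)) = X p f"
    "\<And>Z. Z \<in> vector_fields A \<Longrightarrow> w (fibre_eval Z) = \<xi> (D X Z p)"
proof -
  obtain \<alpha> X where w: "w = pushforward TM (\<lambda>q. (q, \<alpha> q)) p (X p)" and \<alpha>: "\<alpha> \<in> one_forms A"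
    and X: "X \<in> vector_fields A" and xi: "\<alpha> p = \<xi>" and par: "\<And>Z. Z \<in> vector_fields A \<Longrightarrow> cov_form D \<alpha> X Z p = 0"
    using w unfolding horizontal_space_def by auto
  show thesis
    using that[OF X] section_pushforward_apply[OF \<alpha> p X par] by (simp add: w xi)
qed

text \<open>Justifies the description operator. Existence comes from a parallel extension. For
  uniqueness, any other horizontal vector over X p belongs to a field X' with X' p = X p, and its
  values on the test functions depend on X' p only.\<close>

lemma horizontal_lift_props:
  assumes p: "p \<in> points A" and xi: "\<xi> \<in> cotangent_space A p" and X: "X \<in> vector_fields A"
  defines "w \<equiv> horizontal_lift A D (p, \<xi>) (X p)"
  shows horizontal_lift_tangent: "w \<in> tangent_space TM (p, \<xi>)"
    and horizontal_lift_base: "smooth_near A p f \<Longrightarrow> w (\<lambda>x. f (fst x)) = X p f"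
    and horizontal_lift_fibre: "Z \<in> vector_fields A \<Longrightarrow> w (fibre_eval Z) = \<xi> (D X Z p)"
proof -
  let ?P = "\<lambda>w. w \<in> horizontal_space A D (p, \<xi>) \<and> pushforward A fst (p, \<xi>) w = X p"
  obtain \<alpha> where \<alpha>: "\<alpha> \<in> one_forms A" "\<alpha> p = \<xi>"
    and par: "\<And>Z. Z \<in> vector_fields A \<Longrightarrow> cov_form D \<alpha> X Z p = 0"
    using parallel_extension[OF p xi X] by blast
  define w0 where "w0 = pushforward TM (\<lambda>q. (q, \<alpha> q)) p (X p)"
  note w0 = section_pushforward_apply[OF \<alpha>(1) p X par, folded w0_def, unfolded \<alpha>(2)]
  have same: "X' p = Y p" if X': "X' \<in> vector_fields A" and Y: "Y \<in> vector_fields A"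
    and u: "\<And>f. smooth_near A p f \<Longrightarrow> u (\<lambda>x. f (fst x)) = X' p f"
    and pf: "pushforward A fst (p, \<xi>) u = Y p" for X' Y and u :: "('a \<times> 'a covec) tvec"
  proof (rule tvec_eqI_smooth[OF vf_tangent[OF X' p] vf_tangent[OF Y p]])
    fix f assume f: "smooth_near A p f"
    have "Y p f = u (\<lambda>x. f (fst x))" unfolding pf[symmetric] using f by (simp add: pushforward_def o_def)
    then show "X' p f = Y p f" using u[OF f] by simp
  qed
  have "?P w"
    unfolding w_def horizontal_lift_def
  proof (rule theI[of ?P w0])
    have "pushforward A fst (p, \<xi>) w0 f = X p f" for f
      using w0(2)[of f] vf_not_smooth[OF X, of p f] by (auto simp: pushforward_def o_def)
    moreover have "w0 \<in> horizontal_space A D (p, \<xi>)"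
      unfolding horizontal_space_def w0_def using \<alpha> X par by blast
    ultimately show "?P w0" by blast
    fix u assume u: "?P u"
    obtain X' where X': "X' \<in> vector_fields A" "u \<in> tangent_space TM (p, \<xi>)"
      "\<And>f. smooth_near A p f \<Longrightarrow> u (\<lambda>x. f (fst x)) = X' p f"
      "\<And>Z. Z \<in> vector_fields A \<Longrightarrow> u (fibre_eval Z) = \<xi> (D X' Z p)"
      using horizontal_spaceE[OF _ p] u by blast
    have eq: "X' p = X p" using same[OF X'(1) X X'(3)] u by blast
    show "u = w0"
      using D_left_cong[OF X'(1) X _ p eq]
      by (intro cot_tvec_eqI[OF X'(2) w0(1)]) (simp_all add: X'(3,4) w0(2,3) eq)
  qed
  then obtain Y where Y: "Y \<in> vector_fields A" "w \<in> tangent_space TM (p, \<xi>)"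
    "\<And>f. smooth_near A p f \<Longrightarrow> w (\<lambda>x. f (fst x)) = Y p f"
    "\<And>Z. Z \<in> vector_fields A \<Longrightarrow> w (fibre_eval Z) = \<xi> (D Y Z p)"
    using horizontal_spaceE[OF _ p] by blast
  have eq: "Y p = X p" using same[OF Y(1) X Y(3)] \<open>?P w\<close> by blast
  show "w \<in> tangent_space TM (p, \<xi>)" by (rule Y(2))
  show "w (\<lambda>x. f (fst x)) = X p f" if "smooth_near A p f" using Y(3)[OF that] eq by simp
  show "w (fibre_eval Z) = \<xi> (D X Z p)" if "Z \<in> vector_fields A"
    using Y(4)[OF that] D_left_cong[OF Y(1) X that p eq] by simp
qed

lemma
  assumes p: "p \<in> points A" and xi: "\<xi> \<in> cotangent_space A p" and X: "X \<in> vector_fields A"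
    and eta: "\<eta> \<in> cotangent_space A p"
  shows splitting_tangent: "splitting A D (p, \<xi>) (X p, \<eta>) \<in> tangent_space TM (p, \<xi>)"
    and splitting_base: "smooth_near A p f \<Longrightarrow> splitting A D (p, \<xi>) (X p, \<eta>) (\<lambda>x. f (fst x)) = X p f"
    and splitting_fibre: "Z \<in> vector_fields A \<Longrightarrow>
      splitting A D (p, \<xi>) (X p, \<eta>) (fibre_eval Z) = \<xi> (D X Z p) + \<eta> (Z p)"
  by (simp_all add: splitting_def cot.tangent_add horizontal_lift_props[OF p xi X] vertical_lift_tangent[OF p xi eta]
      vertical_lift_base[OF _ xi] vertical_lift_fibre[OF p xi])

lemma splitting_inj:
  assumes p: "p \<in> points A" and xi: "\<xi> \<in> cotangent_space A p"
  shows "inj_on (splitting A D (p, \<xi>)) (tangent_space A p \<times> cotangent_space A p)"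
proof (rule inj_onI, clarify)
  fix v \<eta> v' \<eta>' assume v: "v \<in> tangent_space A p" and eta: "\<eta> \<in> cotangent_space A p"
    and v': "v' \<in> tangent_space A p" and eta': "\<eta>' \<in> cotangent_space A p"
    and eq: "splitting A D (p, \<xi>) (v, \<eta>) = splitting A D (p, \<xi>) (v', \<eta>')"
  obtain X where X: "X \<in> vector_fields A" "X p = v" using tvec_extend[OF v] .
  obtain X' where X': "X' \<in> vector_fields A" "X' p = v'" using tvec_extend[OF v'] .
  have eq': "splitting A D (p, \<xi>) (X p, \<eta>) = splitting A D (p, \<xi>) (X' p, \<eta>')"
    using eq by (simp add: X X')
  have v_eq: "X p = X' p"
  proof (rule tvec_eqI_smooth[of _ p])
    show "X p f = X' p f" if "smooth_near A p f" for f
      using splitting_base[OF p xi X(1) eta that] splitting_base[OF p xi X'(1) eta' that] unfolding eq' by linarith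
  qed (simp_all add: X X' v v')
  have "\<eta> u = \<eta>' u" for u
  proof (cases "u \<in> tangent_space A p")
    case True
    obtain Z where Z: "Z \<in> vector_fields A" "Z p = u" using tvec_extend[OF True] .
    show ?thesis
      using splitting_fibre[OF p xi X(1) eta Z(1)] splitting_fibre[OF p xi X'(1) eta' Z(1)]
      unfolding eq' D_left_cong[OF X(1) X'(1) Z(1) p v_eq] Z(2) by linarith
  next
    case False
    then show ?thesis using cot_outside[OF eta] cot_outside[OF eta'] by simp
  qed
  then show "v = v' \<and> \<eta> = \<eta>'" using v_eq X X' by auto
qed

text \<open>After subtraction of the horizontal lift, the remainder u kills functions from the base.
  Then Z \<mapsto> u(ev_Z) is linear over functions, because the derivative term of u(f ev_Z) drops
  out, and it defines the covector \<eta>.\<close>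

lemma splitting_surj:
  assumes w: "w \<in> tangent_space TM (p, \<xi>)"
  obtains v \<eta> where "v \<in> tangent_space A p" "\<eta> \<in> cotangent_space A p" "w = splitting A D (p, \<xi>) (v, \<eta>)"
    "v = pushforward A fst (p, \<xi>) w"
proof -
  have x: "(p, \<xi>) \<in> points TM" by (rule cot.tangent_space_points[OF w])
  then have p: "p \<in> points A" and xi: "\<xi> \<in> cotangent_space A p" by (simp_all add: points_cotangent_bundle)
  define v where "v = pushforward A fst (p, \<xi>) w"
  have v: "v \<in> tangent_space A p" using pushforward_fst[OF w] by (simp add: v_def)
  obtain X where X: "X \<in> vector_fields A" "X p = v" using tvec_extend[OF v] .
  define u where "u = w - horizontal_lift A D (p, \<xi>) (X p)"
  have u: "u \<in> tangent_space TM (p, \<xi>)"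
    unfolding u_def by (intro cot.tangent_diff w horizontal_lift_tangent p xi X)
  have wf: "w (\<lambda>x. f (fst x)) = X p f" if "smooth_near A p f" for f
    using that by (simp add: X v_def pushforward_def o_def)
  have uf: "u (\<lambda>x. f (fst x)) = 0" if "smooth_near A p f" for f
    using that by (simp add: u_def wf horizontal_lift_base[OF p xi X(1)])
  obtain \<eta> where eta: "\<eta> \<in> cotangent_space A p" "\<And>Z. Z \<in> vector_fields A \<Longrightarrow> \<eta> (Z p) = u (fibre_eval Z)"
  proof (rule tensorial_covector[of "\<lambda>Z. u (fibre_eval Z)" p])
    fix Z Z' assume Z: "Z \<in> vector_fields A" "Z' \<in> vector_fields A"
    have "u (fibre_eval (Z + Z')) = u (\<lambda>x. fibre_eval Z x + fibre_eval Z' x)"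
      by (rule cot.tvec_cong_points[OF u])
        (auto simp: fibre_eval_def points_cotangent_bundle cot_add vf_tangent Z)
    then show "u (fibre_eval (Z + Z')) = u (fibre_eval Z) + u (fibre_eval Z')"
      by (simp add: cot.tvec_add[OF u fibre_eval_smooth[OF Z(1) x] fibre_eval_smooth[OF Z(2) x]])
  next
    fix f Z assume f: "smooth_function A f" and Z: "Z \<in> vector_fields A"
    have "u (fibre_eval (fscale f Z)) = u (\<lambda>x. f (fst x) * fibre_eval Z x)"
      by (rule cot.tvec_cong_points[OF u])
        (auto simp: fibre_eval_def points_cotangent_bundle cot_scale vf_tangent Z)
    then show "u (fibre_eval (fscale f Z)) = f p * u (fibre_eval Z)"
      using cot.tvec_mult[OF u cot_smooth_near_fst[OF smooth_functionD[OF f p] xi] fibre_eval_smooth[OF Z x]]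
        uf[OF smooth_functionD[OF f p]] by simp
  qed (use p in auto)
  have "w = splitting A D (p, \<xi>) (X p, \<eta>)"
    by (rule cot_tvec_eqI[OF w splitting_tangent[OF p xi X(1) eta(1)]])
      (simp_all add: wf splitting_base[OF p xi X(1) eta(1)] splitting_fibre[OF p xi X(1) eta(1)] eta(2)
        u_def horizontal_lift_fibre[OF p xi X(1)])
  then have "w = splitting A D (p, \<xi>) (v, \<eta>)" by (simp only: X(2))
  then show thesis by (rule that[OF v eta(1) _ v_def])
qed

end

section \<open>The almost complex structures on the cotangent bundle\<close>

context cotangent_atlas
begin

lemma fibre_eval_add:
  "x \<in> points TM \<Longrightarrow> X \<in> vector_fields A \<Longrightarrow> Y \<in> vector_fields A \<Longrightarrow>
    fibre_eval (X + Y) x = fibre_eval X x + fibre_eval Y x"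
  by (auto simp: fibre_eval_def points_cotangent_bundle cot_add vf_tangent)

lemma fibre_eval_diff:
  "x \<in> points TM \<Longrightarrow> X \<in> vector_fields A \<Longrightarrow> Y \<in> vector_fields A \<Longrightarrow>
    fibre_eval (X - Y) x = fibre_eval X x - fibre_eval Y x"
  by (auto simp: fibre_eval_def points_cotangent_bundle cot_diff vf_tangent)

lemma fibre_eval_uminus:
  "x \<in> points TM \<Longrightarrow> X \<in> vector_fields A \<Longrightarrow> fibre_eval (- X) x = - fibre_eval X x"
  by (auto simp: fibre_eval_def points_cotangent_bundle cot_uminus vf_tangent)

lemma fibre_eval_fscale:
  "x \<in> points TM \<Longrightarrow> X \<in> vector_fields A \<Longrightarrow> fibre_eval (fscale f X) x = f (fst x) * fibre_eval X x"
  by (auto simp: fibre_eval_def points_cotangent_bundle cot_scale vf_tangent)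

lemma fibre_eval_zero: "x \<in> points TM \<Longrightarrow> fibre_eval 0 x = 0"
  by (auto simp: fibre_eval_def points_cotangent_bundle cot_zero)

end

section \<open>The two structures treated together\<close>

locale twisted_cotangent = cotangent_connection A D + acs_atlas A J
  for A :: "('a, 'e::euclidean_space) chart set" and D and J +
  fixes \<epsilon> :: real
  assumes eps: "\<epsilon> * \<epsilon> = 1"
begin

definition "JE = pullback_structure A D (\<lambda>p (v, \<eta>). (J p v, scale \<epsilon> (dual_endo J p \<eta>)))"

lemma dual_endo_cotangent:
  assumes "\<eta> \<in> cotangent_space A p"
  shows "dual_endo J p \<eta> \<in> cotangent_space A p"
  by (rule cotI) (simp_all add: dual_endo_def J_add J_scale J_tangent cot_add[OF assms] cot_scale[OF assms]
      cot_zero[OF assms] J_outside)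

text \<open>Says that the projection maps w to X p, tested on functions. A field rather than a
  vector is recorded because the connection differentiates along fields.\<close>

definition lies_over :: "('a \<times> 'a covec) tvec \<Rightarrow> 'a \<Rightarrow> 'a vfield \<Rightarrow> bool" where
  "lies_over w p X \<longleftrightarrow> (\<forall>f. smooth_near A p f \<longrightarrow> w (\<lambda>x. f (fst x)) = X p f)"

lemma lies_overD: "lies_over w p X \<Longrightarrow> smooth_near A p f \<Longrightarrow> w (\<lambda>x. f (fst x)) = X p f"
  by (simp add: lies_over_def)

text \<open>For w = X^h + \<eta>^v the value on ev_{JZ} is \<xi>(D_X JZ) + \<eta>(JZ). Solving for
  \<eta>(JZ) and inserting it into the value \<xi>(D_{JX} Z) + \<epsilon> \<eta>(JZ) removes both
  the lifts and the inverse of the splitting.\<close>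

lemma JE_props:
  assumes w: "w \<in> tangent_space TM (p, \<xi>)" and X: "X \<in> vector_fields A"
    and wX: "lies_over w p X"
  shows JE_tangent_field: "JE (p, \<xi>) w \<in> tangent_space TM (p, \<xi>)"
    and JE_base: "lies_over (JE (p, \<xi>) w) p (app J X)"
    and JE_fibre: "Z \<in> vector_fields A \<Longrightarrow> JE (p, \<xi>) w (fibre_eval Z) =
      \<epsilon> * w (fibre_eval (app J Z)) + \<xi> (D (app J X) Z p) - \<epsilon> * \<xi> (D X (app J Z) p)"
proof -
  have x: "(p, \<xi>) \<in> points TM" by (rule cot.tangent_space_points[OF w])
  then have p: "p \<in> points A" and xi: "\<xi> \<in> cotangent_space A p" by (simp_all add: points_cotangent_bundle)
  obtain v \<eta> where v: "v \<in> tangent_space A p" and eta: "\<eta> \<in> cotangent_space A p"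
    and w_eq: "w = splitting A D (p, \<xi>) (v, \<eta>)" and v_eq: "v = pushforward A fst (p, \<xi>) w"
    by (rule splitting_surj[OF w])
  have Xp: "X p = v"
  proof (rule tvec_eqI_smooth[OF vf_tangent[OF X p] v])
    show "X p f = v f" if "smooth_near A p f" for f
      using that lies_overD[OF wX that] by (simp add: v_eq pushforward_fst_apply)
  qed
  have eta': "scale \<epsilon> (dual_endo J p \<eta>) \<in> cotangent_space A p"
    by (intro cotangent_scale dual_endo_cotangent eta)
  have "the_inv_into (tangent_space A p \<times> cotangent_space A p) (splitting A D (p, \<xi>)) w = (v, \<eta>)"
    unfolding w_eq by (rule the_inv_into_f_f[OF splitting_inj[OF p xi]]) (simp add: v eta)
  then have JE: "JE (p, \<xi>) w = splitting A D (p, \<xi>) (app J X p, scale \<epsilon> (dual_endo J p \<eta>))"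
    using w by (simp add: JE_def pullback_structure_def Xp)
  show "JE (p, \<xi>) w \<in> tangent_space TM (p, \<xi>)"
    unfolding JE by (rule splitting_tangent[OF p xi app_vf[OF X] eta'])
  show "lies_over (JE (p, \<xi>) w) p (app J X)"
    unfolding JE lies_over_def by (intro allI impI splitting_base[OF p xi app_vf[OF X] eta'])
  show "JE (p, \<xi>) w (fibre_eval Z) =
      \<epsilon> * w (fibre_eval (app J Z)) + \<xi> (D (app J X) Z p) - \<epsilon> * \<xi> (D X (app J Z) p)"
    if Z: "Z \<in> vector_fields A"
  proof -
    have "w (fibre_eval (app J Z)) = \<xi> (D X (app J Z) p) + \<eta> (app J Z p)"
      using splitting_fibre[OF p xi X eta app_vf[OF Z]] by (simp only: w_eq Xp)
    then show ?thesis
      unfolding JE splitting_fibre[OF p xi app_vf[OF X] eta' Z]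
      by (simp add: dual_endo_def distrib_left)
  qed
qed

lemma tvec_base_field:
  assumes w: "w \<in> tangent_space TM (p, \<xi>)"
  obtains X where "X \<in> vector_fields A" "lies_over w p X"
proof -
  obtain X where X: "X \<in> vector_fields A" "X p = pushforward A fst (p, \<xi>) w"
    using tvec_extend[OF pushforward_fst[OF w]] by auto
  then show thesis using that[OF X(1)] by (simp add: lies_over_def pushforward_fst_apply)
qed

lemma JE_tangent: "w \<in> tangent_space TM x \<Longrightarrow> JE x w \<in> tangent_space TM x"
  by (cases x) (metis tvec_base_field JE_tangent_field)

lemma JE_add:
  assumes w: "w \<in> tangent_space TM x" "w' \<in> tangent_space TM x"
  shows "JE x (w + w') = JE x w + JE x w'"
proof -
  obtain p \<xi> where x: "x = (p, \<xi>)" by (cases x)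
  have "x \<in> points TM" by (rule cot.tangent_space_points[OF w(1)])
  then have p: "p \<in> points A" and xi: "\<xi> \<in> cotangent_space A p" by (simp_all add: x points_cotangent_bundle)
  note w = w[unfolded x]
  obtain X where X: "X \<in> vector_fields A" "lies_over w p X"
    using tvec_base_field[OF w(1)] by blast
  obtain X' where X': "X' \<in> vector_fields A" "lies_over w' p X'"
    using tvec_base_field[OF w(2)] by blast
  have s: "w + w' \<in> tangent_space TM (p, \<xi>)" by (rule cot.tangent_add[OF w])
  have sb: "lies_over (w + w') p (X + X')"
    using X(2) X'(2) by (simp add: lies_over_def)
  note sum = JE_props[OF s vf_add[OF X(1) X'(1)] sb]
  note one = JE_props[OF w(1) X] and two = JE_props[OF w(2) X']
  show ?thesis
    unfolding x
  proof (rule cot_tvec_eqI[OF sum(1) cot.tangent_add[OF one(1) two(1)]])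
    show "JE (p, \<xi>) (w + w') (\<lambda>x. f (fst x)) = (JE (p, \<xi>) w + JE (p, \<xi>) w') (\<lambda>x. f (fst x))"
      if f: "smooth_near A (fst (p, \<xi>)) f" for f
      by (simp only: f[unfolded fst_conv, THEN lies_overD[OF sum(2)]] f[unfolded fst_conv, THEN lies_overD[OF one(2)]]
          f[unfolded fst_conv, THEN lies_overD[OF two(2)]] app_add[OF X(1) X'(1)] plus_fun_apply)
    show "JE (p, \<xi>) (w + w') (fibre_eval Z) = (JE (p, \<xi>) w + JE (p, \<xi>) w') (fibre_eval Z)"
      if Z: "Z \<in> vector_fields A" for Z
      using sum(3)[OF Z] one(3)[OF Z] two(3)[OF Z] X(1) X'(1) Z p
      by (simp add: app_add D_add_left app_vf cot_add[OF xi vf_tangent vf_tangent] D_vf algebra_simps)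
  qed
qed

lemma JE_scale:
  assumes w: "w \<in> tangent_space TM x"
  shows "JE x (scale r w) = scale r (JE x w)"
proof -
  obtain p \<xi> where x: "x = (p, \<xi>)" by (cases x)
  have "x \<in> points TM" by (rule cot.tangent_space_points[OF w(1)])
  then have p: "p \<in> points A" and xi: "\<xi> \<in> cotangent_space A p" by (simp_all add: x points_cotangent_bundle)
  note w = w[unfolded x]
  obtain X where X: "X \<in> vector_fields A" "lies_over w p X"
    using tvec_base_field[OF w] by blast
  have s: "scale r w \<in> tangent_space TM (p, \<xi>)" by (rule cot.tangent_scale[OF w])
  have sb: "lies_over (scale r w) p (fscale (\<lambda>_. r) X)"
    using X(2) by (simp add: lies_over_def)
  note scaled = JE_props[OF s vf_fscale[OF X(1) smooth_function_const] sb]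
  note one = JE_props[OF w X]
  show ?thesis
    unfolding x
  proof (rule cot_tvec_eqI[OF scaled(1) cot.tangent_scale[OF one(1)]])
    show "JE (p, \<xi>) (scale r w) (\<lambda>x. f (fst x)) = scale r (JE (p, \<xi>) w) (\<lambda>x. f (fst x))"
      if f: "smooth_near A (fst (p, \<xi>)) f" for f
      by (simp only: f[unfolded fst_conv, THEN lies_overD[OF scaled(2)]] f[unfolded fst_conv, THEN lies_overD[OF one(2)]]
          app_fscale[OF X(1) smooth_function_const] fscale_apply scale_apply)
    show "JE (p, \<xi>) (scale r w) (fibre_eval Z) = scale r (JE (p, \<xi>) w) (fibre_eval Z)"
      if Z: "Z \<in> vector_fields A" for Z
      unfolding scaled(3)[OF Z] scale_apply one(3)[OF Z] using X(1) Z p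
      by (simp add: app_fscale D_fscale_left smooth_function_const app_vf cot_scale[OF xi vf_tangent] D_vf algebra_simps)
  qed
qed

lemma JE_square:
  assumes w: "w \<in> tangent_space TM x"
  shows "JE x (JE x w) = - w"
proof -
  obtain p \<xi> where x: "x = (p, \<xi>)" by (cases x)
  have xB: "(p, \<xi>) \<in> points TM" using cot.tangent_space_points[OF w(1)] x by simp
  then have p: "p \<in> points A" and xi: "\<xi> \<in> cotangent_space A p" by (simp_all add: points_cotangent_bundle)
  note w = w[unfolded x]
  obtain X where X: "X \<in> vector_fields A" "lies_over w p X"
    using tvec_base_field[OF w] by blast
  note one = JE_props[OF w X]
  note two = JE_props[OF one(1) app_vf[OF X(1)] one(2)]
  show ?thesis
    unfolding x
  proof (rule cot_tvec_eqI[OF two(1) cot.tangent_uminus[OF w]])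
    show "JE (p, \<xi>) (JE (p, \<xi>) w) (\<lambda>x. f (fst x)) = (- w) (\<lambda>x. f (fst x))"
      if f: "smooth_near A (fst (p, \<xi>)) f" for f
      by (simp only: f[unfolded fst_conv, THEN lies_overD[OF two(2)]] f[unfolded fst_conv, THEN lies_overD[OF X(2)]]
          app_square[OF X(1)] uminus_apply)
    show "JE (p, \<xi>) (JE (p, \<xi>) w) (fibre_eval Z) = (- w) (fibre_eval Z)"
      if Z: "Z \<in> vector_fields A" for Z
    proof -
      have "w (fibre_eval (- Z)) = w (\<lambda>x. - fibre_eval Z x)"
        by (rule cot.tvec_cong_points[OF w]) (rule fibre_eval_uminus[OF _ Z])
      then have wm: "w (fibre_eval (- Z)) = - w (fibre_eval Z)"
        by (simp add: cot.tvec_uminus[OF w fibre_eval_smooth[OF Z xB]])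
      have "\<xi> (D (- X) Z p) = - \<xi> (D X Z p)" "\<xi> (D X (- Z) p) = - \<xi> (D X Z p)"
        using cot_uminus[OF xi vf_tangent[OF D_vf[OF X(1) Z] p]] X(1) Z
        by (simp_all add: D_uminus_left D_uminus_right)
      \<comment> \<open>The connection terms cancel once \<epsilon>^2 = 1 is used.\<close>
      then have "JE (p, \<xi>) (JE (p, \<xi>) w) (fibre_eval Z) = - ((\<epsilon> * \<epsilon>) * w (fibre_eval Z))
          + (\<epsilon> * \<epsilon>) * \<xi> (D X Z p) - \<xi> (D X Z p)"
        unfolding two(3)[OF Z] one(3)[OF app_vf[OF Z]] app_square[OF Z] app_square[OF X(1)] wm
        by (simp add: algebra_simps)
      then show ?thesis by (simp add: eps)
    qed
  qed
qed

lemma app_sum: "(\<And>i. i \<in> I \<Longrightarrow> X i \<in> vector_fields A) \<Longrightarrow> app J (\<Sum>i\<in>I. X i) = (\<Sum>i\<in>I. app J (X i))"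
  by (induction I rule: infinite_finite_induct) (simp_all add: app_add app_zero vf_sum)

lemma D_sum_left: "(\<And>i. i \<in> I \<Longrightarrow> X i \<in> vector_fields A) \<Longrightarrow> Z \<in> vector_fields A \<Longrightarrow>
    D (\<Sum>i\<in>I. X i) Z = (\<Sum>i\<in>I. D (X i) Z)"
  by (induction I rule: infinite_finite_induct) (simp_all add: D_add_left D_zero_left vf_sum)

lemma fibre_eval_sum: "(\<And>i. i \<in> I \<Longrightarrow> X i \<in> vector_fields A) \<Longrightarrow> x \<in> points TM \<Longrightarrow>
    fibre_eval (\<Sum>i\<in>I. X i) x = (\<Sum>i\<in>I. fibre_eval (X i) x)"
  by (induction I rule: infinite_finite_induct) (simp_all add: fibre_eval_add fibre_eval_zero vf_sum)

text \<open>Near a point of \<open>TM\<close>, write the base part of \<open>V\<close> in a coordinate frame of \<open>M\<close>; the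
  formulas for \<open>JE\<close> then have coefficients that are visibly smooth.\<close>

lemma JE_vf:
  assumes V: "V \<in> vector_fields TM"
  shows "app JE V \<in> vector_fields TM"
proof -
  \<comment> \<open>The coefficients a b depend on the point y of the cotangent bundle, not only on
    its base point. Frozen at y they are constants on M, so a global field over V y results; this
    suffices because the formula for \<open>JE\<close> is pointwise.\<close>
  have expand: "\<exists>F a. (\<forall>b\<in>Basis. F b \<in> vector_fields A \<and> smooth_near TM x (a b)) \<and>
      (\<forall>\<^sub>F y in mnhds TM x. \<forall>f. smooth_near A (fst y) f \<longrightarrow>
        V y (\<lambda>x. f (fst x)) = (\<Sum>b\<in>(Basis :: 'e set). fscale (\<lambda>_. a b y) (F b)) (fst y) f)"
    if x: "x \<in> points TM" for x
  proof -
    obtain p \<xi> U \<phi> where xx: "x = (p, \<xi>)" "\<xi> \<in> cotangent_space A p" and c: "(U, \<phi>) \<in> A" "p \<in> U"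
      using cot_pointsE[OF x] by metis
    obtain F where F: "\<And>v. F v \<in> vector_fields A"
      "\<forall>\<^sub>F q in mnhds A p. \<forall>v. F v q = chart_tvec A (U, \<phi>) q v"
      using local_frame[OF c] by blast
    define a where "a = (\<lambda>b y. V y (\<lambda>x. \<phi> (fst x) \<bullet> b))"
    have a: "smooth_near TM x (a b)" for b
      unfolding a_def xx(1)
      by (rule cot.vf_smooth[OF V cot_smooth_near_fst[OF smooth_near_coord[OF c] xx(2)]])
    have "\<forall>\<^sub>F y in mnhds TM x. (\<forall>v. F v (fst y) = chart_tvec A (U, \<phi>) (fst y) v) \<and> fst y \<in> U \<and> y \<in> points TM"
      using cot_eventually_fst[OF F(2) chart_points[OF c] xx(2)]
        cot_eventually_fst[OF eventually_mnhds_domain[OF c] chart_points[OF c] xx(2)]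
        cot.eventually_mnhds_points[OF x] unfolding xx(1)
      by eventually_elim simp
    then have "\<forall>\<^sub>F y in mnhds TM x. \<forall>f. smooth_near A (fst y) f \<longrightarrow>
        V y (\<lambda>x. f (fst x)) = (\<Sum>b\<in>(Basis :: 'e set). fscale (\<lambda>_. a b y) (F b)) (fst y) f"
    proof (eventually_elim, intro allI impI)
      fix y f assume y: "(\<forall>v. F v (fst y) = chart_tvec A (U, \<phi>) (fst y) v) \<and> fst y \<in> U \<and> y \<in> points TM"
        and f: "smooth_near A (fst y) f"
      then have Fy: "F v (fst y) = chart_tvec A (U, \<phi>) (fst y) v" and yU: "fst y \<in> U" and yB: "y \<in> points TM" for v
        by auto
      have v: "pushforward A fst y (V y) \<in> tangent_space A (fst y)"
        by (rule pushforward_fst[OF cot.vf_tangent[OF V yB]])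
      have ab: "pushforward A fst y (V y) (\<lambda>q. \<phi> q \<bullet> b) = a b y" for b
        by (simp add: pushforward_fst_apply[OF smooth_near_coord[OF c(1) yU]] a_def)
      have "V y (\<lambda>x. f (fst x)) = pushforward A fst y (V y) f"
        by (simp add: pushforward_fst_apply[OF f])
      also have "\<dots> = (\<Sum>b\<in>Basis. a b y * chart_tvec A (U, \<phi>) (fst y) b f)"
        using tvec_expand[OF c(1) yU v, of f] by (simp only: ab)
      also have "\<dots> = (\<Sum>b\<in>(Basis :: 'e set). fscale (\<lambda>_. a b y) (F b)) (fst y) f"
        by (simp add: sum_fun_apply Fy)
      finally show "V y (\<lambda>x. f (fst x)) = (\<Sum>b\<in>(Basis :: 'e set). fscale (\<lambda>_. a b y) (F b)) (fst y) f" .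
    qed
    then show ?thesis using F(1) a by blast
  qed
  show ?thesis
  proof (rule cot_vfI)
    show "app JE V x \<in> tangent_space TM x" if "x \<in> points TM" for x
      using JE_tangent[OF cot.vf_tangent[OF V that]] by simp
    show "app JE V x = 0" if "x \<notin> points TM" for x
    proof -
      have "V x \<notin> tangent_space TM x" using that cot.tangent_space_points by blast
      then show ?thesis by (simp add: JE_def pullback_structure_def fun_eq_iff)
    qed
  next
    fix x f assume x: "x \<in> points TM" and f: "smooth_near A (fst x) f"
    obtain F a where F: "\<And>b. b \<in> Basis \<Longrightarrow> F b \<in> vector_fields A"
      and a: "\<And>b. b \<in> Basis \<Longrightarrow> smooth_near TM x (a b)"
      and ev: "\<forall>\<^sub>F y in mnhds TM x. \<forall>f. smooth_near A (fst y) f \<longrightarrow>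
        V y (\<lambda>x. f (fst x)) = (\<Sum>b\<in>(Basis :: 'e set). fscale (\<lambda>_. a b y) (F b)) (fst y) f"
      using expand[OF x] by blast
    have "smooth_near TM x (\<lambda>y. \<Sum>b\<in>Basis. a b y * app J (F b) (fst y) f)"
      by (intro cot.smooth_near_sum[OF x] cot.smooth_near_mult a cot_smooth_near_fst'[OF x]
          vf_smooth[OF app_vf[OF F] f])
    then show "smooth_near TM x (\<lambda>y. app JE V y (\<lambda>x. f (fst x)))"
    proof (rule cot.smooth_near_cong)
      have "\<forall>\<^sub>F y in mnhds TM x. smooth_near A (fst y) f"
        using x cot_eventually_fst[OF smooth_near_eventually[OF f]] by (auto simp: points_cotangent_bundle)
      with ev cot.eventually_mnhds_points[OF x]
      show "\<forall>\<^sub>F y in mnhds TM x. (\<Sum>b\<in>Basis. a b y * app J (F b) (fst y) f) = app JE V y (\<lambda>x. f (fst x))"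
      proof eventually_elim
        case (elim y)
        define X where "X = (\<Sum>b\<in>(Basis :: 'e set). fscale (\<lambda>_. a b y) (F b))"
        have X: "X \<in> vector_fields A" unfolding X_def by (intro vf_sum vf_fscale F smooth_function_const)
        have "app JE V y (\<lambda>x. f (fst x)) = app J X (fst y) f"
        proof -
          have "lies_over (V y) (fst y) X" using elim(1) by (simp add: lies_over_def X_def)
          from lies_overD[OF JE_base[OF _ X this, of "snd y"] elim(3)] show ?thesis
            using cot.vf_tangent[OF V elim(2)] by simp
        qed
        also have "app J X = (\<Sum>b\<in>Basis. fscale (\<lambda>_. a b y) (app J (F b)))"
          unfolding X_def by (simp add: app_sum app_fscale vf_fscale F smooth_function_const)
        finally show ?case by (simp add: sum_fun_apply)
      qed
    qed
  next
    fix x Z assume x: "x \<in> points TM" and Z: "Z \<in> vector_fields A"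
    obtain F a where F: "\<And>b. b \<in> Basis \<Longrightarrow> F b \<in> vector_fields A"
      and a: "\<And>b. b \<in> Basis \<Longrightarrow> smooth_near TM x (a b)"
      and ev: "\<forall>\<^sub>F y in mnhds TM x. \<forall>f. smooth_near A (fst y) f \<longrightarrow>
        V y (\<lambda>x. f (fst x)) = (\<Sum>b\<in>(Basis :: 'e set). fscale (\<lambda>_. a b y) (F b)) (fst y) f"
      using expand[OF x] by blast
    have "smooth_near TM x (\<lambda>y. \<epsilon> * V y (fibre_eval (app J Z)) + (\<Sum>b\<in>Basis. a b y * fibre_eval (D (app J (F b)) Z) y)
        - \<epsilon> * (\<Sum>b\<in>Basis. a b y * fibre_eval (D (F b) (app J Z)) y))"
      by (intro cot.smooth_near_sum[OF x] cot.smooth_near_mult cot.smooth_near_add cot.smooth_near_diff a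
          cot.smooth_near_const[OF x] cot.vf_smooth[OF V] fibre_eval_smooth[OF _ x] D_vf app_vf F Z)
    then show "smooth_near TM x (\<lambda>y. app JE V y (fibre_eval Z))"
    proof (rule cot.smooth_near_cong)
      from ev cot.eventually_mnhds_points[OF x]
      show "\<forall>\<^sub>F y in mnhds TM x. \<epsilon> * V y (fibre_eval (app J Z)) + (\<Sum>b\<in>Basis. a b y * fibre_eval (D (app J (F b)) Z) y)
        - \<epsilon> * (\<Sum>b\<in>Basis. a b y * fibre_eval (D (F b) (app J Z)) y) = app JE V y (fibre_eval Z)"
      proof eventually_elim
        case (elim y)
        define X where "X = (\<Sum>b\<in>(Basis :: 'e set). fscale (\<lambda>_. a b y) (F b))"
        have X: "X \<in> vector_fields A" unfolding X_def by (intro vf_sum vf_fscale F smooth_function_const)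
        have 1: "app JE V y (fibre_eval Z) = \<epsilon> * V y (fibre_eval (app J Z)) + fibre_eval (D (app J X) Z) y
            - \<epsilon> * fibre_eval (D X (app J Z)) y"
        proof -
          have "lies_over (V y) (fst y) X" using elim(1) by (simp add: lies_over_def X_def)
          from JE_fibre[OF _ X this Z, of "snd y"] show ?thesis
            using cot.vf_tangent[OF V elim(2)] by (simp add: fibre_eval_def)
        qed
        have 2: "D (app J X) Z = (\<Sum>b\<in>Basis. fscale (\<lambda>_. a b y) (D (app J (F b)) Z))"
          unfolding X_def
          by (simp add: app_sum app_fscale vf_fscale F smooth_function_const D_sum_left D_fscale_left app_vf Z)
        have 3: "D X (app J Z) = (\<Sum>b\<in>Basis. fscale (\<lambda>_. a b y) (D (F b) (app J Z)))"
          unfolding X_def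
          by (simp add: vf_fscale F smooth_function_const D_sum_left D_fscale_left app_vf Z)
        show ?case
          unfolding 1 2 3
          by (simp add: fibre_eval_sum fibre_eval_fscale elim(2) vf_fscale smooth_function_const D_vf app_vf F Z)
      qed
    qed
  qed
qed

lemma acs_JE: "almost_complex_structure TM JE"
  unfolding almost_complex_structure_def endomorphism_field_def
  using JE_tangent JE_add JE_scale JE_square JE_vf
  by (auto simp: JE_def pullback_structure_def)

end

sublocale twisted_cotangent \<subseteq> cotJ: bump_acs_atlas "cotangent_bundle A" JE
  by unfold_locales (rule acs_JE)

section \<open>The Nijenhuis tensor on lifts\<close>

context twisted_cotangent
begin

text \<open>The linear vector fields of the bundle: projectable, and preserving fibrewise linear
  functions. They are stable under brackets and under \<open>JE\<close>, so a Nijenhuis tensor of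
  horizontal lifts can be computed with the pairs (X, K) on M.\<close>

definition basic :: "('a \<times> 'a covec) vfield \<Rightarrow> 'a vfield \<Rightarrow> ('a vfield \<Rightarrow> 'a vfield) \<Rightarrow> bool" where
  "basic V X K \<longleftrightarrow> V \<in> vector_fields TM \<and> X \<in> vector_fields A \<and>
     (\<forall>Z\<in>vector_fields A. K Z \<in> vector_fields A) \<and>
     (\<forall>x\<in>points TM. lies_over (V x) (fst x) X) \<and>
     (\<forall>x\<in>points TM. \<forall>Z\<in>vector_fields A. V x (fibre_eval Z) = fibre_eval (K Z) x)"

text \<open>Vertical fields that are constant along each fibre, described by a one-form.\<close>

definition vertical :: "('a \<times> 'a covec) vfield \<Rightarrow> 'a one_form \<Rightarrow> bool" where
  "vertical W \<beta> \<longleftrightarrow> W \<in> vector_fields TM \<and> \<beta> \<in> one_forms A \<and>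
     (\<forall>x\<in>points TM. lies_over (W x) (fst x) 0) \<and>
     (\<forall>x\<in>points TM. \<forall>Z\<in>vector_fields A. W x (fibre_eval Z) = \<beta> (fst x) (Z (fst x)))"

lemma basicD:
  assumes "basic V X K"
  shows "V \<in> vector_fields TM" "X \<in> vector_fields A" "Z \<in> vector_fields A \<Longrightarrow> K Z \<in> vector_fields A"
    "x \<in> points TM \<Longrightarrow> lies_over (V x) (fst x) X"
    "x \<in> points TM \<Longrightarrow> Z \<in> vector_fields A \<Longrightarrow> V x (fibre_eval Z) = fibre_eval (K Z) x"
  using assms by (auto simp: basic_def)

lemma verticalD:
  assumes "vertical W \<beta>"
  shows "W \<in> vector_fields TM" "\<beta> \<in> one_forms A"
    "x \<in> points TM \<Longrightarrow> lies_over (W x) (fst x) 0"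
    "x \<in> points TM \<Longrightarrow> Z \<in> vector_fields A \<Longrightarrow> W x (fibre_eval Z) = \<beta> (fst x) (Z (fst x))"
  using assms by (auto simp: vertical_def)

lemma basic_cong:
  assumes "basic V X K" "\<And>Z. Z \<in> vector_fields A \<Longrightarrow> K Z = L Z"
  shows "basic V X L"
  using assms by (simp add: basic_def)

lemma tvec_fst:
  assumes w: "w \<in> tangent_space TM x" and over: "\<And>y. y \<in> points TM \<Longrightarrow> lies_over (W y) (fst y) Y"
    and f: "smooth_near A (fst x) f"
  shows "w (\<lambda>y. W y (\<lambda>x. f (fst x))) = w (\<lambda>y. Y (fst y) f)"
proof (rule cot.tvec_cong[OF w])
  have x: "x \<in> points TM" by (rule cot.tangent_space_points[OF w])
  have "\<forall>\<^sub>F y in mnhds TM x. smooth_near A (fst y) f"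
    using x cot_eventually_fst[OF smooth_near_eventually[OF f]] by (auto simp: points_cotangent_bundle)
  with cot.eventually_mnhds_points[OF x]
  show "\<forall>\<^sub>F y in mnhds TM x. W y (\<lambda>x. f (fst x)) = Y (fst y) f"
    by eventually_elim (rule lies_overD[OF over])
qed

lemma lies_over_bracket:
  assumes V: "V \<in> vector_fields TM" "\<And>y. y \<in> points TM \<Longrightarrow> lies_over (V y) (fst y) X"
    and W: "W \<in> vector_fields TM" "\<And>y. y \<in> points TM \<Longrightarrow> lies_over (W y) (fst y) Y"
    and X: "X \<in> vector_fields A" and Y: "Y \<in> vector_fields A" and x: "x \<in> points TM"
  shows "lies_over (lie_bracket TM V W x) (fst x) (lie_bracket A X Y)"
  unfolding lies_over_def
proof (intro allI impI)
  fix f assume f: "smooth_near A (fst x) f"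
  have "V x (\<lambda>y. W y (\<lambda>x. f (fst x))) = X (fst x) (\<lambda>q. Y q f)"
    using tvec_fst[OF cot.vf_tangent[OF V(1) x] W(2) f] lies_overD[OF V(2)[OF x] vf_smooth[OF Y f]] by simp
  moreover have "W x (\<lambda>y. V y (\<lambda>x. f (fst x))) = Y (fst x) (\<lambda>q. X q f)"
    using tvec_fst[OF cot.vf_tangent[OF W(1) x] V(2) f] lies_overD[OF W(2)[OF x] vf_smooth[OF X f]] by simp
  ultimately show "lie_bracket TM V W x (\<lambda>x. f (fst x)) = lie_bracket A X Y (fst x) f"
    by (simp only: lie_bracket_apply[OF cot_smooth_near_fst'[OF x f]] lie_bracket_apply[OF f])
qed

text \<open>V(W ev_Z) = V ev_{LZ} = ev_{K(LZ)}, so the operators compose in the order of the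
  fields.\<close>

lemma basic_bracket:
  assumes V: "basic V X K" and W: "basic W Y L"
  shows "basic (lie_bracket TM V W) (lie_bracket A X Y) (\<lambda>Z. K (L Z) - L (K Z))"
  unfolding basic_def
proof (intro conjI ballI)
  note V = basicD[OF V] and W = basicD[OF W]
  show "lie_bracket TM V W \<in> vector_fields TM" by (rule cot.lie_bracket_vf[OF V(1) W(1)])
  show "lie_bracket A X Y \<in> vector_fields A" by (rule lie_bracket_vf[OF V(2) W(2)])
  show "K (L Z) - L (K Z) \<in> vector_fields A" if "Z \<in> vector_fields A" for Z
    by (intro vf_diff V W that)
  show "lies_over (lie_bracket TM V W x) (fst x) (lie_bracket A X Y)" if "x \<in> points TM" for x
    by (rule lies_over_bracket[OF V(1) V(4) W(1) W(4) V(2) W(2) that])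
  fix x Z assume x: "x \<in> points TM" and Z: "Z \<in> vector_fields A"
  have "V x (\<lambda>y. W y (fibre_eval Z)) = V x (fibre_eval (L Z))"
    by (rule cot.tvec_cong_points[OF cot.vf_tangent[OF V(1) x] W(5)[OF _ Z]])
  moreover have "W x (\<lambda>y. V y (fibre_eval Z)) = W x (fibre_eval (K Z))"
    by (rule cot.tvec_cong_points[OF cot.vf_tangent[OF W(1) x] V(5)[OF _ Z]])
  ultimately show "lie_bracket TM V W x (fibre_eval Z) = fibre_eval (K (L Z) - L (K Z)) x"
    using V(3)[OF W(3)[OF Z]] W(3)[OF V(3)[OF Z]]
    by (simp add: lie_bracket_apply[OF fibre_eval_smooth[OF Z x]] V(5)[OF x W(3)[OF Z]] W(5)[OF x V(3)[OF Z]]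
        fibre_eval_diff[OF x])
qed

lemma basic_diff:
  assumes V: "basic V X K" and W: "basic W Y L"
  shows "basic (V - W) (X - Y) (\<lambda>Z. K Z - L Z)"
  using basicD[OF V] basicD[OF W]
  by (simp add: basic_def lies_over_def cot.vf_diff vf_diff fibre_eval_diff)

lemma app_JE_base:
  assumes V: "V \<in> vector_fields TM" and X: "X \<in> vector_fields A" and x: "x \<in> points TM"
    and over: "lies_over (V x) (fst x) X"
  shows "lies_over (app JE V x) (fst x) (app J X)"
  using JE_base[OF _ X over, of "snd x"] cot.vf_tangent[OF V x] by simp

lemma app_JE_fibre:
  assumes V: "V \<in> vector_fields TM" and X: "X \<in> vector_fields A" and x: "x \<in> points TM"
    and over: "lies_over (V x) (fst x) X" and Z: "Z \<in> vector_fields A"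
  shows "app JE V x (fibre_eval Z) = \<epsilon> * V x (fibre_eval (app J Z)) + fibre_eval (D (app J X) Z) x
    - \<epsilon> * fibre_eval (D X (app J Z)) x"
  using JE_fibre[OF _ X over Z, of "snd x"] cot.vf_tangent[OF V x] by (simp add: fibre_eval_def)

lemma basic_JE:
  assumes V: "basic V X K"
  shows "basic (app JE V) (app J X)
    (\<lambda>Z. fscale (\<lambda>_. \<epsilon>) (K (app J Z)) + D (app J X) Z - fscale (\<lambda>_. \<epsilon>) (D X (app J Z)))"
  unfolding basic_def
proof (intro conjI ballI)
  note V = basicD[OF V]
  show "app JE V \<in> vector_fields TM" by (rule JE_vf[OF V(1)])
  show "app J X \<in> vector_fields A" by (rule app_vf[OF V(2)])
  show "lies_over (app JE V x) (fst x) (app J X)" if "x \<in> points TM" for x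
    by (rule app_JE_base[OF V(1,2) that V(4)[OF that]])
  fix Z assume Z: "Z \<in> vector_fields A"
  show "fscale (\<lambda>_. \<epsilon>) (K (app J Z)) + D (app J X) Z - fscale (\<lambda>_. \<epsilon>) (D X (app J Z)) \<in> vector_fields A"
    by (intro vf_add vf_diff vf_fscale smooth_function_const V(2,3) D_vf app_vf Z)
  fix x assume x: "x \<in> points TM"
  show "app JE V x (fibre_eval Z) =
      fibre_eval (fscale (\<lambda>_. \<epsilon>) (K (app J Z)) + D (app J X) Z - fscale (\<lambda>_. \<epsilon>) (D X (app J Z))) x"
    unfolding app_JE_fibre[OF V(1,2) x V(4)[OF x] Z] V(5)[OF x app_vf[OF Z]]
    by (simp add: fibre_eval_diff[OF x]
        fibre_eval_add[OF x] fibre_eval_fscale[OF x] vf_add vf_fscale smooth_function_const V(2,3) D_vf app_vf Z)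
qed

section \<open>Brackets and Nijenhuis tensor of horizontal and vertical lifts\<close>

definition "hlift X = (\<lambda>x. if x \<in> points TM then horizontal_lift A D x (X (fst x)) else 0)"

definition "vlift \<beta> = (\<lambda>x. if x \<in> points TM then vertical_lift A x (\<beta> (fst x)) else 0)"

lemma smooth_near_lies_over:
  assumes over: "\<And>y. y \<in> points TM \<Longrightarrow> lies_over (V y) (fst y) X" and X: "X \<in> vector_fields A"
    and x: "x \<in> points TM" and f: "smooth_near A (fst x) f"
  shows "smooth_near TM x (\<lambda>y. V y (\<lambda>x. f (fst x)))"
proof (rule cot.smooth_near_cong[OF cot_smooth_near_fst'[OF x vf_smooth[OF X f]]])
  have "\<forall>\<^sub>F y in mnhds TM x. smooth_near A (fst y) f"
    using x cot_eventually_fst[OF smooth_near_eventually[OF f]] by (auto simp: points_cotangent_bundle)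
  with cot.eventually_mnhds_points[OF x]
  show "\<forall>\<^sub>F y in mnhds TM x. X (fst y) f = V y (\<lambda>x. f (fst x))"
    by eventually_elim (rule lies_overD[OF over, symmetric])
qed

lemma basic_hlift:
  assumes X: "X \<in> vector_fields A"
  shows "basic (hlift X) X (D X)"
proof -
  have props: "hlift X x \<in> tangent_space TM x" "lies_over (hlift X x) (fst x) X"
    "Z \<in> vector_fields A \<Longrightarrow> hlift X x (fibre_eval Z) = fibre_eval (D X Z) x"
    if "x \<in> points TM" for x Z
  proof -
    obtain p \<xi> where x: "x = (p, \<xi>)" "p \<in> points A" "\<xi> \<in> cotangent_space A p"
      using \<open>x \<in> points TM\<close> by (auto simp: points_cotangent_bundle)
    show "hlift X x \<in> tangent_space TM x" "lies_over (hlift X x) (fst x) X"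
      "Z \<in> vector_fields A \<Longrightarrow> hlift X x (fibre_eval Z) = fibre_eval (D X Z) x"
      using that horizontal_lift_props[OF x(2,3) X]
      by (simp_all add: hlift_def x(1) lies_over_def fibre_eval_def)
  qed
  have "hlift X \<in> vector_fields TM"
  proof (rule cot_vfI)
    show "hlift X x = 0" if "x \<notin> points TM" for x using that by (simp add: hlift_def fun_eq_iff)
    show "smooth_near TM x (\<lambda>y. hlift X y (\<lambda>x. f (fst x)))"
      if "x \<in> points TM" "smooth_near A (fst x) f" for x f
      by (rule smooth_near_lies_over[OF props(2) X that])
    show "smooth_near TM x (\<lambda>y. hlift X y (fibre_eval Z))" if "x \<in> points TM" "Z \<in> vector_fields A" for x Z
    proof (rule cot.smooth_near_cong[OF fibre_eval_smooth[OF D_vf[OF X that(2)] that(1)]])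
      show "\<forall>\<^sub>F y in mnhds TM x. fibre_eval (D X Z) y = hlift X y (fibre_eval Z)"
        using cot.eventually_mnhds_points[OF that(1)] by eventually_elim (rule props(3)[OF _ that(2), symmetric])
    qed
  qed (rule props(1))
  then show ?thesis using X D_vf props by (simp add: basic_def)
qed

lemma vertical_vlift:
  assumes \<beta>: "\<beta> \<in> one_forms A"
  shows "vertical (vlift \<beta>) \<beta>"
proof -
  have props: "vlift \<beta> x \<in> tangent_space TM x" "lies_over (vlift \<beta> x) (fst x) 0"
    "Z \<in> vector_fields A \<Longrightarrow> vlift \<beta> x (fibre_eval Z) = \<beta> (fst x) (Z (fst x))"
    if "x \<in> points TM" for x Z
  proof -
    obtain p \<xi> where x: "x = (p, \<xi>)" "p \<in> points A" "\<xi> \<in> cotangent_space A p"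
      using \<open>x \<in> points TM\<close> by (auto simp: points_cotangent_bundle)
    show "vlift \<beta> x \<in> tangent_space TM x" "lies_over (vlift \<beta> x) (fst x) 0"
      "Z \<in> vector_fields A \<Longrightarrow> vlift \<beta> x (fibre_eval Z) = \<beta> (fst x) (Z (fst x))"
      using that vertical_lift_tangent[OF x(2,3) one_form_cotangent[OF \<beta> x(2)]] vertical_lift_base[OF _ x(3)]
        vertical_lift_fibre[OF x(2,3)]
      by (simp_all add: vlift_def x(1) lies_over_def)
  qed
  have "vlift \<beta> \<in> vector_fields TM"
  proof (rule cot_vfI)
    show "vlift \<beta> x = 0" if "x \<notin> points TM" for x using that by (simp add: vlift_def fun_eq_iff)
    show "smooth_near TM x (\<lambda>y. vlift \<beta> y (\<lambda>x. f (fst x)))"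
      if "x \<in> points TM" "smooth_near A (fst x) f" for x f
      by (rule smooth_near_lies_over[OF props(2) vf_zero that])
    show "smooth_near TM x (\<lambda>y. vlift \<beta> y (fibre_eval Z))" if "x \<in> points TM" "Z \<in> vector_fields A" for x Z
    proof (rule cot.smooth_near_cong)
      have "fst x \<in> points A" using that(1) by (auto simp: points_cotangent_bundle)
      then show "smooth_near TM x (\<lambda>y. \<beta> (fst y) (Z (fst y)))"
        by (intro cot_smooth_near_fst'[OF that(1)] smooth_functionD[OF one_form_smooth[OF \<beta> that(2)]])
      show "\<forall>\<^sub>F y in mnhds TM x. \<beta> (fst y) (Z (fst y)) = vlift \<beta> y (fibre_eval Z)"
        using cot.eventually_mnhds_points[OF that(1)] by eventually_elim (rule props(3)[OF _ that(2), symmetric])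
    qed
  qed (rule props(1))
  then show ?thesis using \<beta> props by (simp add: vertical_def)
qed

text \<open>For K = D_X the two \<epsilon>-terms of \<open>basic_JE\<close> cancel: J^\<epsilon>
  sends the lift of X to the lift of JX.\<close>

lemma basic_JE_hlift:
  assumes X: "X \<in> vector_fields A"
  shows "basic (app JE (hlift X)) (app J X) (D (app J X))"
  by (rule basic_cong[OF basic_JE[OF basic_hlift[OF X]]]) simp

text \<open>The commutators of covariant derivatives lack the bracket terms of the curvature. Those
  of the JZ-terms are supplied by \<open>basic_JE\<close>; the others are added and subtracted, and
  the surplus collects into D_N Z for N = \<open>nijenhuis A J X Y\<close>.\<close>

lemma basic_nijenhuis_hlift:
  assumes X: "X \<in> vector_fields A" and Y: "Y \<in> vector_fields A"
  shows "basic (nijenhuis TM JE (hlift X) (hlift Y)) (nijenhuis A J X Y)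
    (\<lambda>Z. D (nijenhuis A J X Y) Z + (curvature A D X Y Z - curvature A D (app J X) (app J Y) Z)
      + fscale (\<lambda>_. \<epsilon>) (curvature A D (app J X) Y (app J Z) + curvature A D X (app J Y) (app J Z)))"
proof -
  note b = basic_hlift[OF X] basic_hlift[OF Y] basic_JE_hlift[OF X] basic_JE_hlift[OF Y]
  show ?thesis
    unfolding nijenhuis_def
  proof (rule basic_cong[OF basic_diff[OF basic_diff[OF basic_diff[OF basic_bracket[OF b(3,4)]
            basic_JE[OF basic_bracket[OF b(3,2)]]] basic_JE[OF basic_bracket[OF b(1,4)]]] basic_bracket[OF b(1,2)]]])
    fix Z assume Z: "Z \<in> vector_fields A"
    show "D (app J X) (D (app J Y) Z) - D (app J Y) (D (app J X) Z) -
        (fscale (\<lambda>_. \<epsilon>) (D (app J X) (D Y (app J Z)) - D Y (D (app J X) (app J Z))) +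
          D (app J (lie_bracket A (app J X) Y)) Z - fscale (\<lambda>_. \<epsilon>) (D (lie_bracket A (app J X) Y) (app J Z))) -
        (fscale (\<lambda>_. \<epsilon>) (D X (D (app J Y) (app J Z)) - D (app J Y) (D X (app J Z))) +
          D (app J (lie_bracket A X (app J Y))) Z - fscale (\<lambda>_. \<epsilon>) (D (lie_bracket A X (app J Y)) (app J Z))) -
        (D X (D Y Z) - D Y (D X Z)) =
      D (lie_bracket A (app J X) (app J Y) - app J (lie_bracket A (app J X) Y) - app J (lie_bracket A X (app J Y))
        - lie_bracket A X Y) Z + (curvature A D X Y Z - curvature A D (app J X) (app J Y) Z)
      + fscale (\<lambda>_. \<epsilon>) (curvature A D (app J X) Y (app J Z) + curvature A D X (app J Y) (app J Z))"
      using X Y Z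
      by (simp add: D_diff_left vf_diff app_vf lie_bracket_vf curvature_def)
        (simp add: fun_eq_iff algebra_simps)
  qed
qed

lemma dual_one_form:
  assumes \<beta>: "\<beta> \<in> one_forms A"
  shows "(\<lambda>p. scale \<epsilon> (dual_endo J p (\<beta> p))) \<in> one_forms A"
proof (rule one_formI)
  show "scale \<epsilon> (dual_endo J p (\<beta> p)) \<in> cotangent_space A p" if "p \<in> points A" for p
    by (intro cotangent_scale dual_endo_cotangent one_form_cotangent[OF \<beta> that])
  show "scale \<epsilon> (dual_endo J p (\<beta> p)) = 0" if "p \<notin> points A" for p
    using one_form_outside[OF \<beta> that] by (simp add: dual_endo_def fun_eq_iff)
  show "smooth_function A (\<lambda>q. scale \<epsilon> (dual_endo J q (\<beta> q)) (X q))" if "X \<in> vector_fields A" for X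
    using smooth_function_mult[OF smooth_function_const one_form_smooth[OF \<beta> app_vf[OF that]]]
    by (simp add: dual_endo_def)
qed

lemma JE_lies_over_0:
  assumes w: "w \<in> tangent_space TM x" and over: "lies_over w (fst x) 0"
  shows "lies_over (JE x w) (fst x) 0"
    and "Z \<in> vector_fields A \<Longrightarrow> JE x w (fibre_eval Z) = \<epsilon> * w (fibre_eval (app J Z))"
proof -
  obtain p \<xi> where x: "x = (p, \<xi>)" by (cases x)
  have "x \<in> points TM" by (rule cot.tangent_space_points[OF w])
  then have p: "p \<in> points A" and xi: "\<xi> \<in> cotangent_space A p" by (simp_all add: x points_cotangent_bundle)
  note props = JE_props[OF w[unfolded x] vf_zero over[unfolded x fst_conv]]
  show "lies_over (JE x w) (fst x) 0" using props(2) by (simp add: x app_zero)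
  have "\<xi> (D 0 Z p) = 0" if "Z \<in> vector_fields A" for Z
    using cot_zero[OF xi] by (simp only: D_zero_left[OF that] zero_fun_apply)
  then show "JE x w (fibre_eval Z) = \<epsilon> * w (fibre_eval (app J Z))" if "Z \<in> vector_fields A"
    using props(3)[OF that] that app_vf[OF that] by (simp add: x app_zero)
qed

lemma vertical_JE:
  assumes W: "vertical W \<beta>"
  shows "vertical (app JE W) (\<lambda>p. scale \<epsilon> (dual_endo J p (\<beta> p)))"
  unfolding vertical_def
proof (intro conjI ballI)
  note W = verticalD[OF W]
  show "app JE W \<in> vector_fields TM" by (rule JE_vf[OF W(1)])
  show "(\<lambda>p. scale \<epsilon> (dual_endo J p (\<beta> p))) \<in> one_forms A" by (rule dual_one_form[OF W(2)])
  show "lies_over (app JE W x) (fst x) 0" if "x \<in> points TM" for x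
    using JE_lies_over_0(1)[OF cot.vf_tangent[OF W(1) that] W(3)[OF that]] by simp
  show "app JE W x (fibre_eval Z) = scale \<epsilon> (dual_endo J (fst x) (\<beta> (fst x))) (Z (fst x))"
    if "x \<in> points TM" "Z \<in> vector_fields A" for x Z
    using JE_lies_over_0(2)[OF cot.vf_tangent[OF W(1) that(1)] W(3)[OF that(1)] that(2)]
      W(4)[OF that(1) app_vf[OF that(2)]] by (simp add: dual_endo_def)
qed

lemma lie_bracket_zero_right: "X \<in> vector_fields A \<Longrightarrow> lie_bracket A X 0 = 0"
  using lie_bracket_add_right[OF _ vf_zero vf_zero, of X] by fastforce

text \<open>For K = D_X this says that the bracket of X^h and \<beta>^v is the vertical lift of D_X
  \<beta>.\<close>

lemma bracket_basic_vertical: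
  assumes V: "basic V X K" and W: "vertical W \<beta>" and x: "x \<in> points TM"
  shows "lies_over (lie_bracket TM V W x) (fst x) 0"
    and "Z \<in> vector_fields A \<Longrightarrow> lie_bracket TM V W x (fibre_eval Z) =
      X (fst x) (\<lambda>q. \<beta> q (Z q)) - \<beta> (fst x) (K Z (fst x))"
proof -
  note V = basicD[OF V] and W = verticalD[OF W]
  have p: "fst x \<in> points A" using x by (auto simp: points_cotangent_bundle)
  show "lies_over (lie_bracket TM V W x) (fst x) 0"
    using lies_over_bracket[OF V(1) V(4) W(1) W(3) V(2) vf_zero x] lie_bracket_zero_right[OF V(2)] by simp
  assume Z: "Z \<in> vector_fields A"
  have "V x (\<lambda>y. W y (fibre_eval Z)) = V x (\<lambda>y. \<beta> (fst y) (Z (fst y)))"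
    by (rule cot.tvec_cong_points[OF cot.vf_tangent[OF V(1) x] W(4)[OF _ Z]])
  also have "\<dots> = X (fst x) (\<lambda>q. \<beta> q (Z q))"
    by (rule lies_overD[OF V(4)[OF x] smooth_functionD[OF one_form_smooth[OF W(2) Z] p]])
  moreover have "W x (\<lambda>y. V y (fibre_eval Z)) = W x (fibre_eval (K Z))"
    by (rule cot.tvec_cong_points[OF cot.vf_tangent[OF W(1) x] V(5)[OF _ Z]])
  ultimately show "lie_bracket TM V W x (fibre_eval Z) = X (fst x) (\<lambda>q. \<beta> q (Z q)) - \<beta> (fst x) (K Z (fst x))"
    by (simp add: lie_bracket_apply[OF fibre_eval_smooth[OF Z x]] W(4)[OF x V(3)[OF Z]])
qed

text \<open>One vertical field sends ev_Z to a function from the base, which the other one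
  kills.\<close>

lemma bracket_vertical_vertical:
  assumes V: "vertical V \<alpha>" and W: "vertical W \<beta>"
  shows "lie_bracket TM V W = 0"
proof (rule cotJ.vf_eqI_points)
  note V = verticalD[OF V] and W = verticalD[OF W]
  show "lie_bracket TM V W \<in> vector_fields TM" by (rule cot.lie_bracket_vf[OF V(1) W(1)])
  show "0 \<in> vector_fields TM" by (rule cot.vf_zero)
  fix x assume x: "x \<in> points TM"
  have p: "fst x \<in> points A" using x by (auto simp: points_cotangent_bundle)
  show "lie_bracket TM V W x = 0 x"
  proof (rule cot_tvec_eqI)
    show "lie_bracket TM V W x \<in> tangent_space TM x" by (rule cot.lie_bracket_tangent[OF V(1) W(1) x])
    show "0 x \<in> tangent_space TM x" by (rule cot.vf_tangent[OF cot.vf_zero x])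
    show "lie_bracket TM V W x (\<lambda>x. f (fst x)) = 0 x (\<lambda>x. f (fst x))" if "smooth_near A (fst x) f" for f
      using lies_overD[OF lies_over_bracket[OF V(1) V(3) W(1) W(3) vf_zero vf_zero x] that]
      by (simp add: lie_bracket_zero_right[OF vf_zero])
    show "lie_bracket TM V W x (fibre_eval Z) = 0 x (fibre_eval Z)" if Z: "Z \<in> vector_fields A" for Z
    proof -
      have "V x (\<lambda>y. W y (fibre_eval Z)) = V x (\<lambda>y. \<beta> (fst y) (Z (fst y)))"
        by (rule cot.tvec_cong_points[OF cot.vf_tangent[OF V(1) x] W(4)[OF _ Z]])
      moreover have "W x (\<lambda>y. V y (fibre_eval Z)) = W x (\<lambda>y. \<alpha> (fst y) (Z (fst y)))"
        by (rule cot.tvec_cong_points[OF cot.vf_tangent[OF W(1) x] V(4)[OF _ Z]])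
      ultimately show ?thesis
        using lies_overD[OF V(3)[OF x] smooth_functionD[OF one_form_smooth[OF W(2) Z] p]]
          lies_overD[OF W(3)[OF x] smooth_functionD[OF one_form_smooth[OF V(2) Z] p]]
        by (simp add: lie_bracket_apply[OF fibre_eval_smooth[OF Z x]])
    qed
  qed
qed

lemma nijenhuis_vlift_vlift:
  assumes "\<alpha> \<in> one_forms A" "\<beta> \<in> one_forms A"
  shows "nijenhuis TM JE (vlift \<alpha>) (vlift \<beta>) = 0"
proof -
  note v = vertical_vlift[OF assms(1)] vertical_vlift[OF assms(2)]
  show ?thesis
    unfolding nijenhuis_def bracket_vertical_vertical[OF v(1,2)]
      bracket_vertical_vertical[OF vertical_JE[OF v(1)] vertical_JE[OF v(2)]]
      bracket_vertical_vertical[OF vertical_JE[OF v(1)] v(2)]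
      bracket_vertical_vertical[OF v(1) vertical_JE[OF v(2)]]
    by (simp add: cotJ.app_zero)
qed

text \<open>All derivatives of \<beta> cancel, those along JX directly and those along X by
  \<epsilon>^2 = 1. What is left is \<beta> applied to \<epsilon> (D_{JX} J) Z + J D_X(JZ) + D_X Z,
  and the last two terms are J (D_X J) Z.\<close>

lemma nijenhuis_hlift_vlift:
  assumes X: "X \<in> vector_fields A" and \<beta>: "\<beta> \<in> one_forms A" and x: "x \<in> points TM"
  shows "lies_over (nijenhuis TM JE (hlift X) (vlift \<beta>) x) (fst x) 0"
    and "Z \<in> vector_fields A \<Longrightarrow> nijenhuis TM JE (hlift X) (vlift \<beta>) x (fibre_eval Z) =
      \<beta> (fst x) ((fscale (\<lambda>_. \<epsilon>) (cov_endo D J (app J X) Z) + app J (cov_endo D J X Z)) (fst x))"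
proof -
  define V W where "V = hlift X" and "W = vlift \<beta>"
  have V: "basic V X (D X)" and JV: "basic (app JE V) (app J X) (D (app J X))"
    unfolding V_def by (rule basic_hlift[OF X], rule basic_JE_hlift[OF X])
  have W: "vertical W \<beta>" unfolding W_def by (rule vertical_vlift[OF \<beta>])
  note JW = vertical_JE[OF W]
  have tan: "lie_bracket TM V' W' x \<in> tangent_space TM x"
    if "V' \<in> vector_fields TM" "W' \<in> vector_fields TM" for V' W'
    by (rule cot.lie_bracket_tangent[OF that x])
  note t2 = tan[OF basicD(1)[OF JV] verticalD(1)[OF W]] and t3 = tan[OF basicD(1)[OF V] verticalD(1)[OF JW]]
  note b1 = bracket_basic_vertical[OF JV JW x] and b2 = bracket_basic_vertical[OF JV W x]
    and b3 = bracket_basic_vertical[OF V JW x] and b4 = bracket_basic_vertical[OF V W x]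
  note j2 = JE_lies_over_0[OF t2 b2(1)] and j3 = JE_lies_over_0[OF t3 b3(1)]
  show "lies_over (nijenhuis TM JE (hlift X) (vlift \<beta>) x) (fst x) 0"
    using b1(1) j2(1) j3(1) b4(1)
    by (simp add: nijenhuis_def lies_over_def V_def[symmetric] W_def[symmetric])
  assume Z: "Z \<in> vector_fields A"
  have p: "fst x \<in> points A" using x by (auto simp: points_cotangent_bundle)
  note bp = one_form_cotangent[OF \<beta> p] and Xp = vf_tangent[OF X p] and JXp = vf_tangent[OF app_vf[OF X] p]
  have sm: "smooth_near A (fst x) (\<lambda>q. \<beta> q (Y q))" if "Y \<in> vector_fields A" for Y
    by (rule smooth_functionD[OF one_form_smooth[OF \<beta> that] p])
  have e1: "app J X (fst x) (\<lambda>q. \<epsilon> * \<beta> q (J q (Z q))) = \<epsilon> * app J X (fst x) (\<lambda>q. \<beta> q (J q (Z q)))"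
    using tvec_cmult[OF JXp sm[OF app_vf[OF Z]]] by simp
  have e3: "X (fst x) (\<lambda>q. \<epsilon> * \<beta> q (J q (app J Z q))) = - \<epsilon> * X (fst x) (\<lambda>q. \<beta> q (Z q))"
  proof -
    have "X (fst x) (\<lambda>q. \<epsilon> * \<beta> q (J q (app J Z q))) = X (fst x) (\<lambda>q. - \<epsilon> * \<beta> q (Z q))"
      by (rule tvec_cong_points[OF Xp])
        (simp add: J_square vf_tangent[OF Z] cot_uminus[OF one_form_cotangent[OF \<beta>]])
    then show ?thesis using tvec_cmult[OF Xp sm[OF Z], of "- \<epsilon>"] by simp
  qed
  note d = vf_tangent[OF D_vf p] J_tangent[OF vf_tangent[OF D_vf p]]
  have "nijenhuis TM JE V W x (fibre_eval Z) =
      (\<epsilon> * app J X (fst x) (\<lambda>q. \<beta> q (J q (Z q))) - \<epsilon> * \<beta> (fst x) (J (fst x) (D (app J X) Z (fst x))))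
      - \<epsilon> * (app J X (fst x) (\<lambda>q. \<beta> q (J q (Z q))) - \<beta> (fst x) (D (app J X) (app J Z) (fst x)))
      - \<epsilon> * (- \<epsilon> * X (fst x) (\<lambda>q. \<beta> q (Z q)) - \<epsilon> * \<beta> (fst x) (J (fst x) (D X (app J Z) (fst x))))
      - (X (fst x) (\<lambda>q. \<beta> q (Z q)) - \<beta> (fst x) (D X Z (fst x)))"
    using b1(2)[OF Z] j2(2)[OF Z] b2(2)[OF app_vf[OF Z]] j3(2)[OF Z] b3(2)[OF app_vf[OF Z]] b4(2)[OF Z] e1 e3
    by (simp add: nijenhuis_def dual_endo_def)
  also have "\<dots> = \<epsilon> * \<beta> (fst x) (D (app J X) (app J Z) (fst x)) - \<epsilon> * \<beta> (fst x) (J (fst x) (D (app J X) Z (fst x)))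
      + (\<epsilon> * \<epsilon>) * X (fst x) (\<lambda>q. \<beta> q (Z q)) + (\<epsilon> * \<epsilon>) * \<beta> (fst x) (J (fst x) (D X (app J Z) (fst x)))
      - X (fst x) (\<lambda>q. \<beta> q (Z q)) + \<beta> (fst x) (D X Z (fst x))"
    by (simp add: algebra_simps)
  also have "\<dots> = \<epsilon> * \<beta> (fst x) (D (app J X) (app J Z) (fst x)) - \<epsilon> * \<beta> (fst x) (J (fst x) (D (app J X) Z (fst x)))
      + \<beta> (fst x) (J (fst x) (D X (app J Z) (fst x))) + \<beta> (fst x) (D X Z (fst x))"
    by (simp add: eps)
  also have "\<dots> = \<beta> (fst x) (scale \<epsilon> (D (app J X) (app J Z) (fst x) - J (fst x) (D (app J X) Z (fst x)))
      + (J (fst x) (D X (app J Z) (fst x)) + D X Z (fst x)))"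
    using d X Z
    by (simp add: cot_add[OF bp] cot_diff[OF bp] cot_scale[OF bp] app_vf
        tangent_add tangent_diff tangent_scale right_diff_distrib)
  also have "scale \<epsilon> (D (app J X) (app J Z) (fst x) - J (fst x) (D (app J X) Z (fst x)))
      + (J (fst x) (D X (app J Z) (fst x)) + D X Z (fst x))
      = (fscale (\<lambda>_. \<epsilon>) (cov_endo D J (app J X) Z) + app J (cov_endo D J X Z)) (fst x)"
    using d X Z by (simp add: cov_endo_def J_diff J_square app_vf fun_eq_iff)
  finally show "nijenhuis TM JE (hlift X) (vlift \<beta>) x (fibre_eval Z) =
      \<beta> (fst x) ((fscale (\<lambda>_. \<epsilon>) (cov_endo D J (app J X) Z) + app J (cov_endo D J X Z)) (fst x))"
    by (simp only: V_def W_def)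
qed

text \<open>Agreement at the single point x is enough for the Nijenhuis tensor, by
  \<open>nijenhuis_cong\<close>.\<close>

lemma tvec_lift_sum:
  assumes V: "V \<in> vector_fields TM" and x: "x \<in> points TM"
  obtains X \<beta> where "X \<in> vector_fields A" "\<beta> \<in> one_forms A" "V x = (hlift X + vlift \<beta>) x"
proof -
  obtain p \<xi> where xx: "x = (p, \<xi>)" "p \<in> points A" "\<xi> \<in> cotangent_space A p"
    using x by (auto simp: points_cotangent_bundle)
  obtain v \<eta> where v: "v \<in> tangent_space A p" "\<eta> \<in> cotangent_space A p" "V x = splitting A D (p, \<xi>) (v, \<eta>)"
    using splitting_surj[OF cot.vf_tangent[OF V x, unfolded xx(1)]] xx(1) by metis
  obtain X where X: "X \<in> vector_fields A" "X p = v" using tvec_extend[OF v(1)] .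
  obtain \<beta> where \<beta>: "\<beta> \<in> one_forms A" "\<beta> p = \<eta>" using covec_extend[OF xx(2) v(2)] .
  have "V x = (hlift X + vlift \<beta>) x"
    using x v(3) by (simp add: hlift_def vlift_def splitting_def xx(1) X \<beta>)
  then show thesis using that X(1) \<beta>(1) by blast
qed

theorem integrable_JE_iff:
  "integrable_acs TM JE \<longleftrightarrow>
    (\<forall>X\<in>vector_fields A. \<forall>Y\<in>vector_fields A. nijenhuis A J X Y = 0) \<and>
    (\<forall>X\<in>vector_fields A. \<forall>Z\<in>vector_fields A.
      fscale (\<lambda>_. \<epsilon>) (cov_endo D J (app J X) Z) + app J (cov_endo D J X Z) = 0) \<and>
    (\<forall>X\<in>vector_fields A. \<forall>Y\<in>vector_fields A. \<forall>Z\<in>vector_fields A.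
      (curvature A D X Y Z - curvature A D (app J X) (app J Y) Z)
      + fscale (\<lambda>_. \<epsilon>) (curvature A D (app J X) Y (app J Z) + curvature A D X (app J Y) (app J Z)) = 0)"
  (is "_ \<longleftrightarrow> ?N \<and> ?C \<and> ?R")
proof
  assume int: "integrable_acs TM JE"
  have zero: "S = 0" if S: "S \<in> vector_fields A"
    and ev: "\<And>p \<xi>. p \<in> points A \<Longrightarrow> \<xi> \<in> cotangent_space A p \<Longrightarrow> \<xi> (S p) = 0" for S
  proof (rule vf_eqI_points[OF S vf_zero])
    fix p assume p: "p \<in> points A"
    have "S p = 0" by (rule covec_separates[OF vf_tangent[OF S p]]) (rule ev[OF p])
    then show "S p = 0 p" by (simp only: zero_fun_apply)
  qed
  have N0: "nijenhuis TM JE V W = 0" if "V \<in> vector_fields TM" "W \<in> vector_fields TM" for V W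
    using int that by (simp add: integrable_acs_def)
  have N: ?N
  proof (intro ballI)
    fix X Y assume X: "X \<in> vector_fields A" and Y: "Y \<in> vector_fields A"
    note b = basicD[OF basic_nijenhuis_hlift[OF X Y]]
    show "nijenhuis A J X Y = 0"
    proof (rule vf_eqI[OF nijenhuis_vf[OF X Y] vf_zero])
      fix p f assume f: "smooth_near A p f"
      \<comment> \<open>Values on functions from the base do not see the covector, so the zero
        covector may serve as test point.\<close>
      have x: "(p, 0) \<in> points TM"
        using smooth_near_points[OF f] cotangent_zero by (simp add: points_cotangent_bundle)
      show "nijenhuis A J X Y p f = 0 p f"
        using lies_overD[OF b(4)[OF x]] f N0[OF basicD(1)[OF basic_hlift[OF X]] basicD(1)[OF basic_hlift[OF Y]]]
        by simp
    qed
  qed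
  moreover have ?C
  proof (intro ballI)
    fix X Z assume X: "X \<in> vector_fields A" and Z: "Z \<in> vector_fields A"
    show "fscale (\<lambda>_. \<epsilon>) (cov_endo D J (app J X) Z) + app J (cov_endo D J X Z) = 0"
    proof (rule zero)
      show "fscale (\<lambda>_. \<epsilon>) (cov_endo D J (app J X) Z) + app J (cov_endo D J X Z) \<in> vector_fields A"
        unfolding cov_endo_def by (intro vf_add vf_diff vf_fscale smooth_function_const D_vf app_vf X Z)
      fix p \<xi> assume p: "p \<in> points A" and xi: "\<xi> \<in> cotangent_space A p"
      \<comment> \<open>Every covector at p is the value of a one-form, so mixed pairs test the
        condition against all covectors; the base point of the tangent space may be any point over
        p.\<close>
      obtain \<beta> where \<beta>: "\<beta> \<in> one_forms A" "\<beta> p = \<xi>" using covec_extend[OF p xi] .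
      have "(p, \<xi>) \<in> points TM" using p xi by (simp add: points_cotangent_bundle)
      from nijenhuis_hlift_vlift(2)[OF X \<beta>(1) this Z]
      show "\<xi> ((fscale (\<lambda>_. \<epsilon>) (cov_endo D J (app J X) Z) + app J (cov_endo D J X Z)) p) = 0"
        unfolding N0[OF basicD(1)[OF basic_hlift[OF X]] verticalD(1)[OF vertical_vlift[OF \<beta>(1)]]] fst_conv \<beta>(2)
        by simp
    qed
  qed
  moreover have ?R
  proof (intro ballI)
    fix X Y Z assume X: "X \<in> vector_fields A" and Y: "Y \<in> vector_fields A" and Z: "Z \<in> vector_fields A"
    note b = basicD[OF basic_nijenhuis_hlift[OF X Y]]
    \<comment> \<open>The first condition removes D_N Z, so that the value on ev_Z contains
      curvature only.\<close>
    have NXY: "D (nijenhuis A J X Y) Z = 0" using N X Y by (simp add: D_zero_left[OF Z])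
    have "D (nijenhuis A J X Y) Z + (curvature A D X Y Z - curvature A D (app J X) (app J Y) Z)
      + fscale (\<lambda>_. \<epsilon>) (curvature A D (app J X) Y (app J Z) + curvature A D X (app J Y) (app J Z)) = 0" (is "?S = 0")
    proof (rule zero[OF b(3)[OF Z]])
      fix p \<xi> assume p: "p \<in> points A" and xi: "\<xi> \<in> cotangent_space A p"
      have "(p, \<xi>) \<in> points TM" using p xi by (simp add: points_cotangent_bundle)
      from b(5)[OF this Z]
      show "\<xi> (?S p) = 0"
        unfolding N0[OF basicD(1)[OF basic_hlift[OF X]] basicD(1)[OF basic_hlift[OF Y]]] fibre_eval_def
        by simp
    qed
    then show "(curvature A D X Y Z - curvature A D (app J X) (app J Y) Z)
      + fscale (\<lambda>_. \<epsilon>) (curvature A D (app J X) Y (app J Z) + curvature A D X (app J Y) (app J Z)) = 0"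
      unfolding NXY by simp
  qed
  ultimately show "?N \<and> ?C \<and> ?R" by blast
next
  assume NCR: "?N \<and> ?C \<and> ?R"
  have hh: "nijenhuis TM JE (hlift X) (hlift Y) x = 0"
    if X: "X \<in> vector_fields A" and Y: "Y \<in> vector_fields A" and x: "x \<in> points TM" for X Y x
  proof -
    note b = basicD[OF basic_nijenhuis_hlift[OF X Y]]
    show ?thesis
    proof (rule cot_tvec_eqI[OF cot.vf_tangent[OF b(1) x] cot.tangent_zero[OF x]])
      show "nijenhuis TM JE (hlift X) (hlift Y) x (\<lambda>x. f (fst x)) = 0 (\<lambda>x. f (fst x))"
        if "smooth_near A (fst x) f" for f
        using lies_overD[OF b(4)[OF x] that] NCR X Y by simp
      show "nijenhuis TM JE (hlift X) (hlift Y) x (fibre_eval Z) = 0 (fibre_eval Z)" if Z: "Z \<in> vector_fields A" for Z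
      proof -
        have "D (nijenhuis A J X Y) Z = 0" using NCR X Y by (simp add: D_zero_left[OF Z])
        then have "D (nijenhuis A J X Y) Z + (curvature A D X Y Z - curvature A D (app J X) (app J Y) Z)
          + fscale (\<lambda>_. \<epsilon>) (curvature A D (app J X) Y (app J Z) + curvature A D X (app J Y) (app J Z)) = 0"
          using NCR X Y Z by (simp only: add_0)
        then show ?thesis using b(5)[OF x Z] fibre_eval_zero[OF x] by (simp only: zero_fun_apply)
      qed
    qed
  qed
  have hv: "nijenhuis TM JE (hlift X) (vlift \<beta>) x = 0"
    if X: "X \<in> vector_fields A" and \<beta>: "\<beta> \<in> one_forms A" and x: "x \<in> points TM" for X \<beta> x
  proof (rule cot_tvec_eqI)
    have "fst x \<in> points A" using x by (auto simp: points_cotangent_bundle)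
    note bp = one_form_cotangent[OF \<beta> this]
    show "nijenhuis TM JE (hlift X) (vlift \<beta>) x \<in> tangent_space TM x"
      by (rule cot.vf_tangent[OF cotJ.nijenhuis_vf x])
        (rule basicD(1)[OF basic_hlift[OF X]], rule verticalD(1)[OF vertical_vlift[OF \<beta>]])
    show "0 \<in> tangent_space TM x" by (rule cot.tangent_zero[OF x])
    show "nijenhuis TM JE (hlift X) (vlift \<beta>) x (\<lambda>x. f (fst x)) = 0 (\<lambda>x. f (fst x))"
      if "smooth_near A (fst x) f" for f
      using lies_overD[OF nijenhuis_hlift_vlift(1)[OF X \<beta> x] that] by simp
    show "nijenhuis TM JE (hlift X) (vlift \<beta>) x (fibre_eval Z) = 0 (fibre_eval Z)" if Z: "Z \<in> vector_fields A" for Z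
    proof -
      have "fscale (\<lambda>_. \<epsilon>) (cov_endo D J (app J X) Z) + app J (cov_endo D J X Z) = 0" using NCR X Z by blast
      from nijenhuis_hlift_vlift(2)[OF X \<beta> x Z, unfolded this] show ?thesis
        using cot_zero[OF bp] by (simp add: zero_fun_def)
    qed
  qed
  have "nijenhuis TM JE V W = 0" if V: "V \<in> vector_fields TM" and W: "W \<in> vector_fields TM" for V W
  proof (rule cotJ.vf_eqI_points[OF cotJ.nijenhuis_vf[OF V W] cot.vf_zero])
    fix x assume x: "x \<in> points TM"
    obtain X \<alpha> where X: "X \<in> vector_fields A" and \<alpha>: "\<alpha> \<in> one_forms A" and Vx: "V x = (hlift X + vlift \<alpha>) x"
      using tvec_lift_sum[OF V x] .
    obtain Y \<beta> where Y: "Y \<in> vector_fields A" and \<beta>: "\<beta> \<in> one_forms A" and Wx: "W x = (hlift Y + vlift \<beta>) x"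
      using tvec_lift_sum[OF W x] .
    note h = basicD(1)[OF basic_hlift[OF X]] basicD(1)[OF basic_hlift[OF Y]]
    note v = verticalD(1)[OF vertical_vlift[OF \<alpha>]] verticalD(1)[OF vertical_vlift[OF \<beta>]]
    note hv' = cot.vf_add[OF h(1) v(1)] cot.vf_add[OF h(2) v(2)]
    have vh: "nijenhuis TM JE (vlift \<alpha>) (hlift Y) x = 0"
      by (simp only: cotJ.nijenhuis_skew[OF h(2) v(1)] uminus_apply hv[OF Y \<alpha> x] minus_zero)
    have "nijenhuis TM JE V W x = nijenhuis TM JE (hlift X + vlift \<alpha>) (hlift Y + vlift \<beta>) x"
      by (rule cotJ.nijenhuis_cong[OF V hv'(1) W hv'(2) x Vx Wx])
    also have "\<dots> = nijenhuis TM JE (hlift X) (hlift Y + vlift \<beta>) x + nijenhuis TM JE (vlift \<alpha>) (hlift Y + vlift \<beta>) x"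
      using cotJ.nijenhuis_add[OF h(1) v(1) hv'(2)] by simp
    also have "\<dots> = 0"
      unfolding cotJ.nijenhuis_add_right[OF h(2) v(2) h(1)] cotJ.nijenhuis_add_right[OF h(2) v(2) v(1)]
        plus_fun_apply hh[OF X Y x] hv[OF X \<beta> x] vh nijenhuis_vlift_vlift[OF \<alpha> \<beta>]
      by (simp add: fun_eq_iff)
    finally show "nijenhuis TM JE V W x = 0 x" by (simp add: fun_eq_iff)
  qed
  then show "integrable_acs TM JE" using acs_JE by (simp add: integrable_acs_def)
qed

end

section \<open>Curvature and almost Hermitian identities\<close>

locale acs_connection = connection_atlas A D + acs_atlas A J
  for A :: "('a, 'e::euclidean_space) chart set" and D and J
begin

lemmas vf_closed = vf_zero vf_add vf_diff vf_uminus app_vf D_vf lie_bracket_vf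

lemma curvature_vf:
  "X \<in> vector_fields A \<Longrightarrow> Y \<in> vector_fields A \<Longrightarrow> Z \<in> vector_fields A \<Longrightarrow> curvature A D X Y Z \<in> vector_fields A"
  by (simp add: curvature_def vf_closed)

lemma cov_endo_vf:
  "X \<in> vector_fields A \<Longrightarrow> Y \<in> vector_fields A \<Longrightarrow> cov_endo D J X Y \<in> vector_fields A"
  by (simp add: cov_endo_def vf_closed)

text \<open>Covariant differentiation of J^2 = -1.\<close>

lemma cov_endo_app:
  assumes "X \<in> vector_fields A" "Y \<in> vector_fields A"
  shows "cov_endo D J X (app J Y) = - app J (cov_endo D J X Y)"
  using assms by (simp add: cov_endo_def app_diff app_square D_uminus_right vf_closed)

lemma lie_bracket_diff_left:
  assumes "X \<in> vector_fields A" "X' \<in> vector_fields A" "Y \<in> vector_fields A"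
  shows "lie_bracket A (X - X') Y = lie_bracket A X Y - lie_bracket A X' Y"
  using lie_bracket_add_left[OF assms(1) vf_uminus[OF assms(2)] assms(3)] lie_bracket_uminus_left[OF assms(2,3)]
  by simp

text \<open>Symmetry, anticommutation with J, and symmetry again: (D_{JX} J) Z = (D_Z J)(JX) = - J
  (D_Z J) X = - J (D_X J) Z.\<close>

lemma special_complex_condition:
  assumes sym: "\<And>X Y. X \<in> vector_fields A \<Longrightarrow> Y \<in> vector_fields A \<Longrightarrow> cov_endo D J X Y - cov_endo D J Y X = 0"
    and X: "X \<in> vector_fields A" and Z: "Z \<in> vector_fields A"
  shows "cov_endo D J (app J X) Z + app J (cov_endo D J X Z) = 0"
proof -
  have "cov_endo D J (app J X) Z = cov_endo D J Z (app J X)"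
    using sym[OF app_vf[OF X] Z] by simp
  also have "\<dots> = - app J (cov_endo D J X Z)"
    using sym[OF Z X] by (simp add: cov_endo_app X Z)
  finally show ?thesis by simp
qed

lemma app_curvature:
  assumes par: "\<And>X Y. X \<in> vector_fields A \<Longrightarrow> Y \<in> vector_fields A \<Longrightarrow> D X (app J Y) = app J (D X Y)"
    and X: "X \<in> vector_fields A" and Y: "Y \<in> vector_fields A" and Z: "Z \<in> vector_fields A"
  shows "curvature A D X Y (app J Z) = app J (curvature A D X Y Z)"
  using X Y Z by (simp add: curvature_def par app_add app_diff app_uminus vf_closed)

text \<open>The Dolbeault operator \<open>\<nabla>\<^sub>X = D\<^sub>X + J D\<^sub>J\<^sub>X\<close> of a Chern connection equals \<open>Z \<mapsto> [X, Z] + J [JX, Z]\<close>.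
  Computing its commutator in both ways shows that the (0,2)-part of the curvature vanishes.\<close>

lemma dolbeault_curvature:
  assumes N: "\<And>X Y. X \<in> vector_fields A \<Longrightarrow> Y \<in> vector_fields A \<Longrightarrow> nijenhuis A J X Y = 0"
    and par: "\<And>X Y. X \<in> vector_fields A \<Longrightarrow> Y \<in> vector_fields A \<Longrightarrow> D X (app J Y) = app J (D X Y)"
    and dolbeault: "\<And>X Y. X \<in> vector_fields A \<Longrightarrow> Y \<in> vector_fields A \<Longrightarrow>
      D X Y + app J (D (app J X) Y) = lie_bracket A X Y + app J (lie_bracket A (app J X) Y)"
    and X: "X \<in> vector_fields A" and Y: "Y \<in> vector_fields A" and Z: "Z \<in> vector_fields A"
  shows "(curvature A D X Y Z - curvature A D (app J X) (app J Y) Z)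
      + (curvature A D (app J X) Y (app J Z) + curvature A D X (app J Y) (app J Z)) = 0"
proof -
  define L where "L = (\<lambda>X Z. D X Z + app J (D (app J X) Z))"
  have L_vf: "L X Z \<in> vector_fields A" if "X \<in> vector_fields A" "Z \<in> vector_fields A" for X Z
    using that by (simp add: L_def vf_closed)
  have L_lie: "L X Z = lie_bracket A X Z + app J (lie_bracket A (app J X) Z)"
    if "X \<in> vector_fields A" "Z \<in> vector_fields A" for X Z
    using dolbeault[OF that] by (simp add: L_def)
  \<comment> \<open>In complex terms, the bracket of X + iJX and Y + iJY is U + iJU: vanishing of
    the Nijenhuis tensor says that its imaginary part is JU. The commutator of the two Dolbeault
    operators should therefore be the one along U.\<close>
  define U where "U = lie_bracket A X Y - lie_bracket A (app J X) (app J Y)"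
  have U: "U \<in> vector_fields A" using X Y by (simp add: U_def vf_closed)
  have "app J (lie_bracket A (app J X) Y) + app J (lie_bracket A X (app J Y)) = - U"
    using N[OF X Y] by (simp add: nijenhuis_def U_def algebra_simps)
  then have "app J (app J (lie_bracket A (app J X) Y + lie_bracket A X (app J Y))) = app J (- U)"
    using X Y by (simp add: app_add vf_closed)
  then have "- (lie_bracket A (app J X) Y + lie_bracket A X (app J Y)) = - app J U"
    using X Y U by (simp add: app_square app_uminus vf_closed)
  then have JU: "app J U = lie_bracket A (app J X) Y + lie_bracket A X (app J Y)"
    by (simp only: neg_equal_iff_equal)
  have D_form: "L X (L Y Z) = D X (D Y Z) + app J (D X (D (app J Y) Z)) + app J (D (app J X) (D Y Z))
      - D (app J X) (D (app J Y) Z)"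
    if "X \<in> vector_fields A" "Y \<in> vector_fields A" for X Y
    using that Z by (simp add: L_def par D_add_right app_add app_square vf_closed)
  have lie_form: "L X (L Y Z) = lie_bracket A X (lie_bracket A Y Z) + app J (lie_bracket A (app J X) (lie_bracket A Y Z))
      + app J (lie_bracket A X (lie_bracket A (app J Y) Z)) - lie_bracket A (app J X) (lie_bracket A (app J Y) Z)"
    if X: "X \<in> vector_fields A" and Y: "Y \<in> vector_fields A" for X Y
  proof -
    define T where "T = lie_bracket A (app J Y) Z"
    have T: "T \<in> vector_fields A" using Y Z by (simp add: T_def vf_closed)
    \<comment> \<open>Commutation with J is clear from the form of L in terms of D with DJ = 0, but
      not from the form with brackets; here the former helps to compute the latter.\<close>
    have "L X (app J T) = app J (L X T)"
      using X T by (simp add: L_def par app_add vf_closed)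
    then have "L X (app J T) = app J (lie_bracket A X T) - lie_bracket A (app J X) T"
      using X T by (simp add: L_lie app_add app_square vf_closed)
    moreover have "L X (L Y Z) = L X (lie_bracket A Y Z) + L X (app J T)"
      unfolding L_lie[OF Y Z] T_def[symmetric]
      using X Y Z T by (simp add: L_def D_add_right app_add vf_closed)
    ultimately show ?thesis
      using X Y Z by (simp add: L_lie T_def vf_closed)
  qed
  have "L X (L Y Z) - L Y (L X Z) = lie_bracket A U Z + app J (lie_bracket A (app J U) Z)"
    unfolding lie_form[OF X Y] lie_form[OF Y X] JU
    unfolding U_def
    using X Y Z by (simp add: lie_bracket_diff_left lie_bracket_add_left lie_bracket_jacobi app_add app_diff vf_closed)
  also have "\<dots> = D U Z + app J (D (app J U) Z)"
    using dolbeault[OF U Z] by simp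
  finally have "L X (L Y Z) - L Y (L X Z) = D U Z + app J (D (app J U) Z)" .
  \<comment> \<open>Comparing the commutator expressed by D with the operator along U leaves exactly
    the curvature of the complexified connection on X + iJX and Y + iJY.\<close>
  then have "(curvature A D X Y Z - curvature A D (app J X) (app J Y) Z)
      + app J (curvature A D (app J X) Y Z + curvature A D X (app J Y) Z) = 0"
    unfolding D_form[OF X Y] D_form[OF Y X] JU
    unfolding U_def
    using X Y Z by (simp add: curvature_def D_diff_left D_add_left app_add app_diff app_uminus vf_closed algebra_simps)
  then show ?thesis
    using X Y Z by (simp add: app_curvature[OF par] app_add curvature_vf vf_closed)
qed

end

section \<open>Metric connections of almost Hermitian structures\<close>

locale metric_acs_connection = acs_connection A D J
  for A :: "('a, 'e::euclidean_space) chart set" and D and J +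
  fixes g :: "'a metric_field"
  assumes almost_hermitian: "almost_hermitian A g J" and metric: "metric_connection A g D"
begin

lemma riemannian: "riemannian_metric A g"
  using almost_hermitian by (simp add: almost_hermitian_def)

lemma g_sym: "u \<in> tangent_space A p \<Longrightarrow> v \<in> tangent_space A p \<Longrightarrow> g p u v = g p v u"
  using riemannian tangent_space_points unfolding riemannian_metric_def by blast

lemma g_add_left: "u \<in> tangent_space A p \<Longrightarrow> v \<in> tangent_space A p \<Longrightarrow> w \<in> tangent_space A p \<Longrightarrow>
    g p (u + v) w = g p u w + g p v w"
  using riemannian tangent_space_points unfolding riemannian_metric_def by blast

lemma g_scale_left: "u \<in> tangent_space A p \<Longrightarrow> v \<in> tangent_space A p \<Longrightarrow> g p (scale r u) v = r * g p u v"
  using riemannian tangent_space_points unfolding riemannian_metric_def by blast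

lemma g_pos: "u \<in> tangent_space A p \<Longrightarrow> u \<noteq> 0 \<Longrightarrow> g p u u > 0"
  using riemannian tangent_space_points unfolding riemannian_metric_def by blast

lemma g_uminus_left: "u \<in> tangent_space A p \<Longrightarrow> v \<in> tangent_space A p \<Longrightarrow> g p (- u) v = - g p u v"
  using g_scale_left[of u p v "-1"] by (simp add: scale_def fun_Compl_def)

lemma g_diff_left: "u \<in> tangent_space A p \<Longrightarrow> v \<in> tangent_space A p \<Longrightarrow> w \<in> tangent_space A p \<Longrightarrow>
    g p (u - v) w = g p u w - g p v w"
  using g_add_left[of u p "- v" w] by (simp add: g_uminus_left tangent_uminus)

lemma g_add_right: "u \<in> tangent_space A p \<Longrightarrow> v \<in> tangent_space A p \<Longrightarrow> w \<in> tangent_space A p \<Longrightarrow>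
    g p w (u + v) = g p w u + g p w v"
  using g_add_left[of u p v w] g_sym[of "u + v" p w] g_sym[of u p w] g_sym[of v p w] tangent_add[of u p v] by simp

lemma g_uminus_right: "u \<in> tangent_space A p \<Longrightarrow> v \<in> tangent_space A p \<Longrightarrow> g p v (- u) = - g p v u"
  using g_uminus_left[of u p v] g_sym[of "- u" p v] g_sym[of u p v] tangent_uminus[of u p] by simp

lemma g_diff_right: "u \<in> tangent_space A p \<Longrightarrow> v \<in> tangent_space A p \<Longrightarrow> w \<in> tangent_space A p \<Longrightarrow>
    g p w (u - v) = g p w u - g p w v"
  using g_add_right[of u p "- v" w] by (simp add: g_uminus_right tangent_uminus)

lemma g_smooth: "X \<in> vector_fields A \<Longrightarrow> Y \<in> vector_fields A \<Longrightarrow> smooth_function A (\<lambda>p. g p (X p) (Y p))"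
  using riemannian by (simp add: riemannian_metric_def)

lemma g_J: "u \<in> tangent_space A p \<Longrightarrow> v \<in> tangent_space A p \<Longrightarrow> g p (J p u) (J p v) = g p u v"
  using almost_hermitian tangent_space_points unfolding almost_hermitian_def by blast

lemma g_J_skew: "u \<in> tangent_space A p \<Longrightarrow> v \<in> tangent_space A p \<Longrightarrow> g p (J p u) v = - g p u (J p v)"
  using g_J[of "J p u" p v] by (simp add: J_square J_tangent g_uminus_left)

lemma D_metric: "X \<in> vector_fields A \<Longrightarrow> Y \<in> vector_fields A \<Longrightarrow> Z \<in> vector_fields A \<Longrightarrow> p \<in> points A \<Longrightarrow>
    X p (\<lambda>q. g q (Y q) (Z q)) = g p (D X Y p) (Z p) + g p (Y p) (D X Z p)"
  using metric by (simp add: metric_connection_def)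

lemma g_nondegenerate:
  assumes S: "S \<in> vector_fields A"
    and zero: "\<And>Z p. Z \<in> vector_fields A \<Longrightarrow> p \<in> points A \<Longrightarrow> g p (S p) (Z p) = 0"
  shows "S = 0"
proof (rule vf_eqI_points[OF S vf_zero])
  fix p assume p: "p \<in> points A"
  have "S p = 0" using g_pos[OF vf_tangent[OF S p]] zero[OF S p] by fastforce
  then show "S p = 0 p" by (simp only: zero_fun_apply)
qed

definition "gDJ X Y Z p = g p (cov_endo D J X Y p) (Z p)"

text \<open>J is skew for g, and differentiating g(JY, Z) = - g(Y, JZ) with a metric connection
  shows that D_X J is skew too.\<close>

lemma gDJ_skew:
  assumes X: "X \<in> vector_fields A" and Y: "Y \<in> vector_fields A" and Z: "Z \<in> vector_fields A" and p: "p \<in> points A"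
  shows "gDJ X Y Z p = - gDJ X Z Y p"
proof -
  note t = vf_tangent[OF _ p]
  have "X p (\<lambda>q. g q (app J Y q) (Z q)) = X p (\<lambda>q. - g q (Y q) (app J Z q))"
    by (rule tvec_cong_points[OF t[OF X]]) (simp add: g_J_skew vf_tangent Y Z)
  also have "\<dots> = - X p (\<lambda>q. g q (Y q) (app J Z q))"
    by (rule tvec_uminus[OF t[OF X] smooth_functionD[OF g_smooth[OF Y app_vf[OF Z]] p]])
  finally have "g p (D X (app J Y) p) (Z p) + g p (app J Y p) (D X Z p)
      = - (g p (D X Y p) (app J Z p) + g p (Y p) (D X (app J Z) p))"
    using D_metric[OF X app_vf[OF Y] Z p] D_metric[OF X Y app_vf[OF Z] p] by simp
  moreover have "g p (app J Y p) (D X Z p) = - g p (Y p) (J p (D X Z p))"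
    using g_J_skew[OF t[OF Y] t[OF D_vf[OF X Z]]] by simp
  moreover have "g p (D X Y p) (app J Z p) = - g p (J p (D X Y p)) (Z p)"
    using g_J_skew[OF t[OF D_vf[OF X Y]] t[OF Z]] by simp
  moreover have "gDJ X Y Z p = g p (D X (app J Y) p) (Z p) - g p (J p (D X Y p)) (Z p)"
    using X Y Z by (simp add: gDJ_def cov_endo_def g_diff_left t J_tangent vf_closed)
  moreover have "gDJ X Z Y p = g p (Y p) (D X (app J Z) p) - g p (Y p) (J p (D X Z p))"
    using X Y Z g_sym[OF t[OF cov_endo_vf[OF X Z]] t[OF Y]]
    by (simp add: gDJ_def cov_endo_def g_diff_right t J_tangent vf_closed)
  ultimately show ?thesis by linarith
qed

lemma gDJ_app:
  assumes X: "X \<in> vector_fields A" and Y: "Y \<in> vector_fields A" and Z: "Z \<in> vector_fields A" and p: "p \<in> points A"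
  shows "gDJ X (app J Y) Z p = gDJ X Y (app J Z) p"
  using vf_tangent[OF cov_endo_vf[OF X Y] p] vf_tangent[OF Z p]
  by (simp add: gDJ_def cov_endo_app[OF X Y] g_uminus_left g_J_skew J_tangent)

lemma gDJ_zeroD:
  assumes "\<And>Z p. Z \<in> vector_fields A \<Longrightarrow> p \<in> points A \<Longrightarrow> gDJ X Y Z p = 0"
    and X: "X \<in> vector_fields A" and Y: "Y \<in> vector_fields A"
  shows "cov_endo D J X Y = 0"
  by (rule g_nondegenerate[OF cov_endo_vf[OF X Y]]) (use assms(1) in \<open>simp add: gDJ_def\<close>)

text \<open>Differentiate g(Z, W) along X and Y in both orders. The mixed terms with one derivative
  on each argument are symmetric in X, Y and cancel; the rest is compared with the derivative along
  the bracket.\<close>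

lemma curvature_skew:
  assumes X: "X \<in> vector_fields A" and Y: "Y \<in> vector_fields A" and Z: "Z \<in> vector_fields A"
    and W: "W \<in> vector_fields A" and p: "p \<in> points A"
  shows "g p (curvature A D X Y Z p) (W p) = - g p (Z p) (curvature A D X Y W p)"
proof -
  define h where "h = (\<lambda>q. g q (Z q) (W q))"
  have h: "smooth_near A p h" unfolding h_def by (rule smooth_functionD[OF g_smooth[OF Z W] p])
  have second: "X p (\<lambda>q. Y q h) = g p (D X (D Y Z) p) (W p) + g p (D Y Z p) (D X W p)
      + g p (D X Z p) (D Y W p) + g p (Z p) (D X (D Y W) p)"
    if X: "X \<in> vector_fields A" and Y: "Y \<in> vector_fields A" for X Y
  proof -
    have "X p (\<lambda>q. Y q h) = X p (\<lambda>q. g q (D Y Z q) (W q) + g q (Z q) (D Y W q))"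
      by (rule tvec_cong_points[OF vf_tangent[OF X p]]) (simp add: h_def D_metric[OF Y Z W])
    also have "\<dots> = X p (\<lambda>q. g q (D Y Z q) (W q)) + X p (\<lambda>q. g q (Z q) (D Y W q))"
      by (rule tvec_add[OF vf_tangent[OF X p] smooth_functionD[OF g_smooth p] smooth_functionD[OF g_smooth p]])
        (use Y Z W in \<open>simp_all add: vf_closed\<close>)
    finally show ?thesis
      using D_metric[OF X D_vf[OF Y Z] W p] D_metric[OF X Z D_vf[OF Y W] p] by simp
  qed
  note t = vf_tangent[OF _ p]
  have "lie_bracket A X Y p h = g p (D (lie_bracket A X Y) Z p) (W p) + g p (Z p) (D (lie_bracket A X Y) W p)"
    unfolding h_def by (rule D_metric[OF lie_bracket_vf[OF X Y] Z W p])
  then have "g p (D X (D Y Z) p) (W p) + g p (Z p) (D X (D Y W) p)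
      - (g p (D Y (D X Z) p) (W p) + g p (Z p) (D Y (D X W) p))
      = g p (D (lie_bracket A X Y) Z p) (W p) + g p (Z p) (D (lie_bracket A X Y) W p)"
    using second[OF X Y] second[OF Y X] by (simp add: lie_bracket_apply[OF h])
  moreover have "g p (curvature A D X Y Z p) (W p) = - g p (D X (D Y Z) p) (W p) + g p (D Y (D X Z) p) (W p)
      + g p (D (lie_bracket A X Y) Z p) (W p)"
    using X Y Z W by (simp add: curvature_def g_add_left g_diff_left g_uminus_left t tangent_add tangent_diff tangent_uminus vf_closed)
  moreover have "g p (Z p) (curvature A D X Y W p) = - g p (Z p) (D X (D Y W) p) + g p (Z p) (D Y (D X W) p)
      + g p (Z p) (D (lie_bracket A X Y) W p)"
    using X Y Z W by (simp add: curvature_def g_add_right g_diff_right g_uminus_right t tangent_add tangent_diff tangent_uminus vf_closed)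
  ultimately show ?thesis by linarith
qed

text \<open>The metric exchanges the (0,2)-part and the (2,0)-part of the curvature.\<close>

lemma chern_curvature:
  assumes N: "\<And>X Y. X \<in> vector_fields A \<Longrightarrow> Y \<in> vector_fields A \<Longrightarrow> nijenhuis A J X Y = 0"
    and par: "\<And>X Y. X \<in> vector_fields A \<Longrightarrow> Y \<in> vector_fields A \<Longrightarrow> D X (app J Y) = app J (D X Y)"
    and dolbeault: "\<And>X Y. X \<in> vector_fields A \<Longrightarrow> Y \<in> vector_fields A \<Longrightarrow>
      D X Y + app J (D (app J X) Y) = lie_bracket A X Y + app J (lie_bracket A (app J X) Y)"
    and X: "X \<in> vector_fields A" and Y: "Y \<in> vector_fields A" and Z: "Z \<in> vector_fields A"
  shows "curvature A D X Y Z = curvature A D (app J X) (app J Y) Z"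
    and "curvature A D (app J X) Y (app J Z) + curvature A D X (app J Y) (app J Z) = 0"
proof -
  define P where "P = (\<lambda>Z. curvature A D X Y Z - curvature A D (app J X) (app J Y) Z)"
  define Q where "Q = (\<lambda>Z. curvature A D (app J X) Y (app J Z) + curvature A D X (app J Y) (app J Z))"
  have vf: "P Z \<in> vector_fields A" "Q Z \<in> vector_fields A" if "Z \<in> vector_fields A" for Z
    using that X Y by (simp_all add: P_def Q_def vf_closed curvature_vf)
  have plus: "P Z + Q Z = 0" if "Z \<in> vector_fields A" for Z
    unfolding P_def Q_def by (rule dolbeault_curvature[OF N par dolbeault X Y that])
  \<comment> \<open>P is skew for g, and Q is symmetric because curvature and J are skew and
    commute. Hence P - Q is minus the adjoint of P + Q.\<close>
  have minus: "P Z - Q Z = 0" if Z: "Z \<in> vector_fields A" for Z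
  proof (rule g_nondegenerate)
    show "P Z - Q Z \<in> vector_fields A" using vf[OF Z] by (rule vf_diff)
    fix W p assume W: "W \<in> vector_fields A" and p: "p \<in> points A"
    note t = vf_tangent[OF _ p]
    have P: "g p (P Z p) (W p) = - g p (Z p) (P W p)"
      using X Y Z W p
      by (simp add: P_def g_diff_left g_diff_right t curvature_vf vf_closed curvature_skew)
    have c: "g p (curvature A D X' Y' (app J Z) p) (W p) = g p (Z p) (curvature A D X' Y' (app J W) p)"
      if "X' \<in> vector_fields A" "Y' \<in> vector_fields A" for X' Y'
      using that Z W p
      by (simp add: app_curvature[OF par] g_J_skew[OF t t] curvature_skew[where W = "app J W", simplified app_apply] t curvature_vf
          curvature_skew[OF that Z app_vf[OF W] p, unfolded app_curvature[OF par that W], simplified])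
    have Q: "g p (Q Z p) (W p) = g p (Z p) (Q W p)"
      using X Y Z W p
      by (simp add: Q_def g_add_left g_add_right t curvature_vf vf_closed c)
    have "g p (Z p) ((P W + Q W) p) = 0"
      using plus[OF W] g_add_right[of 0 p 0 "Z p"] tangent_zero[OF p] t[OF Z] by simp
    then have "g p (Z p) (P W p) + g p (Z p) (Q W p) = 0"
      using vf[OF W] Z by (simp add: g_add_right t)
    then show "g p ((P Z - Q Z) p) (W p) = 0"
      using vf[OF Z] W P Q by (simp add: g_diff_left t)
  qed
  have eq: "P Z = - Q Z" "P Z = Q Z"
    using plus[OF Z] minus[OF Z] by (simp_all add: eq_neg_iff_add_eq_0)
  have "Q Z = 0"
  proof
    fix p show "Q Z p = 0 p"
    proof
      fix f show "Q Z p f = 0 p f" using fun_cong[OF fun_cong[OF eq(1)], of p f] fun_cong[OF fun_cong[OF eq(2)], of p f] by simp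
    qed
  qed
  then show "curvature A D X Y Z = curvature A D (app J X) (app J Y) Z"
    "curvature A D (app J X) Y (app J Z) + curvature A D X (app J Y) (app J Z) = 0"
    using eq(2) by (simp_all add: P_def Q_def)
qed

end

section \<open>The Levi-Civita connection and the Kaehler condition\<close>

locale levi_civita_acs = metric_acs_connection +
  assumes torsion_free: "torsion_free A D"
begin

lemma lie_bracket_D:
  "X \<in> vector_fields A \<Longrightarrow> Y \<in> vector_fields A \<Longrightarrow> lie_bracket A X Y = D X Y - D Y X"
  using torsion_free by (simp add: torsion_free_def torsion_def)

text \<open>Torsion-freeness turns brackets into covariant derivatives; the terms in which J is not
  differentiated cancel by J^2 = -1.\<close>

lemma nijenhuis_cov_endo:
  assumes "X \<in> vector_fields A" "Y \<in> vector_fields A"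
  shows "nijenhuis A J X Y = cov_endo D J (app J X) Y - cov_endo D J (app J Y) X
    - app J (cov_endo D J X Y) + app J (cov_endo D J Y X)"
  using assms
  by (simp add: nijenhuis_def cov_endo_def lie_bracket_D app_diff app_square vf_closed algebra_simps)

text \<open>\<open>b X Y Z = gDJ (JX) Y Z + gDJ X Y (JZ)\<close> is skew in \<open>Y, Z\<close>, and symmetric in \<open>X, Y\<close> if \<open>J\<close> is
  integrable; hence it vanishes.\<close>

lemma integrable_gDJ:
  assumes N: "\<And>X Y. X \<in> vector_fields A \<Longrightarrow> Y \<in> vector_fields A \<Longrightarrow> nijenhuis A J X Y = 0"
    and X: "X \<in> vector_fields A" and Y: "Y \<in> vector_fields A" and Z: "Z \<in> vector_fields A" and p: "p \<in> points A"
  shows "gDJ (app J X) Y Z p = - gDJ X Y (app J Z) p"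
proof -
  define b where "b = (\<lambda>X Y Z. gDJ (app J X) Y Z p + gDJ X Y (app J Z) p)"
  have skew: "b X Y Z = - b X Z Y"
    if "X \<in> vector_fields A" "Y \<in> vector_fields A" "Z \<in> vector_fields A" for X Y Z
    using gDJ_skew[OF app_vf[OF that(1)] that(2,3) p] gDJ_skew[OF that(1,2) app_vf[OF that(3)] p]
      gDJ_app[OF that(1,3,2) p] by (simp add: b_def)
  have sym: "b X Y Z = b Y X Z"
    if X: "X \<in> vector_fields A" and Y: "Y \<in> vector_fields A" and Z: "Z \<in> vector_fields A" for X Y Z
  proof -
    note t = vf_tangent[OF _ p]
    have "cov_endo D J (app J X) Y - cov_endo D J (app J Y) X
        - app J (cov_endo D J X Y) + app J (cov_endo D J Y X) = 0"
      using nijenhuis_cov_endo[OF X Y] N[OF X Y] by simp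
    then have "g p ((cov_endo D J (app J X) Y - cov_endo D J (app J Y) X
        - app J (cov_endo D J X Y) + app J (cov_endo D J Y X)) p) (Z p) = g p 0 (Z p)"
      by (simp only: zero_fun_apply)
    moreover have "g p 0 (Z p) = 0"
      using g_scale_left[OF tangent_zero[OF p] t[OF Z], of 0] by simp
    ultimately show ?thesis
      using X Y Z
      by (simp add: b_def gDJ_def g_add_left g_diff_left t tangent_add tangent_diff J_tangent g_J_skew cov_endo_vf app_vf)
  qed
  \<comment> \<open>Alternating the symmetry and the skewness six times returns to the original
    order after three sign changes.\<close>
  have "b X Y Z = - b X Y Z"
    using sym[OF X Y Z] skew[OF Y X Z] sym[OF Y Z X] skew[OF Z Y X] sym[OF Z X Y] skew[OF X Z Y] by simp
  then show ?thesis by (simp add: b_def)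
qed

lemma integrable_cov_endo:
  assumes N: "\<And>X Y. X \<in> vector_fields A \<Longrightarrow> Y \<in> vector_fields A \<Longrightarrow> nijenhuis A J X Y = 0"
    and X: "X \<in> vector_fields A" and Y: "Y \<in> vector_fields A"
  shows "cov_endo D J (app J X) Y = app J (cov_endo D J X Y)"
proof -
  have "cov_endo D J (app J X) Y - app J (cov_endo D J X Y) = 0"
  proof (rule g_nondegenerate)
    show "cov_endo D J (app J X) Y - app J (cov_endo D J X Y) \<in> vector_fields A"
      by (intro vf_diff app_vf cov_endo_vf X Y)
    fix Z p assume Z: "Z \<in> vector_fields A" and p: "p \<in> points A"
    show "g p ((cov_endo D J (app J X) Y - app J (cov_endo D J X Y)) p) (Z p) = 0"
      using integrable_gDJ[OF N X Y Z p] X Y Z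
      by (simp add: gDJ_def g_diff_left vf_tangent[OF _ p] J_tangent g_J_skew cov_endo_vf app_vf)
  qed
  then show ?thesis by simp
qed

text \<open>For a torsion-free connection the exterior derivative is the cyclic sum of covariant
  derivatives, and with Dg = 0 only J is differentiated.\<close>

lemma ext_deriv2_kaehler_form:
  assumes X: "X \<in> vector_fields A" and Y: "Y \<in> vector_fields A" and Z: "Z \<in> vector_fields A" and p: "p \<in> points A"
  shows "ext_deriv2 A (kaehler_form g J) X Y Z p = gDJ X Y Z p + gDJ Y Z X p + gDJ Z X Y p"
proof -
  note t = vf_tangent[OF _ p]
  have deriv: "X p (kaehler_form g J Y Z) = g p (D X (app J Y) p) (Z p) - g p (J p (D X Z p)) (Y p)"
    if X: "X \<in> vector_fields A" and Y: "Y \<in> vector_fields A" and Z: "Z \<in> vector_fields A" for X Y Z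
    using D_metric[OF X app_vf[OF Y] Z p] g_sym[OF t[OF Y] J_tangent[OF t[OF D_vf[OF X Z]]]] X Y Z
    by (simp add: kaehler_form_def g_J_skew t vf_closed)
  have bracket: "kaehler_form g J (lie_bracket A X Y) Z p = g p (J p (D X Y p)) (Z p) - g p (J p (D Y X p)) (Z p)"
    if X: "X \<in> vector_fields A" and Y: "Y \<in> vector_fields A" and Z: "Z \<in> vector_fields A" for X Y Z
    using X Y Z by (simp add: kaehler_form_def lie_bracket_D J_diff g_diff_left t J_tangent vf_closed)
  have exp: "gDJ X Y Z p = g p (D X (app J Y) p) (Z p) - g p (J p (D X Y p)) (Z p)"
    if "X \<in> vector_fields A" "Y \<in> vector_fields A" "Z \<in> vector_fields A" for X Y Z
    using that by (simp add: gDJ_def cov_endo_def g_diff_left t J_tangent vf_closed)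
  show ?thesis
    unfolding ext_deriv2_def deriv[OF X Y Z] deriv[OF Y Z X] deriv[OF Z X Y]
      bracket[OF X Y Z] bracket[OF Y Z X] bracket[OF Z X Y] exp[OF X Y Z] exp[OF Y Z X] exp[OF Z X Y]
    by linarith
qed

lemma kaehler_parallel:
  assumes K: "kaehler A g J" and Y: "Y \<in> vector_fields A" and Z: "Z \<in> vector_fields A"
  shows "cov_endo D J Y Z = 0"
proof (rule gDJ_zeroD[OF _ Y Z])
  have N: "nijenhuis A J X Y = 0" if "X \<in> vector_fields A" "Y \<in> vector_fields A" for X Y
    using K that by (simp add: kaehler_def hermitian_def integrable_acs_def)
  fix W p assume W: "W \<in> vector_fields A" and p: "p \<in> points A"
  have closed: "gDJ X Y Z p + gDJ Y Z X p + gDJ Z X Y p = 0"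
    if "X \<in> vector_fields A" "Y \<in> vector_fields A" "Z \<in> vector_fields A" for X Y Z
    using K that p ext_deriv2_kaehler_form[OF that p] by (simp add: kaehler_def)
  \<comment> \<open>Adding closedness on (JX, Y, Z) and on (X, Y, JZ) leaves twice this term:
    \<open>integrable_gDJ\<close> and \<open>gDJ_app\<close> make the other four cancel in
    pairs.\<close>
  have aJ: "gDJ Y Z (app J X) p = 0" if X: "X \<in> vector_fields A" for X
    using closed[OF app_vf[OF X] Y Z] closed[OF X Y app_vf[OF Z]] integrable_gDJ[OF N X Y Z p] integrable_gDJ[OF N Z X Y p]
      gDJ_app[OF Z X Y p] gDJ_app[OF Y Z X p] by linarith
  have "gDJ Y Z (app J (app J W)) p = - gDJ Y Z W p"
    using W Y Z by (simp only: gDJ_def app_square uminus_apply g_uminus_right vf_tangent[OF _ p] cov_endo_vf)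
  then show "gDJ Y Z W p = 0" using aJ[OF app_vf[OF W]] by simp
qed

lemma parallel_kaehler:
  assumes N: "\<And>X Y. X \<in> vector_fields A \<Longrightarrow> Y \<in> vector_fields A \<Longrightarrow> nijenhuis A J X Y = 0"
    and par: "\<And>X Y. X \<in> vector_fields A \<Longrightarrow> Y \<in> vector_fields A \<Longrightarrow> cov_endo D J X Y = 0"
  shows "kaehler A g J"
proof -
  have "g p (0 p) (Z p) = 0" if "Z \<in> vector_fields A" "p \<in> points A" for Z p
    using g_scale_left[OF tangent_zero[OF that(2)] vf_tangent[OF that], of 0] by (simp only: scale_zero_left zero_fun_apply mult_zero_left)
  then have "gDJ X Y Z p = 0" if "X \<in> vector_fields A" "Y \<in> vector_fields A" "Z \<in> vector_fields A" "p \<in> points A" for X Y Z p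
    using that by (simp only: gDJ_def par)
  then show ?thesis
    using almost_hermitian acs N by (simp add: kaehler_def hermitian_def integrable_acs_def ext_deriv2_kaehler_form)
qed

text \<open>On the bracket side the derivatives along Y are - D_Y X - J D_Y(JX), which is 0 when J
  is parallel.\<close>

lemma torsion_free_dolbeault:
  assumes par: "\<And>X Y. X \<in> vector_fields A \<Longrightarrow> Y \<in> vector_fields A \<Longrightarrow> D X (app J Y) = app J (D X Y)"
    and X: "X \<in> vector_fields A" and Y: "Y \<in> vector_fields A"
  shows "D X Y + app J (D (app J X) Y) = lie_bracket A X Y + app J (lie_bracket A (app J X) Y)"
  using X Y by (simp add: lie_bracket_D app_diff par app_square vf_closed)

end

section \<open>The corollary\<close>

lemma scale_minus_one: "scale (- 1) v = - v"
  by (simp add: fun_eq_iff)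

lemma fscale_one: "fscale (\<lambda>_. 1) X = X"
  by (simp add: fun_eq_iff)

lemma fscale_minus_one: "fscale (\<lambda>_. - 1) X = - X"
  by (simp add: fun_eq_iff)

theorem corollary34:
  fixes A :: "('a, 'e::euclidean_space) chart set"
    and J :: "'a endo_field"
    and D :: "'a connection"
  assumes "smooth_manifold A"
    and "almost_complex_structure A J"
    and "linear_connection A D"
  shows
    "(special_complex A J D \<longrightarrow> integrable_acs (cotangent_bundle A) (J_plus A J D)) \<and>
     (\<forall>g. almost_hermitian A g J \<and> levi_civita A g D \<longrightarrow>
        (integrable_acs (cotangent_bundle A) (J_plus A J D) \<longleftrightarrow> kaehler A g J) \<and>
        (integrable_acs (cotangent_bundle A) (J_minus A J D) \<longleftrightarrow>
           integrable_acs A J \<and>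
           (\<forall>X\<in>vector_fields A. \<forall>Y\<in>vector_fields A. \<forall>Z\<in>vector_fields A.
              (curvature A D X Y Z - curvature A D (app J X) (app J Y) Z)
              - (curvature A D (app J X) Y (app J Z) + curvature A D X (app J Y) (app J Z)) = 0))) \<and>
     (\<forall>g. hermitian A g J \<and> chern_connection A g J D \<longrightarrow>
        integrable_acs (cotangent_bundle A) (J_plus A J D) \<and>
        integrable_acs (cotangent_bundle A) (J_minus A J D))"
proof -
  interpret bump_atlas A by (rule smooth_manifold_bump_atlas[OF assms(1)])
  interpret acs_connection A D J
    by unfold_locales (rule assms)+
  interpret plus: twisted_cotangent A D J 1 by unfold_locales simp
  interpret minus: twisted_cotangent A D J "- 1" by unfold_locales simp
  have plus: "J_plus A J D = plus.JE"
    by (simp add: J_plus_def plus.JE_def)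
  have minus: "J_minus A J D = minus.JE"
    by (simp add: J_minus_def minus.JE_def scale_minus_one)
  have integrable: "integrable_acs A J \<longleftrightarrow> (\<forall>X\<in>vector_fields A. \<forall>Y\<in>vector_fields A. nijenhuis A J X Y = 0)"
    using assms(2) by (simp add: integrable_acs_def)
  note plus_iff = plus.integrable_JE_iff[folded plus integrable, unfolded fscale_one]
  note minus_iff = minus.integrable_JE_iff[folded minus integrable, unfolded fscale_minus_one]
  \<comment> \<open>Stated by separate properties instead of \<open>chern_connection\<close>, so
    that it serves both Chern connections and the Levi-Civita connection of a Kaehler
    structure.\<close>
  have chern_integrable: "integrable_acs (cotangent_bundle A) (J_plus A J D) \<and>
      integrable_acs (cotangent_bundle A) (J_minus A J D)"
    if herm: "hermitian A g J" and metric: "metric_connection A g D"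
      and par: "\<And>X Y. X \<in> vector_fields A \<Longrightarrow> Y \<in> vector_fields A \<Longrightarrow> cov_endo D J X Y = 0"
      and dolbeault: "\<And>X Y. X \<in> vector_fields A \<Longrightarrow> Y \<in> vector_fields A \<Longrightarrow>
        D X Y + app J (D (app J X) Y) = lie_bracket A X Y + app J (lie_bracket A (app J X) Y)" for g
  proof -
    interpret metric_acs_connection A D J g
      using herm metric by unfold_locales (simp_all add: hermitian_def)
    have int: "integrable_acs A J" using herm by (simp add: hermitian_def)
    then have N: "nijenhuis A J X Y = 0" if "X \<in> vector_fields A" "Y \<in> vector_fields A" for X Y
      using that integrable by blast
    have DJ: "D X (app J Y) = app J (D X Y)" if "X \<in> vector_fields A" "Y \<in> vector_fields A" for X Y
      using par[OF that] by (simp add: cov_endo_def)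
    have curv: "curvature A D X Y Z - curvature A D (app J X) (app J Y) Z = 0"
      "curvature A D (app J X) Y (app J Z) + curvature A D X (app J Y) (app J Z) = 0"
      if "X \<in> vector_fields A" "Y \<in> vector_fields A" "Z \<in> vector_fields A" for X Y Z
      using chern_curvature[OF N DJ dolbeault that] by simp_all
    show ?thesis
      unfolding plus_iff minus_iff using int by (simp add: curv par app_vf app_zero)
  qed
  have special: "integrable_acs (cotangent_bundle A) (J_plus A J D)" if sc: "special_complex A J D"
  proof -
    have "curvature A D X Y Z = 0"
      if "X \<in> vector_fields A" "Y \<in> vector_fields A" "Z \<in> vector_fields A" for X Y Z
      using sc that by (simp add: special_complex_def flat_def)
    moreover have "cov_endo D J (app J X) Z + app J (cov_endo D J X Z) = 0"
      if "X \<in> vector_fields A" "Z \<in> vector_fields A" for X Z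
      by (rule special_complex_condition[OF _ that]) (use sc in \<open>simp add: special_complex_def\<close>)
    ultimately show ?thesis
      unfolding plus_iff using sc by (simp add: special_complex_def app_vf)
  qed
  have lc: "(integrable_acs (cotangent_bundle A) (J_plus A J D) \<longleftrightarrow> kaehler A g J) \<and>
        (integrable_acs (cotangent_bundle A) (J_minus A J D) \<longleftrightarrow>
           integrable_acs A J \<and>
           (\<forall>X\<in>vector_fields A. \<forall>Y\<in>vector_fields A. \<forall>Z\<in>vector_fields A.
              (curvature A D X Y Z - curvature A D (app J X) (app J Y) Z)
              - (curvature A D (app J X) Y (app J Z) + curvature A D X (app J Y) (app J Z)) = 0))"
    if ah: "almost_hermitian A g J" and lc: "levi_civita A g D" for g
  proof -
    interpret levi_civita_acs A D J g
      using ah lc by unfold_locales (simp_all add: levi_civita_def)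
    have cov_int: "cov_endo D J (app J X) Z = app J (cov_endo D J X Z)"
      if "integrable_acs A J" "X \<in> vector_fields A" "Z \<in> vector_fields A" for X Z
      using that integrable by (intro integrable_cov_endo) blast+
    have "kaehler A g J" if "integrable_acs (cotangent_bundle A) (J_plus A J D)"
    proof (rule parallel_kaehler)
      have int: "integrable_acs A J" using that by (simp add: plus_iff)
      then show "nijenhuis A J X Y = 0" if "X \<in> vector_fields A" "Y \<in> vector_fields A" for X Y
        using that integrable by blast
      fix X Y assume X: "X \<in> vector_fields A" and Y: "Y \<in> vector_fields A"
      \<comment> \<open>For \<epsilon> = 1 the mixed condition is a sum whose two terms coincide
        when J is integrable.\<close>
      have "app J (cov_endo D J X Y) + app J (cov_endo D J X Y) = 0"
        using \<open>integrable_acs (cotangent_bundle A) _\<close> X Y cov_int[OF int X Y] unfolding plus_iff by metis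
      then have "app J (cov_endo D J X Y) = 0"
        by (auto simp: fun_eq_iff)
      then have "app J (app J (cov_endo D J X Y)) = 0" by (simp only: app_zero)
      then show "cov_endo D J X Y = 0" by (simp add: app_square cov_endo_vf X Y)
    qed
    moreover have "integrable_acs (cotangent_bundle A) (J_plus A J D)" if K: "kaehler A g J"
    proof -
      have par: "cov_endo D J X Y = 0" if "X \<in> vector_fields A" "Y \<in> vector_fields A" for X Y
        by (rule kaehler_parallel[OF K that])
      have DJ: "D X (app J Y) = app J (D X Y)" if "X \<in> vector_fields A" "Y \<in> vector_fields A" for X Y
        using par[OF that] by (simp add: cov_endo_def)
      have "hermitian A g J" using K by (simp add: kaehler_def)
      then show ?thesis
        using chern_integrable[OF _ metric par torsion_free_dolbeault[OF DJ]] by blast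
    qed
    moreover have "integrable_acs (cotangent_bundle A) (J_minus A J D) \<longleftrightarrow>
           integrable_acs A J \<and>
           (\<forall>X\<in>vector_fields A. \<forall>Y\<in>vector_fields A. \<forall>Z\<in>vector_fields A.
              (curvature A D X Y Z - curvature A D (app J X) (app J Y) Z)
              - (curvature A D (app J X) Y (app J Z) + curvature A D X (app J Y) (app J Z)) = 0)"
      \<comment> \<open>For \<epsilon> = -1 the mixed condition is a difference of these same two
        terms, so it follows from integrability of J.\<close>
      unfolding minus_iff add_uminus_conv_diff using cov_int by auto
    ultimately show ?thesis by blast
  qed
  show ?thesis
  proof (intro conjI[OF _ conjI] allI impI)
    show "special_complex A J D \<Longrightarrow> integrable_acs (cotangent_bundle A) (J_plus A J D)"
      by (rule special)
  next
    fix g assume "almost_hermitian A g J \<and> levi_civita A g D"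
    then show "(integrable_acs (cotangent_bundle A) (J_plus A J D) \<longleftrightarrow> kaehler A g J) \<and>
        (integrable_acs (cotangent_bundle A) (J_minus A J D) \<longleftrightarrow>
           integrable_acs A J \<and>
           (\<forall>X\<in>vector_fields A. \<forall>Y\<in>vector_fields A. \<forall>Z\<in>vector_fields A.
              (curvature A D X Y Z - curvature A D (app J X) (app J Y) Z)
              - (curvature A D (app J X) Y (app J Z) + curvature A D X (app J Y) (app J Z)) = 0))"
      using lc by blast
  next
    fix g assume "hermitian A g J \<and> chern_connection A g J D"
    then show "integrable_acs (cotangent_bundle A) (J_plus A J D) \<and>
        integrable_acs (cotangent_bundle A) (J_minus A J D)"
      by (intro chern_integrable[of g]) (auto simp: chern_connection_def)
  qed
qed

end
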